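(* Let $\mathcal G$ be a Gerstenhaber algebra and $\mathcal H=\underline\bigotimes^+(\mathcal G[1])$. On $S^+(\mathcal H[1])$, the degree $1$ map $m$ and the cobracket $\kappa$ defined in the context satisfy $$(id\otimes m+m\otimes id)\circ\kappa=-\kappa\circ m .$$
   Context: Vector spaces are $\mathbb Z$-graded over a field of characteristic $0$. A Gerstenhaber algebra is a graded vector space $\mathcal G$ with an associative product $\wedge$ of degree $0$, $\alpha\wedge\beta=(-1)^{|\alpha||\beta|}\beta\wedge\alpha$, and a bracket $[\ ,\ ]$ of degree $-1$ such that $(\mathcal G[1],[\ ,\ ])$ is a graded Lie algebra and $[\alpha,\beta\wedge\gamma]=[\alpha,\beta]\wedge\gamma+(-1)^{|\beta|(|\alpha|-1)}\beta\wedge[\alpha,\gamma]$. $V[1]$ is $V$ with degrees lowered by $1$. Koszul rule: exchanging adjacent elements of degrees $x,y$ costs $(-1)^{xy}$; $\varepsilon\binom{\dots}{\dots}$ denotes the resulting sign of a permutation of graded elements; $(f\otimes g)(u\otimes v)=(-1)^{|g||u|}f(u)\otimes g(v)$. For $\alpha_i\in\mathcal G[1]$ of degree $a_i=|\alpha_i|-1$: $Bat(p,q)$ is the set of permutations $\sigma$ of $\{1,\dots,p+q\}$ with $\sigma(1)<\dots<\sigma(p)$, $\sigma(p+1)<\dots<\sigma(p+q)$; $bat_{p,q}(\alpha_1\otimes\dots\otimes\alpha_p,\alpha_{p+1}\otimes\dots\otimes\alpha_{p+q})=\sum_{\sigma\in Bat(p,q)}\varepsilon\binom{a_1\dots a_{p+q}}{a_{\sigma^{-1}(1)}\dots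 a_{\sigma^{-1}(p+q)}}\alpha_{\sigma^{-1}(1)}\otimes\dots\otimes\alpha_{\sigma^{-1}(p+q)}$. $\underline\bigotimes^n(\mathcal G[1])$ is the quotient of $(\mathcal G[1])^{\otimes n}$ by the sum of the images of $bat_{p,n-p}$ ($0<p<n$), with classes written $\alpha_1\underline\otimes\dots\underline\otimes\alpha_n$; $\mathcal H=\bigoplus_{n\ge1}\underline\bigotimes^n(\mathcal G[1])$. In $\mathcal H[1]$ the element $X=\alpha_1\underline\otimes\dots\underline\otimes\alpha_p$ has degree $x=a_1+\dots+a_p-1$. $S^+(\mathcal H[1])$ is the graded symmetric algebra without unit; its product is denoted by a dot, and $X_I=X_{i_1}\cdot\ldots\cdot X_{i_k}$ for $I=\{i_1<\dots<i_k\}$, with degree $x_I$ ($X_\emptyset$ is omitted). With $\mu_2(\alpha,\beta)=(-1)^a\alpha\wedge\beta$ ($a$ the degree of $\alpha$ in $\mathcal G[1]$), let $\mu(\alpha_1\underline\otimes\dots\underline\otimes\alpha_n)=\sum_{0<j<n}(-1)^{a_1+\dots+a_{j-1}}\alpha_1\underline\otimes\dots\underline\otimes\mu_2(\alpha_j,\alpha_{j+1})\underline\otimes\dots\underline\otimes\alpha_n$ (well defined on $\mathcal H$), and $$m(X_1\cdot\ldots\cdot X_n)=\sum_{j=1}^n(-1)^{\sum_{r<j}x_r}X_1\cdot\ldots\cdot\mu(X_j)\cdot\ldots\cdot X_n.$$ Writing $X_s=\alpha_1\underline\otimes\dots\underline\otimes\alpha_p$, the sum "over $U_s\underline\otimes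 V_s=X_s$" means the sum over $0<j<p$ with $U_s=\alpha_1\underline\otimes\dots\underline\otimes\alpha_j$, $V_s=\alpha_{j+1}\underline\otimes\dots\underline\otimes\alpha_p$, of degrees $u_s=a_1+\dots+a_j-1$, $v_s=a_{j+1}+\dots+a_p-1$ in $\mathcal H[1]$. Then $$\begin{aligned}\kappa(X_1\cdot\ldots\cdot X_n)=\sum_{\substack{1\le s\le n\\ I\sqcup J=\{1,\dots,n\}\setminus\{s\}}}(-1)^{\sum_{i<s}x_i}\sum_{U_s\underline\otimes V_s=X_s}(-1)^{u_s+1}\Big(&\varepsilon\tbinom{x_1\dots u_s v_s\dots x_n}{x_I\,u_s\,v_s\,x_J}X_I\cdot U_s\otimes V_s\cdot X_J\\&+\varepsilon\tbinom{x_1\dots u_s v_s\dots x_n}{x_I\,v_s\,u_s\,x_J}X_I\cdot V_s\otimes U_s\cdot X_J\Big),\end{aligned}$$ where $I$ or $J$ may be empty and in the signs $x_s$ is replaced by the pair $u_s,v_s$ in the initial order. $\kappa$ is well defined, of degree $1$. *)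

theory Defs
  imports
    Complex_Main
    "HOL-Library.Poly_Mapping"
    "HOL-Library.Set_Algebras"
    "HOL-Combinatorics.Permutations"
begin

locale graded_vector_space = vector_space scale
  for scale :: "'k::field_char_0 \<Rightarrow> 'g::ab_group_add \<Rightarrow> 'g" +
  fixes grade :: "int \<Rightarrow> 'g set"
  assumes grade_subspace: "subspace (grade n)"
    and grade_direct_sum:
      "\<exists>!f. finite {n. f n \<noteq> 0} \<and> (\<forall>n. f n \<in> grade n) \<and> x = (\<Sum>n | f n \<noteq> 0. f n)"

text \<open>The sign rules of the bracket are those of a graded Lie algebra on the shifted space,
  in which an element of \<open>grade m\<close> has degree \<open>m - 1\<close>.\<close>

locale gerstenhaber_algebra = graded_vector_space scale grade
  for scale :: "'k::field_char_0 \<Rightarrow> 'g::ab_group_add \<Rightarrow> 'g" and grade :: "int \<Rightarrow> 'g set" +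
  fixes wedge :: "'g \<Rightarrow> 'g \<Rightarrow> 'g" and bracket :: "'g \<Rightarrow> 'g \<Rightarrow> 'g"
  assumes wedge_linear_left: "Vector_Spaces.linear scale scale (\<lambda>\<alpha>. wedge \<alpha> \<beta>)"
    and wedge_linear_right: "Vector_Spaces.linear scale scale (\<lambda>\<beta>. wedge \<alpha> \<beta>)"
    and wedge_degree: "\<alpha> \<in> grade m \<Longrightarrow> \<beta> \<in> grade n \<Longrightarrow> wedge \<alpha> \<beta> \<in> grade (m + n)"
    and wedge_assoc: "wedge (wedge \<alpha> \<beta>) \<gamma> = wedge \<alpha> (wedge \<beta> \<gamma>)"
    and wedge_commute: "\<alpha> \<in> grade m \<Longrightarrow> \<beta> \<in> grade n \<Longrightarrow>
      wedge \<alpha> \<beta> = scale ((-1) powi (m * n)) (wedge \<beta> \<alpha>)"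
    and bracket_linear_left: "Vector_Spaces.linear scale scale (\<lambda>\<alpha>. bracket \<alpha> \<beta>)"
    and bracket_linear_right: "Vector_Spaces.linear scale scale (\<lambda>\<beta>. bracket \<alpha> \<beta>)"
    and bracket_degree: "\<alpha> \<in> grade m \<Longrightarrow> \<beta> \<in> grade n \<Longrightarrow> bracket \<alpha> \<beta> \<in> grade (m + n - 1)"
    and bracket_antisym: "\<alpha> \<in> grade m \<Longrightarrow> \<beta> \<in> grade n \<Longrightarrow>
      bracket \<alpha> \<beta> = - scale ((-1) powi ((m - 1) * (n - 1))) (bracket \<beta> \<alpha>)"
    and bracket_jacobi: "\<alpha> \<in> grade l \<Longrightarrow> \<beta> \<in> grade m \<Longrightarrow> \<gamma> \<in> grade n \<Longrightarrow>
      bracket \<alpha> (bracket \<beta> \<gamma>) =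
        bracket (bracket \<alpha> \<beta>) \<gamma> + scale ((-1) powi ((l - 1) * (m - 1))) (bracket \<beta> (bracket \<alpha> \<gamma>))"
    and bracket_leibniz: "\<alpha> \<in> grade l \<Longrightarrow> \<beta> \<in> grade m \<Longrightarrow> \<gamma> \<in> grade n \<Longrightarrow>
      bracket \<alpha> (wedge \<beta> \<gamma>) =
        wedge (bracket \<alpha> \<beta>) \<gamma> + scale ((-1) powi (m * (l - 1))) (wedge \<beta> (bracket \<alpha> \<gamma>))"

text \<open>The free vector space on a set \<open>B\<close> consists of the finitely supported functions
  \<open>x :: 'b \<Rightarrow>\<^sub>0 'k\<close> with \<open>Poly_Mapping.keys x \<subseteq> B\<close>.\<close>

definition pm_scale :: "'k::field \<Rightarrow> ('b \<Rightarrow>\<^sub>0 'k) \<Rightarrow> ('b \<Rightarrow>\<^sub>0 'k)"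
  where "pm_scale c x = Poly_Mapping.map ((*) c) x"

lemma lookup_pm_scale: "Poly_Mapping.lookup (pm_scale c x) b = c * Poly_Mapping.lookup x b"
  by (simp add: pm_scale_def Poly_Mapping.map.rep_eq when_def split: if_splits)

global_interpretation pm: vector_space pm_scale
  defines pm_span = pm.span
  by standard
    (auto intro!: poly_mapping_eqI simp: lookup_pm_scale lookup_add algebra_simps)

abbreviation basis :: "'b \<Rightarrow> ('b \<Rightarrow>\<^sub>0 'k::field)"
  where "basis b \<equiv> Poly_Mapping.single b 1"

definition lin_ext :: "('b \<Rightarrow> ('c \<Rightarrow>\<^sub>0 'k::field)) \<Rightarrow> ('b \<Rightarrow>\<^sub>0 'k) \<Rightarrow> ('c \<Rightarrow>\<^sub>0 'k)"
  where "lin_ext f x = (\<Sum>b\<in>Poly_Mapping.keys x. pm_scale (Poly_Mapping.lookup x b) (f b))"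

text \<open>Elements of a quotient are cosets.  If a linear map \<open>f\<close> sends the subspace of relations
  of the source into the subspace \<open>R'\<close>, then \<open>induced R' f\<close> sends the coset of \<open>x\<close> to
  the coset of \<open>f x\<close>.\<close>

definition quotient_space :: "'b set \<Rightarrow> ('b \<Rightarrow>\<^sub>0 'k::field) set \<Rightarrow> ('b \<Rightarrow>\<^sub>0 'k) set set"
  where "quotient_space B R = {x +o R | x. Poly_Mapping.keys x \<subseteq> B}"

definition induced ::
    "('c \<Rightarrow>\<^sub>0 'k::field) set \<Rightarrow> (('b \<Rightarrow>\<^sub>0 'k) \<Rightarrow> ('c \<Rightarrow>\<^sub>0 'k)) \<Rightarrow> ('b \<Rightarrow>\<^sub>0 'k) set \<Rightarrow> ('c \<Rightarrow>\<^sub>0 'k) set"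
  where "induced R' f C = f ` C + R'"

text \<open>If \<open>V\<close> is the quotient of the free vector space on \<open>B\<close> by the span of \<open>R\<close>, then the
  tensor algebra of \<open>V\<close> is the quotient of the free vector space on \<open>lists B\<close> by the span of
  \<open>tensor_rel B R\<close>.\<close>

definition tensor_rel :: "'b set \<Rightarrow> ('b \<Rightarrow>\<^sub>0 'k::field) set \<Rightarrow> ('b list \<Rightarrow>\<^sub>0 'k) set"
  where "tensor_rel B R =
    {lin_ext (\<lambda>b. basis (u @ b # v)) r | u v r. u \<in> lists B \<and> v \<in> lists B \<and> r \<in> R}"

text \<open>Koszul sign of the rearrangement of graded elements of degrees \<open>ds ! 0, ds ! 1, \<dots>\<close> that
  puts the element number \<open>ps ! i\<close> at place \<open>i\<close>: every pair of elements whose order is reversed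
  is exchanged once.\<close>

definition koszul :: "int list \<Rightarrow> nat list \<Rightarrow> 'k::field"
  where "koszul ds ps =
    (\<Prod>(i, j) \<in> {(i, j). i < j \<and> j < length ps \<and> ps ! j < ps ! i}.
       (-1) powi (ds ! (ps ! i) * ds ! (ps ! j)))"

text \<open>A homogeneous element of \<open>\<G>[1]\<close> is recorded together with its degree: \<open>(a, \<alpha>)\<close> with
  \<open>\<alpha> \<in> grade (a + 1)\<close>.  Thus \<open>\<G>[1]\<close>, the direct sum of its homogeneous components, is the
  quotient of the free vector space on \<open>letters grade\<close> by the span of \<open>letter_rel scale grade\<close>.\<close>

type_synonym 'g letter = "int \<times> 'g"
type_synonym 'g word = "'g letter list"

definition letters :: "(int \<Rightarrow> 'g set) \<Rightarrow> 'g letter set"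
  where "letters grade = {(a, \<alpha>). \<alpha> \<in> grade (a + 1)}"

definition letter_rel ::
    "('k::field \<Rightarrow> 'g::ab_group_add \<Rightarrow> 'g) \<Rightarrow> (int \<Rightarrow> 'g set) \<Rightarrow> ('g letter \<Rightarrow>\<^sub>0 'k) set"
  where "letter_rel scale grade =
    {basis (a, \<alpha> + \<beta>) - basis (a, \<alpha>) - basis (a, \<beta>) | a \<alpha> \<beta>.
       \<alpha> \<in> grade (a + 1) \<and> \<beta> \<in> grade (a + 1)} \<union>
    {basis (a, scale c \<alpha>) - pm_scale c (basis (a, \<alpha>)) | a c \<alpha>. \<alpha> \<in> grade (a + 1)}"

text \<open>Positions are counted from \<open>0\<close>.\<close>

definition Bat :: "nat \<Rightarrow> nat \<Rightarrow> (nat \<Rightarrow> nat) set"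
  where "Bat p q =
    {\<sigma>. \<sigma> permutes {..<p + q} \<and> strict_mono_on {..<p} \<sigma> \<and> strict_mono_on {p..<p + q} \<sigma>}"

definition bat :: "'g word \<Rightarrow> 'g word \<Rightarrow> ('g word \<Rightarrow>\<^sub>0 'k::field)"
  where "bat u v =
    (\<Sum>\<sigma> \<in> Bat (length u) (length v).
       let ps = map (inv \<sigma>) [0..<length u + length v]
       in pm_scale (koszul (map fst (u @ v)) ps) (basis (map ((!) (u @ v)) ps)))"

definition H_words :: "(int \<Rightarrow> 'g set) \<Rightarrow> 'g word set"
  where "H_words grade = lists (letters grade) - {[]}"

definition H_rel ::
    "('k::field \<Rightarrow> 'g::ab_group_add \<Rightarrow> 'g) \<Rightarrow> (int \<Rightarrow> 'g set) \<Rightarrow> ('g word \<Rightarrow>\<^sub>0 'k) set"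
  where "H_rel scale grade = pm_span
    (tensor_rel (letters grade) (letter_rel scale grade) \<union>
     {bat u v | u v. u \<in> H_words grade \<and> v \<in> H_words grade})"

text \<open>The shift from \<open>\<H>\<close> to \<open>\<H>[1]\<close> lowers the degree by \<open>1\<close>.\<close>

definition wdeg :: "'g word \<Rightarrow> int"
  where "wdeg X = sum_list (map fst X) - 1"

text \<open>The list \<open>[X\<^sub>1, \<dots>, X\<^sub>n]\<close> stands for the product of the classes of the words \<open>X\<^sub>i\<close>.\<close>

type_synonym 'g sword = "'g word list"

definition S_words :: "(int \<Rightarrow> 'g set) \<Rightarrow> 'g sword set"
  where "S_words grade = lists (H_words grade) - {[]}"

definition S_rel ::
    "('k::field \<Rightarrow> 'g::ab_group_add \<Rightarrow> 'g) \<Rightarrow> (int \<Rightarrow> 'g set) \<Rightarrow> ('g sword \<Rightarrow>\<^sub>0 'k) set"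
  where "S_rel scale grade = pm_span
    (tensor_rel (H_words grade) (H_rel scale grade) \<union>
     {basis (P @ [X, Y] @ Q) - pm_scale ((-1) powi (wdeg X * wdeg Y)) (basis (P @ [Y, X] @ Q))
       | P Q X Y. P \<in> lists (H_words grade) \<and> Q \<in> lists (H_words grade) \<and>
                  X \<in> H_words grade \<and> Y \<in> H_words grade})"

definition S_plus ::
    "('k::field \<Rightarrow> 'g::ab_group_add \<Rightarrow> 'g) \<Rightarrow> (int \<Rightarrow> 'g set) \<Rightarrow> ('g sword \<Rightarrow>\<^sub>0 'k) set set"
  where "S_plus scale grade = quotient_space (S_words grade) (S_rel scale grade)"

definition sdeg :: "'g sword \<Rightarrow> int"
  where "sdeg P = sum_list (map wdeg P)"

text \<open>The pair \<open>(P, Q)\<close> stands for \<open>P \<otimes> Q\<close>; the tensor product is the quotient of the free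
  vector space on \<open>S_words grade \<times> S_words grade\<close> by \<open>SS_rel scale grade\<close>.\<close>

definition SS_rel ::
    "('k::field \<Rightarrow> 'g::ab_group_add \<Rightarrow> 'g) \<Rightarrow> (int \<Rightarrow> 'g set) \<Rightarrow> ('g sword \<times> 'g sword \<Rightarrow>\<^sub>0 'k) set"
  where "SS_rel scale grade = pm_span
    ({lin_ext (\<lambda>P. basis (P, Q)) r | r Q. r \<in> S_rel scale grade \<and> Q \<in> S_words grade} \<union>
     {lin_ext (\<lambda>Q. basis (P, Q)) r | r P. r \<in> S_rel scale grade \<and> P \<in> S_words grade})"

text \<open>The product \<open>\<mu>\<^sub>2\<close> has degree \<open>1\<close> on \<open>\<G>[1]\<close>.\<close>

definition mu2 ::
    "('k::field \<Rightarrow> 'g \<Rightarrow> 'g) \<Rightarrow> ('g \<Rightarrow> 'g \<Rightarrow> 'g) \<Rightarrow> 'g letter \<Rightarrow> 'g letter \<Rightarrow> 'g letter"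
  where "mu2 scale wedge A B =
    (fst A + fst B + 1, scale ((-1) powi fst A) (wedge (snd A) (snd B)))"

definition mu_word ::
    "('k::field \<Rightarrow> 'g \<Rightarrow> 'g) \<Rightarrow> ('g \<Rightarrow> 'g \<Rightarrow> 'g) \<Rightarrow> 'g word \<Rightarrow> ('g word \<Rightarrow>\<^sub>0 'k)"
  where "mu_word scale wedge X =
    (\<Sum>j | Suc j < length X.
       pm_scale ((-1) powi (\<Sum>i<j. fst (X ! i)))
         (basis (take j X @ [mu2 scale wedge (X ! j) (X ! Suc j)] @ drop (j + 2) X)))"

definition m_sword ::
    "('k::field \<Rightarrow> 'g \<Rightarrow> 'g) \<Rightarrow> ('g \<Rightarrow> 'g \<Rightarrow> 'g) \<Rightarrow> 'g sword \<Rightarrow> ('g sword \<Rightarrow>\<^sub>0 'k)"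
  where "m_sword scale wedge Xs =
    (\<Sum>j<length Xs.
       pm_scale ((-1) powi (\<Sum>r<j. wdeg (Xs ! r)))
         (lin_ext (\<lambda>Y. basis (take j Xs @ [Y] @ drop (Suc j) Xs)) (mu_word scale wedge (Xs ! j))))"

definition m_map ::
    "('k::field \<Rightarrow> 'g::ab_group_add \<Rightarrow> 'g) \<Rightarrow> (int \<Rightarrow> 'g set) \<Rightarrow> ('g \<Rightarrow> 'g \<Rightarrow> 'g) \<Rightarrow>
     ('g sword \<Rightarrow>\<^sub>0 'k) set \<Rightarrow> ('g sword \<Rightarrow>\<^sub>0 'k) set"
  where "m_map scale grade wedge =
    induced (S_rel scale grade) (lin_ext (m_sword scale wedge))"

text \<open>For given \<open>s\<close> and \<open>U\<^sub>s \<otimes> V\<^sub>s = X\<^sub>s\<close>, the list \<open>Y\<close> is \<open>X\<^sub>1, \<dots>, U\<^sub>s, V\<^sub>s, \<dots>, X\<^sub>n\<close>, with \<open>U\<^sub>s\<close> at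
  position \<open>s\<close> and \<open>V\<^sub>s\<close> at position \<open>s + 1\<close>; the sets \<open>I\<close> and \<open>J\<close> are sets of positions in \<open>Y\<close>.\<close>

definition kappa_sword :: "'g sword \<Rightarrow> ('g sword \<times> 'g sword \<Rightarrow>\<^sub>0 'k::field)"
  where "kappa_sword Xs =
    (\<Sum>s<length Xs. \<Sum>I \<in> Pow ({..length Xs} - {s, Suc s}). \<Sum>j \<in> {0<..<length (Xs ! s)}.
       let U = take j (Xs ! s); V = drop j (Xs ! s);
           Y = take s Xs @ [U, V] @ drop (Suc s) Xs;
           ds = map wdeg Y;
           Il = sorted_list_of_set I;
           Jl = sorted_list_of_set ({..length Xs} - {s, Suc s} - I)
       in pm_scale ((-1) powi (\<Sum>i<s. wdeg (Xs ! i)) * (-1) powi (wdeg U + 1))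
            (pm_scale (koszul ds (Il @ [s, Suc s] @ Jl))
               (basis (map ((!) Y) Il @ [U], [V] @ map ((!) Y) Jl)) +
             pm_scale (koszul ds (Il @ [Suc s, s] @ Jl))
               (basis (map ((!) Y) Il @ [V], [U] @ map ((!) Y) Jl))))"

definition kappa ::
    "('k::field \<Rightarrow> 'g::ab_group_add \<Rightarrow> 'g) \<Rightarrow> (int \<Rightarrow> 'g set) \<Rightarrow>
     ('g sword \<Rightarrow>\<^sub>0 'k) set \<Rightarrow> ('g sword \<times> 'g sword \<Rightarrow>\<^sub>0 'k) set"
  where "kappa scale grade = induced (SS_rel scale grade) (lin_ext kappa_sword)"

text \<open>\<open>f \<otimes> g\<close> for \<open>g\<close> of degree \<open>d\<close>, with the Koszul sign for moving \<open>g\<close> past the first factor.\<close>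

definition tensor_map ::
    "int \<Rightarrow> ('g sword \<Rightarrow> ('g sword \<Rightarrow>\<^sub>0 'k::field)) \<Rightarrow> ('g sword \<Rightarrow> ('g sword \<Rightarrow>\<^sub>0 'k)) \<Rightarrow>
     'g sword \<times> 'g sword \<Rightarrow> ('g sword \<times> 'g sword \<Rightarrow>\<^sub>0 'k)"
  where "tensor_map d f g = (\<lambda>(P, Q).
    pm_scale ((-1) powi (d * sdeg P))
      (lin_ext (\<lambda>P'. lin_ext (\<lambda>Q'. basis (P', Q')) (g Q)) (f P)))"

definition id_tensor_m ::
    "('k::field \<Rightarrow> 'g::ab_group_add \<Rightarrow> 'g) \<Rightarrow> (int \<Rightarrow> 'g set) \<Rightarrow> ('g \<Rightarrow> 'g \<Rightarrow> 'g) \<Rightarrow>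
     ('g sword \<times> 'g sword \<Rightarrow>\<^sub>0 'k) set \<Rightarrow> ('g sword \<times> 'g sword \<Rightarrow>\<^sub>0 'k) set"
  where "id_tensor_m scale grade wedge =
    induced (SS_rel scale grade) (lin_ext (tensor_map 1 basis (m_sword scale wedge)))"

definition m_tensor_id ::
    "('k::field \<Rightarrow> 'g::ab_group_add \<Rightarrow> 'g) \<Rightarrow> (int \<Rightarrow> 'g set) \<Rightarrow> ('g \<Rightarrow> 'g \<Rightarrow> 'g) \<Rightarrow>
     ('g sword \<times> 'g sword \<Rightarrow>\<^sub>0 'k) set \<Rightarrow> ('g sword \<times> 'g sword \<Rightarrow>\<^sub>0 'k) set"
  where "m_tensor_id scale grade wedge =
    induced (SS_rel scale grade) (lin_ext (tensor_map 0 (m_sword scale wedge) basis))"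

end

theory Submission
  imports Defs
begin

text \<open>On free words, \<open>\<mu>\<close> is a coderivation of deconcatenation, hence \<open>m\<close> anticommutes with the
    cobracket
  obtained by splitting one word and distributing the others: merging two neighbouring letters
  and splitting at a different place commute up to the Koszul sign of two odd operations.  The
  identity therefore already holds, without relations, for the maps on words, by induction
  on the number of words.

  It descends to the quotients because all maps preserve the relations.  Modulo the relations
  of the letters, \<open>\<mu>\<close> is a derivation of the shuffle product by graded commutativity of \<open>\<wedge>\<close>.
  Deconcatenation is multiplicative for the shuffle product; modulo shuffles only \<open>u \<otimes> v\<close> and its
  exchange survive of the image of a shuffle of \<open>u\<close> and \<open>v\<close>, and they cancel in the
  antisymmetrized cobracket.\<close>

section \<open>Linear extensions\<close>

text \<open>The definitions give \<open>bat\<close> as a sum over permutations and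
  \<open>kappa_sword\<close> as a sum over split positions and subsets, with Koszul signs counted
  over inversions. Such sums resist induction, so every identity is proved for recursions on the
  first letter or first word (\<open>shuf\<close>, \<open>decon\<close>, \<open>unsh\<close>,
  \<open>cobr\<close>), where the sign of a step is that of one element passing an initial block;
  separate bridge results identify the recursions with the sums. A second obstacle is that relations
  form spans and need not be homogeneous, while a Koszul sign depends on the degree of what is
  moved. The relation spaces are therefore shown to be stable under arbitrary degree-dependent
  signs, after which a relation can be moved like a homogeneous element. Two degrees are kept apart:
  \<open>ldeg\<close> is additive on words and \<open>wdeg\<close> is lower by one. The minus sign
  of the theorem and the cancellation of shuffles both come from this shift.\<close>

abbreviation signed :: "int \<Rightarrow> ('b \<Rightarrow>\<^sub>0 'k::field) \<Rightarrow> ('b \<Rightarrow>\<^sub>0 'k)"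
  where "signed n \<equiv> pm_scale ((-1) powi n)"

lemma signed_if: "signed n x = (if even n then x else - x)"
  by (auto simp: power_int_minus_left)

lemma lin_ext_superset:
  assumes "finite A" "Poly_Mapping.keys x \<subseteq> A"
  shows "lin_ext f x = (\<Sum>b\<in>A. pm_scale (Poly_Mapping.lookup x b) (f b))"
  unfolding lin_ext_def
  by (rule sum.mono_neutral_left) (use assms in \<open>auto simp: in_keys_iff\<close>)

lemma lin_ext_add [simp]: "lin_ext f (x + y) = lin_ext f x + lin_ext f y"
proof -
  let ?A = "Poly_Mapping.keys x \<union> Poly_Mapping.keys y"
  have "Poly_Mapping.keys (x + y) \<subseteq> ?A"
    by (rule keys_add)
  then show ?thesis
    by (simp add: lin_ext_superset[of ?A] lookup_add pm.scale_left_distrib sum.distrib)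
qed

lemma keys_pm_scale: "Poly_Mapping.keys (pm_scale c x) \<subseteq> Poly_Mapping.keys x"
  by (auto simp: in_keys_iff lookup_pm_scale)

lemma lin_ext_scale [simp]: "lin_ext f (pm_scale c x) = pm_scale c (lin_ext f x)"
  by (simp add: lin_ext_superset[of "Poly_Mapping.keys x"] keys_pm_scale lookup_pm_scale
      pm.scale_sum_right)

lemma lin_ext_linear: "Vector_Spaces.linear pm_scale pm_scale (lin_ext f)"
  by unfold_locales simp_all

interpretation lin_ext: Vector_Spaces.linear pm_scale pm_scale "lin_ext f"
  by (rule lin_ext_linear)

lemma lin_ext_zero [simp]: "lin_ext f 0 = 0"
  by (rule lin_ext.zero)

lemma lin_ext_uminus [simp]: "lin_ext f (- x) = - lin_ext f x"
  by (rule lin_ext.neg)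

lemma lin_ext_diff [simp]: "lin_ext f (x - y) = lin_ext f x - lin_ext f y"
  by (rule lin_ext.diff)

lemma lin_ext_sum: "lin_ext f (\<Sum>i\<in>A. g i) = (\<Sum>i\<in>A. lin_ext f (g i))"
  by (rule lin_ext.sum)

lemma lin_ext_basis [simp]: "lin_ext f (basis b) = f b"
  by (simp add: lin_ext_def)

text \<open>As a congruence rule it supplies \<open>b \<in> Poly_Mapping.keys y\<close> under the
  sum, so that degrees known only on the support, as in \<open>mu_word_keys\<close>, can evaluate
  signs inside \<open>lin_ext\<close>.\<close>

lemma lin_ext_cong [cong]:
  assumes "x = y" "\<And>b. b \<in> Poly_Mapping.keys y \<Longrightarrow> f b = g b"
  shows "lin_ext f x = lin_ext g y"
  using assms by (simp add: lin_ext_def)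

lemma lin_ext_fun_add [simp]: "lin_ext (\<lambda>b. f b + g b) x = lin_ext f x + lin_ext g x"
  by (simp add: lin_ext_def pm.scale_right_distrib sum.distrib)

lemma lin_ext_fun_scale [simp]: "lin_ext (\<lambda>b. pm_scale c (f b)) x = pm_scale c (lin_ext f x)"
  by (simp add: lin_ext_def pm.scale_sum_right mult.commute)

lemma lin_ext_fun_zero [simp]: "lin_ext (\<lambda>b. 0) x = 0"
  by (simp add: lin_ext_def)

lemma lin_ext_fun_uminus [simp]: "lin_ext (\<lambda>b. - f b) x = - lin_ext f x"
  by (simp add: lin_ext_def pm.scale_right_distrib sum_negf)

lemma lin_ext_fun_diff [simp]: "lin_ext (\<lambda>b. f b - g b) x = lin_ext f x - lin_ext g x"
  by (simp add: lin_ext_def pm.scale_right_diff_distrib sum_subtractf)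

lemma lin_ext_fun_sum: "lin_ext (\<lambda>b. \<Sum>i\<in>A. f i b) x = (\<Sum>i\<in>A. lin_ext (f i) x)"
  by (induction A rule: infinite_finite_induct) simp_all

lemma lin_ext_lin_ext [simp]: "lin_ext f (lin_ext g x) = lin_ext (\<lambda>b. lin_ext f (g b)) x"
  by (simp add: lin_ext_def[of g] lin_ext_sum) (simp add: lin_ext_def)

text \<open>Exchange of two finite sums. Its main use is to bring the sum over a relation to the
  inside, where everything else is a fixed word.\<close>

lemma lin_ext_swap:
  "lin_ext (\<lambda>a. lin_ext (\<lambda>b. f a b) y) x = lin_ext (\<lambda>b. lin_ext (\<lambda>a. f a b) x) y"
proof -
  have "lin_ext (\<lambda>a. lin_ext (\<lambda>b. f a b) y) x =
      (\<Sum>b\<in>Poly_Mapping.keys y. lin_ext (\<lambda>a. pm_scale (Poly_Mapping.lookup y b) (f a b)) x)"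
    by (simp only: lin_ext_def[of _ y] lin_ext_fun_sum)
  then show ?thesis
    by (simp add: lin_ext_def[of _ y])
qed

lemma lin_ext_basis_id [simp]: "lin_ext basis x = x"
proof (rule poly_mapping_eqI)
  fix b
  show "Poly_Mapping.lookup (lin_ext basis x) b = Poly_Mapping.lookup x b"
    by (auto simp: lin_ext_def lookup_sum lookup_pm_scale lookup_single when_def if_distrib
        sum.delta in_keys_iff cong: if_cong)
qed

definition supp_on :: "'b set \<Rightarrow> ('b \<Rightarrow>\<^sub>0 'k::field) set"
  where "supp_on A = {x. Poly_Mapping.keys x \<subseteq> A}"

lemma supp_on_subspace: "pm.subspace (supp_on A)"
proof (rule pm.subspaceI)
  fix c :: 'a and x y :: "'b \<Rightarrow>\<^sub>0 'a"
  assume "x \<in> supp_on A"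
  then show "pm_scale c x \<in> supp_on A"
    using keys_pm_scale[of c x] by (auto simp: supp_on_def)
  assume "y \<in> supp_on A"
  with \<open>x \<in> supp_on A\<close> show "x + y \<in> supp_on A"
    using keys_add[of x y] by (auto simp: supp_on_def)
qed (simp add: supp_on_def)

lemma supp_on_basis [simp]: "(basis b :: 'b \<Rightarrow>\<^sub>0 'k::field) \<in> supp_on A \<longleftrightarrow> b \<in> A"
  by (simp add: supp_on_def)

lemma supp_onD: "x \<in> supp_on A \<Longrightarrow> b \<in> Poly_Mapping.keys x \<Longrightarrow> b \<in> A"
  by (auto simp: supp_on_def)

lemma lin_ext_in_subspace:
  assumes "pm.subspace W" "\<And>b. b \<in> Poly_Mapping.keys x \<Longrightarrow> f b \<in> W"
  shows "lin_ext f x \<in> W"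
  unfolding lin_ext_def
  by (intro pm.subspace_sum pm.subspace_scale assms)

text \<open>The induction rules for the various spaces of relations rest on this reduction to
  generators.\<close>

lemma lin_ext_span_in_subspace:
  assumes "x \<in> pm.span G" "pm.subspace W" "\<And>g. g \<in> G \<Longrightarrow> lin_ext f g \<in> W"
  shows "lin_ext f x \<in> W"
  using assms(1)
proof (induction rule: pm.span_induct_alt)
  case base
  show ?case
    using assms(2) by (simp add: pm.subspace_0)
next
  case (step c x y)
  then show ?case
    using assms(2,3) by (simp add: pm.subspace_add pm.subspace_scale)
qed

section \<open>Deconcatenation and shuffles\<close>

definition ldeg :: "'g word \<Rightarrow> int"
  where "ldeg w = sum_list (map fst w)"

lemma ldeg_simps [simp]: "ldeg [] = 0" "ldeg (a # w) = fst a + ldeg w" "ldeg (u @ v) =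
    ldeg u + ldeg v"
  by (simp_all add: ldeg_def)

lemma wdeg_ldeg: "wdeg w = ldeg w - 1"
  by (simp add: wdeg_def ldeg_def)

fun decon :: "'g word \<Rightarrow> ('g word \<times> 'g word \<Rightarrow>\<^sub>0 'k::field)"
  where
    "decon [] = basis ([], [])"
  | "decon (a # w) = basis ([], a # w) + lin_ext (\<lambda>(p, q). basis (a # p, q)) (decon w)"

text \<open>The signed shuffle product by first letters: \<open>b\<close> comes first by passing all
  of \<open>a # u\<close>, hence the sign.\<close>

fun shuf :: "'g word \<Rightarrow> 'g word \<Rightarrow> ('g word \<Rightarrow>\<^sub>0 'k::field)"
  where
    "shuf [] v = basis v"
  | "shuf (a # u) [] = basis (a # u)"
  | "shuf (a # u) (b # v) = lin_ext (\<lambda>w. basis (a # w)) (shuf u (b # v)) +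
       signed (fst b * ldeg (a # u)) (lin_ext (\<lambda>w. basis (b # w)) (shuf (a # u) v))"

lemma shuf_Nil2 [simp]: "shuf u [] = basis u"
  by (cases u) simp_all

lemma supp_on_intros:
  "(0 :: 'b \<Rightarrow>\<^sub>0 'k::field) \<in> supp_on A"
  "x \<in> supp_on A \<Longrightarrow> y \<in> supp_on A \<Longrightarrow> x + y \<in> supp_on A"
  "x \<in> supp_on A \<Longrightarrow> pm_scale c x \<in> supp_on A"
  "(\<And>b. b \<in> Poly_Mapping.keys z \<Longrightarrow> f b \<in> supp_on A) \<Longrightarrow> lin_ext f z \<in> supp_on A"
  "(\<And>i. i \<in> S \<Longrightarrow> h i \<in> supp_on A) \<Longrightarrow> sum h S \<in> supp_on A"
  by (simp_all add: supp_on_subspace pm.subspace_0 pm.subspace_add pm.subspace_scale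
      lin_ext_in_subspace pm.subspace_sum)

lemma decon_supp: "(decon w :: _ \<Rightarrow>\<^sub>0 'k::field) \<in> supp_on {(p, q). p @ q = w}"
proof (induction w)
  case (Cons a w)
  then show ?case
    by (auto intro!: supp_on_intros dest: supp_onD)
qed simp

lemma decon_keys: "b \<in> Poly_Mapping.keys (decon w) \<Longrightarrow> fst b @ snd b = w"
  using supp_onD[OF decon_supp] by fastforce

lemma shuf_supp: "(shuf u v :: _ \<Rightarrow>\<^sub>0 'k::field) \<in> supp_on {w. mset w = mset u + mset v}"
proof (induction u v rule: shuf.induct)
  case (3 a u b v)
  then show ?case
    by (auto intro!: supp_on_intros dest: supp_onD)
qed simp_all

lemma ldeg_mset: "mset u = mset v \<Longrightarrow> ldeg u = ldeg v"
  unfolding ldeg_def by (metis mset_map sum_mset_sum_list)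

lemma shuf_keys:
  assumes "w \<in> Poly_Mapping.keys (shuf u v)"
  shows "mset w = mset u + mset v" "ldeg w = ldeg u + ldeg v"
proof -
  show *: "mset w = mset u + mset v"
    using supp_onD[OF shuf_supp assms] by simp
  then show "ldeg w = ldeg u + ldeg v"
    using ldeg_mset[of w "u @ v"] by simp
qed

text \<open>A cut of a shuffle cuts \<open>u\<close> and \<open>v\<close>, and what lies before the
  cut is a shuffle of \<open>u1\<close> and \<open>v1\<close>; the sign is that of moving
  \<open>v1\<close> past \<open>u2\<close>. The induction looks at the first letter of the shuffle,
  and only the cut with empty left part bypasses the induction hypotheses.\<close>

lemma decon_shuf:
  "lin_ext decon (shuf u v) =
    lin_ext (\<lambda>(u1, u2). lin_ext (\<lambda>(v1, v2). signed (ldeg u2 * ldeg v1)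
      (lin_ext (\<lambda>p. lin_ext (\<lambda>q. basis (p, q)) (shuf u2 v2)) (shuf u1 v1))) (decon v)) (decon u)"
proof (induction u v rule: shuf.induct)
  case (3 a u b v)
  have *: "lin_ext (\<lambda>w. lin_ext (\<lambda>x. basis (c # fst x, snd x)) (decon w)) z =
      lin_ext (\<lambda>x. basis (c # fst x, snd x)) (lin_ext decon z)" for c and z :: "'a word \<Rightarrow>\<^sub>0 'b"
    by simp
  show ?case
    apply (simp only: shuf.simps lin_ext_add lin_ext_scale lin_ext_lin_ext lin_ext_basis
        decon.simps lin_ext_fun_add case_prod_unfold * 3 fst_conv snd_conv)
    apply (simp add: case_prod_unfold algebra_simps)
    \<comment> \<open>Signs go back under the sums, where \<open>decon_keys\<close> recovers the
      degrees of \<open>u\<close> and \<open>v\<close> from those of their parts.\<close>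
    apply (simp only: lin_ext_fun_scale[symmetric] pm.scale_scale)
    apply (intro arg_cong2[where f="(+)"] lin_ext_cong refl)
    apply (auto dest!: decon_keys simp: signed_if power_int_minus_left simp flip: power_int_add)
    done
qed (simp_all add: case_prod_unfold)

section \<open>The map \<open>mu\<close> against deconcatenation and shuffles\<close>

lemma mu_word_Nil [simp]: "mu_word sc wd [] = 0"
  by (simp add: mu_word_def)

fun merge :: "('k::field \<Rightarrow> 'g \<Rightarrow> 'g) \<Rightarrow> ('g \<Rightarrow> 'g \<Rightarrow> 'g) \<Rightarrow> 'g letter \<Rightarrow> 'g word \<Rightarrow> ('g word \<Rightarrow>\<^sub>0 'k)"
  where
    "merge sc wd a [] = 0"
  | "merge sc wd a (b # w) = basis (mu2 sc wd a b # w)"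

text \<open>The summand \<open>j = 0\<close> multiplies \<open>a\<close> into its neighbour; in all
  others the odd map \<open>mu2\<close> passes \<open>a\<close>, which costs
  \<open>(-1)^(fst a)\<close>.\<close>

lemma mu_word_Cons [simp]:
  fixes w :: "'g word"
  shows "mu_word sc wd (a # w) =
    merge sc wd a w + signed (fst a) (lin_ext (\<lambda>x. basis (a # x)) (mu_word sc wd w))"
proof (cases w)
  case Nil
  then show ?thesis by (simp add: mu_word_def)
next
  case (Cons b v)
  have *: "{j. Suc j < length (c # x)} = {..<length x}" for c and x :: "'g word"
    by auto
  have shift: "(\<Sum>i<Suc j. fst ((a # b # v) ! i)) = fst a + (\<Sum>i<j. fst ((b # v) ! i))" for j
    by (subst sum.lessThan_Suc_shift) simp
  have "mu_word sc wd (a # b # v) = basis (mu2 sc wd a b # v) +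
    (\<Sum>j<length v. pm_scale ((-1) powi (\<Sum>i<Suc j. fst ((a # b # v) ! i)))
      (basis (a # take j (b # v) @ [mu2 sc wd ((b # v) ! j) ((b # v) ! Suc j)] @ drop (j +
          2) (b # v))))"
    unfolding mu_word_def * by (simp add: sum.lessThan_Suc_shift del: sum.lessThan_Suc)
  also have "\<dots> = basis (mu2 sc wd a b # v) +
      signed (fst a) (lin_ext (\<lambda>x. basis (a # x)) (mu_word sc wd (b # v)))"
    unfolding mu_word_def[of _ _ "b # v"] * shift
    by (simp add: power_int_add lin_ext_sum pm.scale_sum_right)
  finally show ?thesis
    by (simp add: Cons)
qed

lemma merge_supp:
  "merge sc wd a w \<in> supp_on {x. x \<noteq> [] \<and> ldeg x = fst a + ldeg w + 1}"
  by (cases w) (simp_all add: mu2_def supp_on_intros)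

lemma mu_word_supp:
  "mu_word sc wd w \<in> supp_on {x. x \<noteq> [] \<and> ldeg x = ldeg w + 1}"
proof (induction w)
  case (Cons a w)
  then show ?case
    using merge_supp[of sc wd a w]
    by (auto intro!: supp_on_intros dest: supp_onD simp: add_ac)
qed (simp add: supp_on_intros)

lemma mu_word_keys:
  assumes "x \<in> Poly_Mapping.keys (mu_word sc wd w)"
  shows "ldeg x = ldeg w + 1" "x \<noteq> []"
  using supp_onD[OF mu_word_supp assms] by auto

text \<open>No cut separates the two merged letters. On the right this is matched by
  \<open>merge\<close> vanishing on \<open>p = []\<close>, the cut directly after
  \<open>a\<close>.\<close>

lemma decon_merge:
  "lin_ext decon (merge sc wd a w) =
    lin_ext (\<lambda>x. basis ([], x)) (merge sc wd a w) +
    lin_ext (\<lambda>(p, q). lin_ext (\<lambda>x. basis (x, q)) (merge sc wd a p)) (decon w)"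
  by (cases w) (simp_all add: case_prod_unfold)

lemma decon_mu_word:
  "lin_ext decon (mu_word sc wd w) =
    lin_ext (\<lambda>(p, q). lin_ext (\<lambda>x. basis (x, q)) (mu_word sc wd p) +
      signed (ldeg p) (lin_ext (\<lambda>x. basis (p, x)) (mu_word sc wd q))) (decon w)"
proof (induction w)
  case (Cons a w)
  have *: "lin_ext (\<lambda>w. lin_ext (\<lambda>x. basis (c # fst x, snd x)) (decon w)) z =
      lin_ext (\<lambda>x. basis (c # fst x, snd x)) (lin_ext decon z)" for c and z :: "'a word \<Rightarrow>\<^sub>0 'b"
    by simp
  show ?case
    apply (simp only: mu_word_Cons lin_ext_add lin_ext_scale lin_ext_lin_ext lin_ext_basis
        decon.simps lin_ext_fun_add case_prod_unfold * Cons fst_conv snd_conv decon_merge)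
    apply (simp add: case_prod_unfold algebra_simps)
    apply (simp only: lin_ext_fun_scale[symmetric] pm.scale_scale)
    apply (simp add: power_int_add)
    done
qed (simp add: case_prod_unfold)

text \<open>First of four expansions of a merge at the head of a shuffle. Writing \<open>hd\<close>
  and \<open>tl\<close> under an \<open>if\<close> makes equal terms literally equal, so that they
  cancel in \<open>mu_defect_Cons\<close> and only the merges of \<open>a\<close> with
  \<open>b\<close> remain.\<close>

lemma merge_shuf_right:
  "lin_ext (merge sc wd a) (shuf u (b # v)) =
    lin_ext (\<lambda>x. basis (mu2 sc wd a (hd u) # x)) (if u = [] then 0 else shuf (tl u) (b # v)) +
    signed (fst b * ldeg u) (lin_ext (\<lambda>x. basis (mu2 sc wd a b # x)) (shuf u v))"
  by (cases u) (simp_all)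

lemma merge_shuf_left:
  "lin_ext (merge sc wd b) (shuf (a # u) v) =
    lin_ext (\<lambda>x. basis (mu2 sc wd b a # x)) (shuf u v) +
    lin_ext (\<lambda>x. basis (mu2 sc wd b (hd v) # x))
      (if v = [] then 0 else signed (fst (hd v) * ldeg (a # u)) (shuf (a # u) (tl v)))"
  by (cases v) (simp_all)

lemma shuf_merge_left:
  "lin_ext (\<lambda>w. shuf w (b # v)) (merge sc wd a u) =
    lin_ext (\<lambda>x. basis (mu2 sc wd a (hd u) # x)) (if u = [] then 0 else shuf (tl u) (b # v)) +
    signed (fst b * (ldeg (a # u) + 1))
      (lin_ext (\<lambda>x. basis (b # x)) (lin_ext (\<lambda>w. shuf w v) (merge sc wd a u)))"
  by (cases u) (simp_all add: mu2_def algebra_simps)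

lemma shuf_merge_right:
  "lin_ext (shuf (a # u)) (merge sc wd b v) =
    lin_ext (\<lambda>x. basis (a # x)) (lin_ext (shuf u) (merge sc wd b v)) +
    signed ((fst b + 1) * ldeg (a # u)) (lin_ext (\<lambda>x. basis (mu2 sc wd b (hd v) # x))
      (if v = [] then 0 else signed (fst (hd v) * ldeg (a # u)) (shuf (a # u) (tl v))))"
  by (cases v) (simp_all add: mu2_def algebra_simps power_int_add)

text \<open>The failure of \<open>\<mu>\<close> to be a derivation of the shuffle product.  By \<open>mu_defect_Cons\<close> it
  comes only from merging a letter of \<open>u\<close> with a letter of \<open>v\<close> in both orders, which is a relation
  because \<open>\<mu>\<^sub>2\<close> is graded anticommutative.\<close>

definition mu_defect ::
    "('k::field \<Rightarrow> 'g \<Rightarrow> 'g) \<Rightarrow> ('g \<Rightarrow> 'g \<Rightarrow> 'g) \<Rightarrow> 'g word \<Rightarrow> 'g word \<Rightarrow> ('g word \<Rightarrow>\<^sub>0 'k)"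
  where "mu_defect sc wd u v = lin_ext (mu_word sc wd) (shuf u v) -
    lin_ext (\<lambda>w. shuf w v) (mu_word sc wd u) -
    signed (ldeg u) (lin_ext (shuf u) (mu_word sc wd v))"

lemma mu_defect_Cons:
  "mu_defect sc wd (a # u) (b # v) =
    signed (fst a) (lin_ext (\<lambda>x. basis (a # x)) (mu_defect sc wd u (b # v))) +
    signed (fst b * (ldeg (a # u) + 1)) (lin_ext (\<lambda>x. basis (b # x)) (mu_defect sc wd (a # u) v)) +
    signed (fst b * ldeg u) (lin_ext (\<lambda>x. basis (mu2 sc wd a b # x) +
      signed (fst a * fst b) (basis (mu2 sc wd b a # x))) (shuf u v))"
proof -
  let ?c = "\<lambda>a x. lin_ext (\<lambda>w. basis (a # w)) x"
  let ?mu = "mu_word sc wd"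
  have 1: "lin_ext ?mu (shuf (a # u) (b # v)) =
      lin_ext (merge sc wd a) (shuf u (b # v)) +
          signed (fst a) (?c a (lin_ext ?mu (shuf u (b # v)))) +
      signed (fst b * ldeg (a # u)) (lin_ext (merge sc wd b) (shuf (a # u) v) +
        signed (fst b) (?c b (lin_ext ?mu (shuf (a # u) v))))"
    by (simp add: pm.scale_right_distrib)
  have 2: "lin_ext (\<lambda>w. shuf w (b # v)) (?c a (?mu u)) =
      ?c a (lin_ext (\<lambda>w. shuf w (b # v)) (?mu u)) +
      signed (fst b * (ldeg (a # u) + 1)) (?c b (lin_ext (\<lambda>w. shuf w v) (?c a (?mu u))))"
    by (simp add: mu_word_keys algebra_simps)
  have 3: "lin_ext (shuf (a # u)) (?c b (?mu v)) =
      ?c a (lin_ext (shuf u) (?c b (?mu v))) +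
      signed (fst b * ldeg (a # u)) (?c b (lin_ext (shuf (a # u)) (?mu v)))"
    by simp
  show ?thesis
    unfolding mu_defect_def 1 merge_shuf_right merge_shuf_left 
    apply (simp only: mu_word_Cons lin_ext_add lin_ext_scale 2 3 shuf_merge_left shuf_merge_right)
    apply (simp only: lin_ext_diff lin_ext_scale lin_ext_add lin_ext_fun_add lin_ext_fun_scale)
    \<comment> \<open>The signs in front of matching terms depend only on these three
      parities.\<close>
    apply (cases "even (fst a)"; cases "even (fst b)"; cases "even (ldeg u)")
    apply (simp_all add: signed_if algebra_simps del: lin_ext_lin_ext)
    done
qed

section \<open>The maps bat and recursive shuffles\<close>

lemma koszul_Nil [simp]: "koszul ds [] = 1"
  by (simp add: koszul_def)

text \<open>An inversion either involves place \<open>0\<close>, and then pairs \<open>p\<close>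
  with a later smaller entry, or is an inversion of \<open>ps\<close> shifted by one place.\<close>

lemma koszul_Cons:
  "(koszul ds (p # ps) :: 'k::field) =
    (-1) powi (ds ! p * sum_list (map ((!) ds) (filter (\<lambda>q. q < p) ps))) * koszul ds ps"
proof -
  let ?S = "\<lambda>qs. {(i, j). i < j \<and> j < length qs \<and> qs ! j < qs ! i}"
  let ?f = "\<lambda>qs (i, j). (-1 :: 'k) powi (ds ! (qs ! i) * ds ! (qs ! j))"
  let ?J = "{j. j < length ps \<and> ps ! j < p}"
  have fin: "finite (?S qs)" for qs
    by (rule finite_subset[of _ "{..<length qs} \<times> {..<length qs}"]) auto
  have S: "?S (p # ps) = Pair 0 ` Suc ` ?J \<union> map_prod Suc Suc ` ?S ps"
  proof (intro set_eqI iffI; clarify)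
    fix i j assume "i < j" "j < length (p # ps)" "(p # ps) ! j < (p # ps) ! i"
      "(i, j) \<notin> map_prod Suc Suc ` ?S ps"
    then show "(i, j) \<in> Pair 0 ` Suc ` ?J"
      by (cases i; cases j) (auto simp: map_prod_def image_iff)
  qed auto
  have list: "(\<Prod>j\<in>?J. (-1 :: 'k) powi (c * ds ! (ps ! j))) =
      (-1) powi (c * sum_list (map ((!) ds) (filter (\<lambda>q. q < p) ps)))" for c
  proof -
    have "(\<Prod>j\<in>?J. (-1 :: 'k) powi (c * ds ! (ps ! j))) =
        (\<Prod>j<length ps. if ps ! j < p then (-1 :: 'k) powi (c * ds ! (ps ! j)) else 1)"
      by (rule prod.mono_neutral_cong_left) auto
    also have "\<dots> = prod_list (map (\<lambda>q. if q < p then (-1 :: 'k) powi (c * ds ! q) else 1) ps)"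
      by (simp add: prod.list_conv_set_nth atLeast0LessThan)
    also have "\<dots> = (-1) powi (c * sum_list (map ((!) ds) (filter (\<lambda>q. q < p) ps)))"
      by (induction ps) (auto simp: power_int_add distrib_left)
    finally show ?thesis .
  qed
  have "koszul ds (p # ps) = prod (?f (p # ps)) (Pair 0 ` Suc ` ?J) *
      prod (?f (p # ps)) (map_prod Suc Suc ` ?S ps)"
    unfolding koszul_def S by (rule prod.union_disjoint) (auto intro: finite_imageI fin)
  also have "prod (?f (p # ps)) (Pair 0 ` Suc ` ?J) =
      (-1) powi (ds ! p * sum_list (map ((!) ds) (filter (\<lambda>q. q < p) ps)))"
    by (subst prod.reindex, simp add: inj_on_def)+ (simp add: list)
  also have "prod (?f (p # ps)) (map_prod Suc Suc ` ?S ps) = koszul ds ps"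
    by (subst prod.reindex) (auto simp: koszul_def inj_on_def intro!: prod.cong)
  finally show ?thesis .
qed

lemma koszul_strict_sorted: "sorted_wrt (<) ps \<Longrightarrow> koszul ds ps = 1"
proof (induction ps)
  case (Cons p ps)
  then have "filter (\<lambda>q. q < p) ps = []"
    by (auto simp: filter_empty_conv)
  with Cons show ?case
    by (simp add: koszul_Cons)
qed simp

text \<open>Since \<open>A @ B\<close> increases, an entry of \<open>A\<close> taken first has no
  smaller entry after it, while the first entry of \<open>B\<close> passes exactly what is left of
  \<open>A\<close>. These are the two signs in the recursion of \<open>shuf\<close>.\<close>

lemma sum_shuffles_koszul:
  assumes "sorted_wrt (<) (A @ B)" "\<And>i. i \<in> set (A @ B) \<Longrightarrow> ds ! i = fst (f i)"
  shows "(\<Sum>ps\<in>shuffles A B. pm_scale (koszul ds ps) (basis (map f ps))) =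
    (shuf (map f A) (map f B) :: _ \<Rightarrow>\<^sub>0 'k::field)"
  using assms
proof (induction A B rule: shuffles.induct)
  case (3 a A b B)
  let ?t = "\<lambda>ps. pm_scale (koszul ds ps) (basis (map f ps)) :: _ \<Rightarrow>\<^sub>0 'k"
  have "a < q" if "ps \<in> shuffles A (b # B)" "q \<in> set ps" for ps q
    using 3(3) set_shuffles[OF that(1)] that(2) by auto
  then have "filter (\<lambda>q. q < a) ps = []" if "ps \<in> shuffles A (b # B)" for ps
    using that by (meson filter_False less_asym)
  then have *: "koszul ds (a # ps) = (koszul ds ps :: 'k)" if "ps \<in> shuffles A (b # B)" for ps
    using that by (simp add: koszul_Cons)
  have "filter (\<lambda>q. q < b) ps \<in> shuffles (filter (\<lambda>q. q < b) (a # A)) (filter (\<lambda>q. q < b) B)"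
    if "ps \<in> shuffles (a # A) B" for ps
    using that filter_shuffles[of "\<lambda>q. q < b" "a # A" B] by blast
  moreover have "filter (\<lambda>q. q < b) (a # A) = a # A" "filter (\<lambda>q. q < b) B = []"
    using 3(3) by (auto simp: filter_empty_conv filter_id_conv sorted_wrt_append dest: less_asym)
  ultimately have "filter (\<lambda>q. q < b) ps = a # A" if "ps \<in> shuffles (a # A) B" for ps
    using that by simp
  moreover have "sum_list (map ((!) ds) (a # A)) = ldeg (map f (a # A))"
    unfolding ldeg_def map_map by (intro arg_cong[where f = sum_list] map_cong) (use 3(4) in auto)
  ultimately have **: "koszul ds (b # ps) =
      (-1) powi (fst (f b) * ldeg (map f (a # A))) * (koszul ds ps :: 'k)"
    if "ps \<in> shuffles (a # A) B" for ps
    using that 3(4)[of b] by (simp only: koszul_Cons) simp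
  have "sum ?t (shuffles (a # A) (b # B)) =
      sum ?t ((#) a ` shuffles A (b # B)) + sum ?t ((#) b ` shuffles (a # A) B)"
    unfolding shuffles.simps by (rule sum.union_disjoint) (use 3(3) in auto)
  also have "sum ?t ((#) a ` shuffles A (b # B)) =
      lin_ext (\<lambda>w. basis (f a # w)) (sum ?t (shuffles A (b # B)))"
    by (subst sum.reindex) (auto simp: lin_ext_sum * intro!: sum.cong)
  also have "sum ?t ((#) b ` shuffles (a # A) B) = signed (fst (f b) * ldeg (map f (a # A)))
      (lin_ext (\<lambda>w. basis (f b # w)) (sum ?t (shuffles (a # A) B)))"
    by (subst sum.reindex) (auto simp: lin_ext_sum pm.scale_sum_right ** intro!: sum.cong)
  also have "sum ?t (shuffles A (b # B)) = shuf (map f A) (map f (b # B))"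
    by (rule 3(1)) (use 3(3,4) in \<open>auto simp: sorted_wrt_append\<close>)
  also have "sum ?t (shuffles (a # A) B) = shuf (map f (a # A)) (map f B)"
    by (rule 3(2)) (use 3(3,4) in \<open>auto simp: sorted_wrt_append\<close>)
  finally show ?case
    by (simp only: list.map shuf.simps)
qed (simp_all add: koszul_strict_sorted)

lemma sorted_wrt_filter_iff:
  "sorted_wrt R (filter P xs) \<longleftrightarrow> sorted_wrt (\<lambda>x y. P x \<longrightarrow> P y \<longrightarrow> R x y) xs"
  by (induction xs) auto

lemma strict_sorted_upt_unique:
  "sorted_wrt (<) xs \<Longrightarrow> set xs = {m..<n} \<Longrightarrow> xs = [m..<n::nat]"
  by (rule strict_sorted_equal) simp_all

text \<open>\<open>\<sigma>\<close> sends an entry to its place, so the listing of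
  \<open>inv \<sigma>\<close> shows the entry at each place. Monotonicity of \<open>\<sigma>\<close>
  on a block means that the block keeps its order in this list, which characterizes
  shuffles.\<close>

lemma bij_betw_Bat_shuffles:
  "bij_betw (\<lambda>\<sigma>. map (inv \<sigma>) [0..<p + q]) (Bat p q) (shuffles [0..<p] [p..<p + q])"
proof (rule bij_betwI')
  fix \<sigma> \<tau> assume "\<sigma> \<in> Bat p q" "\<tau> \<in> Bat p q"
  then have perm: "\<sigma> permutes {..<p + q}" "\<tau> permutes {..<p + q}"
    by (simp_all add: Bat_def)
  show "map (inv \<sigma>) [0..<p + q] = map (inv \<tau>) [0..<p + q] \<longleftrightarrow> \<sigma> = \<tau>"
  proof
    assume eq: "map (inv \<sigma>) [0..<p + q] = map (inv \<tau>) [0..<p + q]"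
    have "inv \<sigma> = inv \<tau>"
    proof
      fix i
      show "inv \<sigma> i = inv \<tau> i"
        using eq perm[THEN permutes_inv, THEN permutes_not_in, of i]
        by (cases "i < p + q") (auto simp: map_eq_conv)
    qed
    then show "\<sigma> = \<tau>"
      using perm by (metis permutes_inv_inv)
  qed simp
next
  fix \<sigma> assume "\<sigma> \<in> Bat p q"
  then have perm: "\<sigma> permutes {..<p +
      q}" and mono: "strict_mono_on {..<p} \<sigma>" "strict_mono_on {p..<p + q} \<sigma>"
    by (simp_all add: Bat_def)
  define ps where "ps = map (inv \<sigma>) [0..<p + q]"
  have set_ps: "set ps = {..<p + q}"
    using permutes_image[OF permutes_inv[OF perm]] by (simp add: ps_def atLeast0LessThan)
  have less: "sorted_wrt (\<lambda>x y. x \<in> S \<longrightarrow> y \<in> S \<longrightarrow> x < y) ps" if "strict_mono_on S \<sigma>" for S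
    unfolding sorted_wrt_iff_nth_less
  proof (intro allI impI)
    fix i j assume ij: "i < j" "j < length ps" and S: "ps ! i \<in> S" "ps ! j \<in> S"
    have "\<sigma> (ps ! i) = i" "\<sigma> (ps ! j) = j"
      using ij perm by (simp_all add: ps_def permutes_inverses)
    then show "ps ! i < ps ! j"
      using strict_mono_on_less[OF that S] ij(1) by metis
  qed
  have "filter (\<lambda>x. x < p) ps = [0..<p]"
  proof (rule strict_sorted_upt_unique)
    show "sorted_wrt (<) (filter (\<lambda>x. x < p) ps)"
      using less[OF mono(1)] by (simp only: sorted_wrt_filter_iff lessThan_iff)
    show "set (filter (\<lambda>x. x < p) ps) = {0..<p}"
      by (simp only: set_filter set_ps) auto
  qed
  moreover have "filter (\<lambda>x. \<not> x < p) ps = [p..<p + q]"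
  proof (rule strict_sorted_upt_unique)
    have "sorted_wrt (\<lambda>x y. \<not> x < p \<longrightarrow> \<not> y < p \<longrightarrow> x < y) ps"
      by (rule sorted_wrt_mono_rel[OF _ less[OF mono(2)]]) (use set_ps in auto)
    then show "sorted_wrt (<) (filter (\<lambda>x. \<not> x < p) ps)"
      by (simp only: sorted_wrt_filter_iff)
    show "set (filter (\<lambda>x. \<not> x < p) ps) = {p..<p + q}"
      by (simp only: set_filter set_ps) auto
  qed
  ultimately show "map (inv \<sigma>) [0..<p + q] \<in> shuffles [0..<p] [p..<p + q]"
    using partition_in_shuffles[of ps "\<lambda>x. x < p"] by (simp add: ps_def)
next
  fix ps assume ps: "ps \<in> shuffles [0..<p] [p..<p + q]"
  have set_ps: "set ps = {..<p + q}" and len: "length ps = p + q" and dist: "distinct ps"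
    using set_shuffles[OF ps] length_shuffles[OF ps] distinct_disjoint_shuffles[OF _ _ _ ps]
    by (simp_all add: ivl_disj_int ivl_disj_un atLeast0LessThan)
  \<comment> \<open>The list read as a function from places to entries, extended by the identity.
    The preimage in \<open>Bat p q\<close> is its inverse, which sends entries to places.\<close>
  define \<tau> where "\<tau> i = (if i < p + q then ps ! i else i)" for i
  have "bij_betw \<tau> {..<p + q} {..<p + q}"
    by (rule bij_betw_cong[THEN iffD1, OF _ bij_betw_nth[OF dist]]) (simp_all add: \<tau>_def set_ps len)
  then have perm: "\<tau> permutes {..<p + q}"
    by (rule bij_imp_permutes) (simp add: \<tau>_def)
  have mono: "strict_mono_on S (inv \<tau>)"
    if "S \<subseteq> {..<p + q}" "sorted_wrt (\<lambda>x y. x \<in> S \<longrightarrow> y \<in> S \<longrightarrow> x < y) ps" for S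
  proof (rule strict_mono_onI)
    fix x y assume xy: "x \<in> S" "y \<in> S" "x < y"
    have in_range: "inv \<tau> z < p + q" if "z \<in> S" for z
      using permutes_in_image[OF permutes_inv[OF perm], of z] that \<open>S \<subseteq> _\<close> by auto
    have nth: "ps ! inv \<tau> z = z" if "z \<in> S" for z
      using permutes_inverses(1)[OF perm, of z] in_range[OF that] by (simp add: \<tau>_def)
    show "inv \<tau> x < inv \<tau> y"
    proof (rule ccontr)
      assume "\<not> inv \<tau> x < inv \<tau> y"
      moreover have "inv \<tau> x \<noteq> inv \<tau> y"
        using nth xy by (metis less_irrefl)
      ultimately have "inv \<tau> y < inv \<tau> x"
        by simp
      then have "y < x"
        using that(2) in_range[of x] nth xy len unfolding sorted_wrt_iff_nth_less by metis
      with xy show False by simp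
    qed
  qed
  have "filter (\<lambda>x. x \<in> set [0..<p]) ps = [0..<p]" "filter (\<lambda>x. x \<in> set [p..<p + q]) ps =
      [p..<p + q]"
    using filter_shuffles_disjoint1(1)[OF _ ps] filter_shuffles_disjoint2(1)[OF _ ps] by auto
  then have "sorted_wrt (<) (filter (\<lambda>x. x \<in> set [0..<p]) ps)"
    "sorted_wrt (<) (filter (\<lambda>x. x \<in> set [p..<p + q]) ps)"
    by simp_all
  then have "strict_mono_on {..<p} (inv \<tau>)" "strict_mono_on {p..<p + q} (inv \<tau>)"
    unfolding sorted_wrt_filter_iff by (auto intro!: mono simp: atLeast0LessThan)
  then have "inv \<tau> \<in> Bat p q"
    using permutes_inv[OF perm] by (simp add: Bat_def)
  moreover have "ps = map (inv (inv \<tau>)) [0..<p + q]"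
    by (rule nth_equalityI) (simp_all add: permutes_inv_inv[OF perm] \<tau>_def len)
  ultimately show "\<exists>\<sigma>\<in>Bat p q. ps = map (inv \<sigma>) [0..<p + q]"
    by blast
qed

lemma bat_eq_shuf: "bat u v = shuf u v"
proof -
  let ?n = "length u + length v"
  have "bat u v = (\<Sum>ps\<in>shuffles [0..<length u] [length u..<?n].
      pm_scale (koszul (map fst (u @ v)) ps) (basis (map ((!) (u @ v)) ps)))"
    unfolding bat_def Let_def
    by (rule sum.reindex_bij_betw[OF bij_betw_Bat_shuffles])
  also have "\<dots> = shuf (map ((!) (u @ v)) [0..<length u]) (map ((!) (u @ v)) [length u..<?n])"
    by (rule sum_shuffles_koszul) (auto simp: sorted_wrt_append nth_map simp del: map_append)
  also have "\<dots> = shuf u v"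
    by (intro arg_cong2[where f = shuf] nth_equalityI) (simp_all add: nth_append)
  finally show ?thesis .
qed

section \<open>The relations of the shuffle quotient\<close>

text \<open>The two terms of \<open>\<kappa>\<close> attached to \<open>U \<otimes> V\<close>, up to the signs from other factors.  Since \<open>phi\<close>
  vanishes on empty words, the unrestricted deconcatenation can be used, for which the shuffle
      product
  has the multiplicativity \<open>decon_shuf\<close>.\<close>

definition phi :: "'g word \<Rightarrow> 'g word \<Rightarrow> ('g word \<times> 'g word \<Rightarrow>\<^sub>0 'k::field)"
  where "phi U V = (if U = [] \<or> V = [] then 0 else
    signed (ldeg U) (basis (U, V)) + signed (ldeg U + wdeg U * wdeg V) (basis (V, U)))"

definition delta :: "'g word \<Rightarrow> ('g word \<times> 'g word \<Rightarrow>\<^sub>0 'k::field)"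
  where "delta w = lin_ext (\<lambda>(U, V). phi U V) (decon w)"

lemma phi_Nil [simp]: "phi [] V = 0" "phi U [] = 0"
  by (simp_all add: phi_def)

text \<open>The exponents at \<open>(V, U)\<close> are \<open>ldeg U + wdeg U * wdeg V\<close> and
  \<open>ldeg U * ldeg V + ldeg V\<close>; as \<open>wdeg\<close> is \<open>ldeg\<close> minus one,
  they differ by an odd number. The same happens at \<open>(U, V)\<close>.\<close>

lemma phi_swap: "phi U V + signed (ldeg U * ldeg V) (phi V U) = 0"
  by (auto simp: phi_def wdeg_ldeg signed_if algebra_simps)

text \<open>By \<open>decon_mu_word\<close>, \<open>mu\<close> reaches the right part with sign
  \<open>(-1)^(ldeg U)\<close>. The prefactor \<open>(-1)^(ldeg U)\<close> of \<open>phi\<close>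
  flips when \<open>mu\<close> raises the degree of \<open>U\<close>, and \<open>wdeg U\<close> has
  the parity opposite to \<open>ldeg U\<close>; so both terms acquire the minus.\<close>

lemma delta_mu_word:
  "lin_ext delta (mu_word sc wd w) =
    - lin_ext (\<lambda>(U, V). lin_ext (\<lambda>x. basis (x, V)) (mu_word sc wd U) +
      signed (wdeg U) (lin_ext (\<lambda>x. basis (U, x)) (mu_word sc wd V))) (delta w)"
proof -
  let ?mu = "mu_word sc wd"
  let ?t = "\<lambda>U V. lin_ext (\<lambda>x. basis (x, V)) (?mu U) +
      signed (wdeg U) (lin_ext (\<lambda>x. basis (U, x)) (?mu V))"
  have *: "lin_ext (\<lambda>x. phi x V) (?mu U) + signed (ldeg U) (lin_ext (phi U) (?mu V)) =
      - lin_ext (\<lambda>p. ?t (fst p) (snd p)) (phi U V)" for U V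
  proof (cases "U = [] \<or> V = []")
    case False
    then show ?thesis
      by (auto simp: phi_def wdeg_ldeg mu_word_keys signed_if algebra_simps)
  qed auto
  have "lin_ext delta (?mu w) = lin_ext (\<lambda>p. phi (fst p) (snd p)) (lin_ext decon (?mu w))"
    by (simp add: delta_def case_prod_unfold)
  also have "\<dots> = lin_ext (\<lambda>(U, V). lin_ext (\<lambda>x. phi x V) (?mu U) +
      signed (ldeg U) (lin_ext (phi U) (?mu V))) (decon w)"
    by (simp add: decon_mu_word case_prod_unfold)
  also have "\<dots> = - lin_ext (\<lambda>(U, V). ?t U V) (delta w)"
    unfolding * by (simp add: delta_def case_prod_unfold)
  finally show ?thesis .
qed

text \<open>Separates the two trivial cuts: in \<open>delta_shuf\<close> they produce the only terms
  that are not relations one by one.\<close>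

lemma decon_split:
  assumes "w \<noteq> []"
  obtains x where "decon w = basis ([], w) + basis (w, []) + x"
    "(x :: _ \<Rightarrow>\<^sub>0 'k::field) \<in> supp_on {(p, q). p \<noteq> [] \<and> q \<noteq> [] \<and> p @ q = w}"
proof -
  have "\<exists>x. decon w = basis ([], w) + basis (w, []) + x \<and>
      (x :: _ \<Rightarrow>\<^sub>0 'k) \<in> supp_on {(p, q). p \<noteq> [] \<and> q \<noteq> [] \<and> p @ q = w}"
    using assms
  proof (induction w rule: list_nonempty_induct)
    case (single a)
    show ?case
      by (rule exI[of _ 0]) (simp add: supp_on_intros)
  next
    case (cons a w)
    then obtain x :: "_ \<Rightarrow>\<^sub>0 'k" where x: "decon w = basis ([], w) + basis (w, []) + x"
      "x \<in> supp_on {(p, q). p \<noteq> [] \<and> q \<noteq> [] \<and> p @ q = w}"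
      by blast
    show ?case
      by (rule exI[of _ "basis ([a], w) + lin_ext (\<lambda>(p, q). basis (a # p, q)) x"])
        (use x cons(1) in \<open>auto intro!: supp_on_intros dest: supp_onD\<close>)
  qed
  with that show thesis by blast
qed

lemma shuf_keys_set:
  assumes "w \<in> Poly_Mapping.keys (shuf u v)"
  shows "set w = set u \<union> set v"
  using shuf_keys(1)[OF assms] by (metis set_mset_mset set_mset_union)

lemma shuf_keys_Nil [simp]:
  "[] \<in> Poly_Mapping.keys (shuf u v :: _ \<Rightarrow>\<^sub>0 'k::field) \<longleftrightarrow> u = [] \<and> v = []"
  using shuf_keys(1)[of "[]" u v] by auto

section \<open>Relations of letters and words, and the descent of \<open>mu\<close>\<close>

context gerstenhaber_algebra
begin

abbreviation "L \<equiv> letters grade"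
abbreviation "LR \<equiv> letter_rel scale grade"
abbreviation "HW \<equiv> H_words grade"
abbreviation "HR \<equiv> H_rel scale grade"
abbreviation "M2 \<equiv> mu2 scale wedge"
abbreviation "mu \<equiv> mu_word scale wedge"

text \<open>Multilinearity relations alone, before shuffles are divided out. \<open>mu\<close>
  respects them by itself, and the defect of \<open>mu\<close> as a derivation of shuffles already
  lies here.\<close>

definition LW :: "('g word \<Rightarrow>\<^sub>0 'k) set"
  where "LW = pm.span (tensor_rel L LR)"

lemma LW_subspace: "pm.subspace LW"
  by (simp add: LW_def)

lemma HR_subspace: "pm.subspace HR"
  by (simp add: H_rel_def)

lemma LW_base: "r \<in> LR \<Longrightarrow> p \<in> lists L \<Longrightarrow> q \<in> lists L \<Longrightarrow> lin_ext (\<lambda>b. basis (p @ b # q)) r \<in> LW"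
  unfolding LW_def tensor_rel_def by (rule pm.span_base) blast

lemma LW_subset_HR: "LW \<subseteq> HR"
  unfolding LW_def H_rel_def by (rule pm.span_mono) blast

lemma shuf_in_HR: "u \<in> HW \<Longrightarrow> v \<in> HW \<Longrightarrow> shuf u v \<in> HR"
  unfolding H_rel_def bat_eq_shuf by (rule pm.span_base) blast

lemma HR_induct:
  assumes "r \<in> HR" "pm.subspace W"
    and "\<And>p q l. p \<in> lists L \<Longrightarrow> q \<in> lists L \<Longrightarrow> l \<in> LR \<Longrightarrow> lin_ext (\<lambda>b. f (p @ b # q)) l \<in> W"
    and "\<And>u v. u \<in> HW \<Longrightarrow> v \<in> HW \<Longrightarrow> lin_ext f (shuf u v) \<in> W"
  shows "lin_ext f r \<in> W"
  using assms(1) unfolding H_rel_def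
proof (rule lin_ext_span_in_subspace[OF _ assms(2)])
  fix g :: "'g word \<Rightarrow>\<^sub>0 'k"
  assume "g \<in> tensor_rel L LR \<union> {bat u v |u v. u \<in> HW \<and> v \<in> HW}"
  then show "lin_ext f g \<in> W"
    unfolding tensor_rel_def bat_eq_shuf
    by (elim UnE CollectE exE conjE) (simp_all add: assms(3,4))
qed

lemma LW_induct:
  assumes "r \<in> LW" "pm.subspace W"
    and "\<And>p q l. p \<in> lists L \<Longrightarrow> q \<in> lists L \<Longrightarrow> l \<in> LR \<Longrightarrow> lin_ext (\<lambda>b. f (p @ b # q)) l \<in> W"
  shows "lin_ext f r \<in> W"
  using assms(1) unfolding LW_def
proof (rule lin_ext_span_in_subspace[OF _ assms(2)])
  fix g :: "'g word \<Rightarrow>\<^sub>0 'k"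
  assume "g \<in> tensor_rel L LR"
  then show "lin_ext f g \<in> W"
    unfolding tensor_rel_def by (elim CollectE exE conjE) (simp add: assms(3))
qed

lemma LR_cases:
  assumes "r \<in> LR"
  obtains a \<alpha> \<beta> where "\<alpha> \<in> grade (a + 1)" "\<beta> \<in> grade (a + 1)"
      "r = basis (a, \<alpha> + \<beta>) - basis (a, \<alpha>) - basis (a, \<beta>)"
  | a c \<alpha> where "\<alpha> \<in> grade (a + 1)" "r = basis (a, scale c \<alpha>) - pm_scale c (basis (a, \<alpha>))"
  using assms unfolding letter_rel_def by blast

lemma LR_add: "\<alpha> \<in> grade (a + 1) \<Longrightarrow> \<beta> \<in> grade (a + 1) \<Longrightarrow>
    basis (a, \<alpha> + \<beta>) - basis (a, \<alpha>) - basis (a, \<beta>) \<in> LR"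
  and LR_scale: "\<alpha> \<in> grade (a + 1) \<Longrightarrow> basis (a, scale c \<alpha>) - pm_scale c (basis (a, \<alpha>)) \<in> LR"
  unfolding letter_rel_def by blast+

text \<open>Degrees are recorded in the letters, and both kinds of relation involve one degree
  \<open>a\<close> only. A sign depending on it is therefore a common factor.\<close>

lemma LR_keys:
  assumes "r \<in> LR"
  obtains d where "\<And>b. b \<in> Poly_Mapping.keys r \<Longrightarrow> b \<in> L \<and> fst b = d"
proof -
  have "\<exists>d. r \<in> supp_on {b \<in> L. fst b = d}"
    using assms
  proof (cases rule: LR_cases)
    case (1 a \<alpha> \<beta>)
    then show ?thesis
      by (intro exI[of _ a])
        (auto intro!: pm.subspace_diff supp_on_subspace simp: letters_def subspace_add[OF
            grade_subspace])
  next
    case (2 a c \<alpha>)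
    then show ?thesis
      by (intro exI[of _ a])
        (auto intro!: pm.subspace_diff supp_on_intros supp_on_subspace simp: letters_def
            subspace_scale[OF grade_subspace])
  qed
  with that show thesis
    by (fastforce dest: supp_onD simp: mem_Collect_eq)
qed

lemma M2_in_L: "a \<in> L \<Longrightarrow> b \<in> L \<Longrightarrow> M2 a b \<in> L"
  using wedge_degree[of "snd a" "fst a + 1" "snd b" "fst b + 1"]
  by (auto simp: letters_def mu2_def algebra_simps intro!: subspace_scale[OF grade_subspace])

lemma wedge_simps [simp]:
  "wedge (\<alpha> + \<beta>) \<gamma> = wedge \<alpha> \<gamma> + wedge \<beta> \<gamma>" "wedge (scale c \<alpha>) \<gamma> = scale c (wedge \<alpha> \<gamma>)"
  "wedge \<alpha> (\<beta> + \<gamma>) = wedge \<alpha> \<beta> + wedge \<alpha> \<gamma>" "wedge \<alpha> (scale c \<gamma>) = scale c (wedge \<alpha> \<gamma>)"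
proof -
  interpret l: Vector_Spaces.linear scale scale "\<lambda>\<alpha>. wedge \<alpha> \<gamma>"
    by (rule wedge_linear_left)
  interpret r: Vector_Spaces.linear scale scale "wedge \<alpha>"
    by (rule wedge_linear_right)
  show "wedge (\<alpha> + \<beta>) \<gamma> = wedge \<alpha> \<gamma> + wedge \<beta> \<gamma>" "wedge (scale c \<alpha>) \<gamma> = scale c (wedge \<alpha> \<gamma>)"
    by (rule l.add l.scale)+
  show "wedge \<alpha> (\<beta> + \<gamma>) = wedge \<alpha> \<beta> + wedge \<alpha> \<gamma>" "wedge \<alpha> (scale c \<gamma>) = scale c (wedge \<alpha> \<gamma>)"
    by (rule r.add r.scale)+
qed

lemma M2_LR:
  assumes "r \<in> LR" "c \<in> L"
  shows "lin_ext (\<lambda>b. basis (M2 b c)) r \<in> LR" "lin_ext (\<lambda>b. basis (M2 c b)) r \<in> LR"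
proof -
  have in_grade: "snd (M2 (a, \<alpha>) c) \<in> grade (a + fst c + 1 + 1)"
    "snd (M2 c (a, \<alpha>)) \<in> grade (fst c + a + 1 + 1)" if "\<alpha> \<in> grade (a + 1)" for a \<alpha>
    using M2_in_L[of "(a, \<alpha>)" c] M2_in_L[of c "(a, \<alpha>)"] that assms(2)
    by (simp_all add: letters_def mu2_def split: prod.splits)
  show "lin_ext (\<lambda>b. basis (M2 b c)) r \<in> LR"
    using assms(1)
  proof (cases rule: LR_cases)
    case (1 a \<alpha> \<beta>)
    then show ?thesis
      using LR_add[OF in_grade(1)[OF 1(1)] in_grade(1)[OF 1(2)]]
      by (simp add: mu2_def scale_right_distrib)
  next
    case (2 a k \<alpha>)
    then show ?thesis
      using LR_scale[OF in_grade(1)[OF 2(1)], of k]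
      by (simp add: mu2_def mult.commute)
  qed
  show "lin_ext (\<lambda>b. basis (M2 c b)) r \<in> LR"
    using assms(1)
  proof (cases rule: LR_cases)
    case (1 a \<alpha> \<beta>)
    then show ?thesis
      using LR_add[OF in_grade(2)[OF 1(1)] in_grade(2)[OF 1(2)]]
      by (simp add: mu2_def scale_right_distrib)
  next
    case (2 a k \<alpha>)
    then show ?thesis
      using LR_scale[OF in_grade(2)[OF 2(1)], of k]
      by (simp add: mu2_def mult.commute)
  qed
qed

lemma LW_Cons:
  assumes "r \<in> LW" "a \<in> L"
  shows "lin_ext (\<lambda>w. basis (a # w)) r \<in> LW"
  using assms(1)
proof (rule LW_induct[OF _ LW_subspace])
  fix p q l assume "p \<in> lists L" "q \<in> lists L" "l \<in> LR"
  then show "lin_ext (\<lambda>b. basis (a # p @ b # q)) l \<in> LW"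
    using LW_base[of l "a # p" q] assms(2) by simp
qed

lemma HR_supp: "HR \<subseteq> supp_on HW"
proof
  fix r assume "r \<in> HR"
  then have "lin_ext basis r \<in> supp_on HW"
  proof (rule HR_induct[OF _ supp_on_subspace])
    fix p q l assume *: "p \<in> lists L" "q \<in> lists L" "l \<in> LR"
    show "lin_ext (\<lambda>b. basis (p @ b # q)) l \<in> supp_on HW"
      using * by (auto intro!: supp_on_intros simp: H_words_def elim: LR_keys)
  next
    fix u v assume "u \<in> HW" "v \<in> HW"
    then show "lin_ext basis (shuf u v) \<in> supp_on HW"
      by (auto simp: H_words_def supp_on_def shuf_keys_set)
  qed
  then show "r \<in> supp_on HW" by simp
qed

lemma HR_keys: "r \<in> HR \<Longrightarrow> w \<in> Poly_Mapping.keys r \<Longrightarrow> w \<in> HW"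
  using HR_supp by (auto dest: supp_onD)

lemma lin_ext_signed_LR:
  assumes "l \<in> LR" "pm.subspace W" "lin_ext f l \<in> W"
  shows "lin_ext (\<lambda>b. signed (s (fst b)) (f b)) l \<in> W"
proof -
  obtain d where d: "\<And>b. b \<in> Poly_Mapping.keys l \<Longrightarrow> b \<in> L \<and> fst b = d"
    using LR_keys[OF assms(1)] by blast
  have "lin_ext (\<lambda>b. signed (s (fst b)) (f b)) l = signed (s d) (lin_ext f l)"
    unfolding lin_ext_fun_scale[symmetric] by (rule lin_ext_cong) (simp_all add: d)
  with assms(2,3) show ?thesis
    by (simp add: pm.subspace_scale)
qed

text \<open>Closure under degree-dependent signs, although relations need not be homogeneous: this
  absorbs every Koszul sign produced by moving something past a relation.\<close>

lemma twist_HR: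
  assumes "r \<in> HR"
  shows "lin_ext (\<lambda>w. signed (s (ldeg w)) (basis w)) r \<in> HR"
  using assms
proof (rule HR_induct[OF _ HR_subspace])
  fix p q l assume *: "p \<in> lists L" "q \<in> lists L" "l \<in> LR"
  show "lin_ext (\<lambda>b. signed (s (ldeg (p @ b # q))) (basis (p @ b # q))) l \<in> HR"
    unfolding ldeg_simps
    by (rule lin_ext_signed_LR[OF *(3) HR_subspace, where s = "\<lambda>d. s (ldeg p + (d + ldeg q))"])
      (use LW_base[OF *(3,1,2)] LW_subset_HR in blast)
next
  fix u v assume "u \<in> HW" "v \<in> HW"
  moreover have "lin_ext (\<lambda>w. signed (s (ldeg w)) (basis w)) (shuf u v :: _ \<Rightarrow>\<^sub>0 'k) =
      signed (s (ldeg u + ldeg v)) (lin_ext basis (shuf u v))"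
    unfolding lin_ext_fun_scale[symmetric] by (rule lin_ext_cong) (simp_all add: shuf_keys)
  ultimately show "lin_ext (\<lambda>w. signed (s (ldeg w)) (basis w)) (shuf u v) \<in> HR"
    by (simp add: pm.subspace_scale HR_subspace shuf_in_HR)
qed

lemma lists_LI: "w \<in> HW \<Longrightarrow> w \<in> lists L" "w \<in> lists L \<Longrightarrow> w \<noteq> [] \<Longrightarrow> w \<in> HW" "w \<in> HW \<Longrightarrow> w \<noteq> []"
  by (simp_all add: H_words_def)

lemma merge_lists: "a \<in> L \<Longrightarrow> w \<in> lists L \<Longrightarrow> merge scale wedge a w \<in> supp_on (lists L)"
  by (cases w) (simp_all add: supp_on_intros M2_in_L)

lemma mu_lists: "w \<in> lists L \<Longrightarrow> mu w \<in> supp_on (lists L)"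
proof (induction w)
  case (Cons a w)
  then show ?case
    using merge_lists[of a w] by (auto intro!: supp_on_intros dest: supp_onD)
qed (simp add: supp_on_intros)

lemma mu_keys_HW: "w \<in> lists L \<Longrightarrow> x \<in> Poly_Mapping.keys (mu w) \<Longrightarrow> x \<in> HW"
  using supp_onD[OF mu_lists] mu_word_keys(2) lists_LI(2) by metis

text \<open>Commutativity of \<open>wedge\<close> in degrees \<open>fst a + 1\<close>,
  \<open>fst b + 1\<close> and the signs of \<open>mu2\<close> combine to the exponent
  \<open>(fst a + 1) * (fst b + 1) + fst a + fst b\<close>, which has the parity of
  \<open>fst a * fst b + 1\<close>. The cancellation holds only modulo a scaling relation, because
  \<open>basis\<close> is not linear in the letter.\<close>

lemma M2_anticommute:
  assumes "a \<in> L" "b \<in> L"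
  obtains l where "l \<in> LR"
    "basis (M2 a b) + signed (fst a * fst b) (basis (M2 b a)) = signed (fst a * fst b) l"
proof -
  define x where "x = snd (M2 a b)"
  define c where "c = ((-1) powi (fst a * fst b + 1) :: 'k)"
  have "wedge (snd b) (snd a) = scale ((-1) powi ((fst b + 1) * (fst a +
      1))) (wedge (snd a) (snd b))"
    using assms by (intro wedge_commute) (auto simp: letters_def)
  then have "M2 b a = (fst a + fst b + 1, scale c x)"
    by (auto simp: mu2_def x_def c_def power_int_minus_left)
  moreover have "M2 a b = (fst a + fst b + 1, x)"
    by (simp add: mu2_def x_def)
  moreover have "basis (fst a + fst b + 1, scale c x) - pm_scale c (basis (fst a + fst b +
      1, x)) \<in> LR"
    using M2_in_L[OF assms] by (intro LR_scale) (auto simp: x_def mu2_def letters_def)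
  ultimately show thesis
    by (intro that[of "basis (M2 b a) - pm_scale c (basis (M2 a b))"])
      (auto simp: c_def signed_if)
qed

lemma mu_defect_LW:
  assumes "u \<in> lists L" "v \<in> lists L"
  shows "mu_defect scale wedge u v \<in> LW"
  using assms
proof (induction u v rule: shuf.induct)
  case (3 a u b v)
  obtain l where l: "l \<in> LR" "basis (M2 a b) + signed (fst a * fst b) (basis (M2 b a)) =
      signed (fst a * fst b) l"
    using 3 by (auto elim: M2_anticommute)
  have "basis (M2 a b # x) + signed (fst a * fst b) (basis (M2 b a # x)) \<in> LW"
    if "x \<in> lists L" for x
  proof -
    have "basis (M2 a b # x) + signed (fst a * fst b) (basis (M2 b a # x)) =
        lin_ext (\<lambda>b. basis ([] @ b # x)) (signed (fst a * fst b) l)"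
      by (simp flip: l(2))
    also have "\<dots> \<in> LW"
      unfolding lin_ext_scale
      by (intro pm.subspace_scale LW_subspace LW_base l(1) that) simp
    finally show ?thesis .
  qed
  moreover have "x \<in> lists L" if "x \<in> Poly_Mapping.keys (shuf u v :: _ \<Rightarrow>\<^sub>0 'k)" for x
    using 3 shuf_keys_set[OF that] by auto
  ultimately have "lin_ext (\<lambda>x. basis (M2 a b # x) +
      signed (fst a * fst b) (basis (M2 b a # x))) (shuf u v) \<in> LW"
    by (intro lin_ext_in_subspace[OF LW_subspace]) blast
  then show ?case
    using 3 unfolding mu_defect_Cons
    by (intro pm.subspace_add pm.subspace_scale LW_Cons LW_subspace) simp_all
qed (simp_all add: mu_defect_def pm.subspace_0 LW_subspace)

text \<open>The letter in the slot is either multiplied with a neighbour, where bilinearity of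
  \<open>mu2\<close> gives another letter relation, or left alone. If \<open>mu\<close> acts to its
  right, the sign involves its degree, which is constant on a letter relation.\<close>

lemma mu_letter_slot:
  assumes "p \<in> lists L" "q \<in> lists L" "l \<in> LR"
  shows "lin_ext (\<lambda>b. mu (p @ b # q)) l \<in> LW"
  using assms(1)
proof (induction p)
  case Nil
  have "lin_ext (\<lambda>b. merge scale wedge b q) l \<in> LW"
  proof (cases q)
    case (Cons c x)
    then show ?thesis
      using LW_base[OF M2_LR(1)[OF assms(3), of c], of "[]" x] assms(2) by simp
  qed (simp add: pm.subspace_0 LW_subspace)
  moreover have "lin_ext (\<lambda>b. signed (fst b) (lin_ext (\<lambda>x. basis (b # x)) (mu q))) l \<in> LW"
  proof (rule lin_ext_signed_LR[OF assms(3) LW_subspace, of _ "\<lambda>d. d"])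
    show "lin_ext (\<lambda>b. lin_ext (\<lambda>x. basis (b # x)) (mu q)) l \<in> LW"
      unfolding lin_ext_swap[of _ "mu q"]
    proof (rule lin_ext_in_subspace[OF LW_subspace])
      fix x assume "x \<in> Poly_Mapping.keys (mu q)"
      then show "lin_ext (\<lambda>b. basis (b # x)) l \<in> LW"
        using LW_base[OF assms(3), of "[]" x] supp_onD[OF mu_lists[OF assms(2)]] by simp
    qed
  qed
  ultimately show ?case
    by (simp add: pm.subspace_add LW_subspace)
next
  case (Cons a p)
  have "lin_ext (\<lambda>b. merge scale wedge a (p @ b # q)) l \<in> LW"
  proof (cases p)
    case Nil
    then show ?thesis
      using LW_base[OF M2_LR(2)[OF assms(3), of a], of "[]" q] assms(2) Cons by simp
  next
    case p: (Cons c x)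
    then show ?thesis
      using LW_base[OF assms(3), of "M2 a c # x" q] assms(2) Cons M2_in_L by simp
  qed
  moreover have "signed (fst a) (lin_ext (\<lambda>x. basis (a # x)) (lin_ext (\<lambda>b. mu (p @ b # q)) l)) \<in> LW"
    using Cons by (intro pm.subspace_scale LW_subspace LW_Cons) simp_all
  ultimately show ?case
    by (simp add: pm.subspace_add LW_subspace)
qed

lemma mu_HR:
  assumes "r \<in> HR"
  shows "lin_ext mu r \<in> HR"
  using assms
proof (rule HR_induct[OF _ HR_subspace])
  fix p q l assume "p \<in> lists L" "q \<in> lists L" "l \<in> LR"
  then show "lin_ext (\<lambda>b. mu (p @ b # q)) l \<in> HR"
    using mu_letter_slot LW_subset_HR by blast
next
  fix u v assume *: "u \<in> HW" "v \<in> HW"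
  have "lin_ext mu (shuf u v) = mu_defect scale wedge u v + lin_ext (\<lambda>w. shuf w v) (mu u) +
      signed (ldeg u) (lin_ext (shuf u) (mu v))"
    by (simp add: mu_defect_def)
  also have "\<dots> \<in> HR"
  proof (intro pm.subspace_add pm.subspace_scale lin_ext_in_subspace HR_subspace)
    show "mu_defect scale wedge u v \<in> HR"
      using mu_defect_LW[OF lists_LI(1)[OF *(1)] lists_LI(1)[OF *(2)]] LW_subset_HR by blast
  \<comment> \<open>The two derivation terms are combinations of shuffles of nonempty words, because
    \<open>mu\<close> produces only nonempty words.\<close>
  qed (rule shuf_in_HR; rule * mu_keys_HW[OF lists_LI(1)[OF *(1)]] mu_keys_HW[OF lists_LI(1)[OF
      *(2)]];
      assumption)+
  finally show "lin_ext mu (shuf u v) \<in> HR" .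
qed

section \<open>Relations of the tensor square of words, and the descent of
  \<open>delta\<close>\<close>

definition HH :: "('g word \<times> 'g word \<Rightarrow>\<^sub>0 'k) set"
  where "HH = pm.span
    ({lin_ext (\<lambda>U. basis (U, V)) r | r V. r \<in> HR \<and> V \<in> HW} \<union>
     {lin_ext (\<lambda>V. basis (U, V)) r | r U. r \<in> HR \<and> U \<in> HW})"

lemma HH_subspace: "pm.subspace HH"
  by (simp add: HH_def)

lemma HH_base:
  "r \<in> HR \<Longrightarrow> V \<in> HW \<Longrightarrow> lin_ext (\<lambda>U. basis (U, V)) r \<in> HH"
  "r \<in> HR \<Longrightarrow> U \<in> HW \<Longrightarrow> lin_ext (\<lambda>V. basis (U, V)) r \<in> HH"
  unfolding HH_def by (rule pm.span_base, blast)+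

text \<open>The signs in \<open>phi\<close> depend on the degree of the argument that carries the
  relation; \<open>tw\<close> absorbs them by \<open>twist_HR\<close>. For empty \<open>V\<close>
  everything vanishes.\<close>

lemma phi_HR:
  assumes "r \<in> HR" "V \<in> lists L"
  shows "lin_ext (\<lambda>U. phi U V) r \<in> HH" "lin_ext (phi V) r \<in> HH"
proof -
  have tw: "lin_ext (\<lambda>U. signed (s (ldeg U)) (basis (U, V))) r \<in> HH"
    "lin_ext (\<lambda>U. signed (s (ldeg U)) (basis (V, U))) r \<in> HH" if "V \<noteq> []" for s
    using HH_base[OF twist_HR[OF assms(1), of s], of V] assms(2) that lists_LI(2) by simp_all
  have ne: "U \<noteq> []" if "U \<in> Poly_Mapping.keys r" for U
    using HR_keys[OF assms(1) that] lists_LI(3) by blast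
  have "lin_ext (\<lambda>U. signed (ldeg U) (basis (U, V)) + signed (ldeg U +
      wdeg U * wdeg V) (basis (V, U))) r \<in> HH"
    if "V \<noteq> []"
    unfolding lin_ext_fun_add wdeg_ldeg
    by (intro pm.subspace_add HH_subspace tw[OF that, of "\<lambda>d. d"] tw[OF that, of "\<lambda>d. d +
        (d - 1) * (ldeg V - 1)"])
  moreover have "lin_ext (\<lambda>U. phi U V) r = (if V = [] then 0 else
      lin_ext (\<lambda>U. signed (ldeg U) (basis (U, V)) + signed (ldeg U +
          wdeg U * wdeg V) (basis (V, U))) r)"
    by (simp add: phi_def ne del: lin_ext_fun_add)
  ultimately show "lin_ext (\<lambda>U. phi U V) r \<in> HH"
    by (simp add: pm.subspace_0 HH_subspace)
  have "lin_ext (\<lambda>U. signed (ldeg V) (basis (V, U)) + signed (ldeg V +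
      wdeg V * wdeg U) (basis (U, V))) r \<in> HH"
    if "V \<noteq> []"
    unfolding lin_ext_fun_add wdeg_ldeg
    by (intro pm.subspace_add HH_subspace tw[OF that, of "\<lambda>d. ldeg V"] tw[OF that, of "\<lambda>d. ldeg V
        + (ldeg V - 1) * (d - 1)"])
  moreover have "lin_ext (phi V) r = (if V = [] then 0 else
      lin_ext (\<lambda>U. signed (ldeg V) (basis (V, U)) + signed (ldeg V +
          wdeg V * wdeg U) (basis (U, V))) r)"
    by (simp add: phi_def ne del: lin_ext_fun_add)
  ultimately show "lin_ext (phi V) r \<in> HH"
    by (simp add: pm.subspace_0 HH_subspace)
qed

text \<open>At each cut the slot lies in the left or in the right part. \<open>f\<close> is
  arbitrary so that letters before the slot can be absorbed into its left argument during the
  induction.\<close>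

lemma decon_letter_slot:
  assumes "p \<in> lists L" "q \<in> lists L" "l \<in> LR" "pm.subspace W"
    and "\<And>r w. r \<in> LW \<Longrightarrow> w \<in> lists L \<Longrightarrow> lin_ext (\<lambda>x. f x w) r \<in> W"
    and "\<And>r w. r \<in> LW \<Longrightarrow> w \<in> lists L \<Longrightarrow> lin_ext (f w) r \<in> W"
  shows "lin_ext (\<lambda>b. lin_ext (\<lambda>(x, y). f x y) (decon (p @ b # q))) l \<in> W"
  using assms(1,5,6)
proof (induction p arbitrary: f)
  case Nil
  have "lin_ext (\<lambda>b. lin_ext (\<lambda>(x, y). f (b # x) y) (decon q)) l \<in> W"
    unfolding lin_ext_swap[of _ "decon q"]
  proof (rule lin_ext_in_subspace[OF assms(4)], clarsimp)
    fix x y assume "(x, y) \<in> Poly_Mapping.keys (decon q :: _ \<Rightarrow>\<^sub>0 'k)"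
    from decon_keys[OF this] have "x @ y = q"
      by simp
    with assms(2) have "x \<in> lists L" "y \<in> lists L"
      by auto
    then show "lin_ext (\<lambda>b. f (b # x) y) l \<in> W"
      using Nil(1)[OF LW_base[OF assms(3), of "[]" x], of y] by simp
  qed
  moreover have "lin_ext (\<lambda>b. f [] (b # q)) l \<in> W"
    using Nil(2)[OF LW_base[OF assms(3), of "[]" q], of "[]"] assms(2) by simp
  ultimately show ?case
    by (simp add: case_prod_unfold pm.subspace_add assms(4))
next
  case (Cons a p)
  have "lin_ext (\<lambda>b. f [] (a # p @ b # q)) l \<in> W"
    using Cons(5)[OF LW_base[OF assms(3), of "a # p" q], of "[]"] assms(2) Cons(1,2) by simp
  moreover have "lin_ext (\<lambda>b. lin_ext (\<lambda>(x, y). f (a # x) y) (decon (p @ b # q))) l \<in> W"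
  proof (rule Cons(3))
    fix r w assume "r \<in> LW" "w \<in> lists L"
    then show "lin_ext (\<lambda>x. f (a # x) w) r \<in> W" "lin_ext (f (a # w)) r \<in> W"
      using Cons(4)[OF LW_Cons[of r a], of w] Cons(5)[of r "a # w"] Cons(1,2) by simp_all
  qed
  ultimately show ?case
    by (simp add: case_prod_unfold pm.subspace_add assms(4))
qed

lemma delta_shuf:
  assumes "u \<in> HW" "v \<in> HW"
  shows "lin_ext delta (shuf u v) \<in> HH"
proof -
  \<comment> \<open>Contribution of the cut \<open>(u1, u2)\<close> of \<open>u\<close> and the cut
    \<open>(v1, v2)\<close> of \<open>v\<close> to the split shuffle, as given by
    \<open>decon_shuf\<close>.\<close>
  define G where "G u1 u2 v1 v2 = signed (ldeg u2 * ldeg v1)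
      (lin_ext (\<lambda>p. lin_ext (phi p) (shuf u2 v2)) (shuf u1 v1) :: _ \<Rightarrow>\<^sub>0 'k)" for u1 u2 v1 v2 ::
          "'g word"
  obtain x where x: "decon u = basis ([], u) + basis (u, []) + x"
    "(x :: _ \<Rightarrow>\<^sub>0 'k) \<in> supp_on {(p, q). p \<noteq> [] \<and> q \<noteq> [] \<and> p @ q = u}"
    using decon_split lists_LI(3)[OF assms(1)] by blast
  obtain y where y: "decon v = basis ([], v) + basis (v, []) + y"
    "(y :: _ \<Rightarrow>\<^sub>0 'k) \<in> supp_on {(p, q). p \<noteq> [] \<and> q \<noteq> [] \<and> p @ q = v}"
    using decon_split lists_LI(3)[OF assms(2)] by blast
  \<comment> \<open>If both left parts are nonempty, the left factor is a shuffle relation;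
    \<open>G2\<close> is the same for the right parts.\<close>
  have G1: "G u1 u2 v1 v2 \<in> HH"
    if "u1 \<in> HW" "v1 \<in> HW" "u2 \<in> lists L" "v2 \<in> lists L" for u1 u2 v1 v2
    unfolding G_def lin_ext_swap[of _ "shuf u2 v2"]
  proof (rule pm.subspace_scale[OF HH_subspace], rule lin_ext_in_subspace[OF HH_subspace], rule
      phi_HR)
    show "shuf u1 v1 \<in> HR"
      by (intro shuf_in_HR that)
    fix w assume "w \<in> Poly_Mapping.keys (shuf u2 v2 :: _ \<Rightarrow>\<^sub>0 'k)"
    from shuf_keys_set[OF this] show "w \<in> lists L"
      using that(3,4) by auto
  qed
  have G2: "G u1 u2 v1 v2 \<in> HH"
    if "u1 \<in> lists L" "v1 \<in> lists L" "u2 \<in> HW" "v2 \<in> HW" for u1 u2 v1 v2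
    unfolding G_def
  proof (rule pm.subspace_scale[OF HH_subspace], rule lin_ext_in_subspace[OF HH_subspace], rule
      phi_HR)
    show "shuf u2 v2 \<in> HR"
      by (intro shuf_in_HR that)
    fix w assume "w \<in> Poly_Mapping.keys (shuf u1 v1 :: _ \<Rightarrow>\<^sub>0 'k)"
    from shuf_keys_set[OF this] show "w \<in> lists L"
      using that(1,2) by auto
  qed
  have uv: "u \<in> lists L" "v \<in> lists L" "u \<noteq> []" "v \<noteq> []"
    using assms lists_LI by auto
  have xk: "fst b \<in> HW \<and> snd b \<in> HW" if "b \<in> Poly_Mapping.keys x" for b
    using supp_onD[OF x(2) that] uv by (auto simp: H_words_def)
  have yk: "fst b \<in> HW \<and> snd b \<in> HW" if "b \<in> Poly_Mapping.keys y" for b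
    using supp_onD[OF y(2) that] uv by (auto simp: H_words_def)
  have "lin_ext delta (shuf u v) = lin_ext (\<lambda>p. phi (fst p) (snd p)) (lin_ext decon (shuf u v))"
    by (simp add: delta_def[abs_def] case_prod_unfold)
  also have "\<dots> = lin_ext (\<lambda>a. lin_ext (\<lambda>b. G (fst a) (snd a) (fst b) (snd b)) (decon v)) (decon u)"
    by (simp add: decon_shuf case_prod_unfold G_def)
  \<comment> \<open>Of the four pairs of trivial cuts two leave an empty factor and vanish; the
    other two give \<open>phi u v\<close> and its signed exchange. Every other pair has two nonempty
    left parts or two nonempty right parts.\<close>
  also have "\<dots> = (phi u v + signed (ldeg u * ldeg v) (phi v u)) +
      lin_ext (\<lambda>b. G [] u (fst b) (snd b)) y + lin_ext (\<lambda>b. G u [] (fst b) (snd b)) y +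
      lin_ext (\<lambda>a. G (fst a) (snd a) [] v + G (fst a) (snd a) v [] +
        lin_ext (\<lambda>b. G (fst a) (snd a) (fst b) (snd b)) y) x"
    unfolding x(1) y(1) by (simp add: algebra_simps) (simp add: G_def)
  also have "\<dots> \<in> HH"
    unfolding phi_swap
  proof (intro pm.subspace_add pm.subspace_0 HH_subspace)
    show "lin_ext (\<lambda>b. G [] u (fst b) (snd b)) y \<in> HH" "lin_ext (\<lambda>b. G u [] (fst b) (snd b)) y \<in> HH"
      by (intro lin_ext_in_subspace[OF HH_subspace] G1 G2; simp add: yk assms uv lists_LI(1) del:
          in_lists_conv_set)+
    show "lin_ext (\<lambda>a. G (fst a) (snd a) [] v + G (fst a) (snd a) v [] +
        lin_ext (\<lambda>b. G (fst a) (snd a) (fst b) (snd b)) y) x \<in> HH"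
    proof (rule lin_ext_in_subspace[OF HH_subspace])
      fix a assume "a \<in> Poly_Mapping.keys x"
      note xk[OF this]
      moreover from this have "lin_ext (\<lambda>b. G (fst a) (snd a) (fst b) (snd b)) y \<in> HH"
        by (intro lin_ext_in_subspace[OF HH_subspace] G1; simp add: yk lists_LI(1) del:
            in_lists_conv_set)
      ultimately show "G (fst a) (snd a) [] v + G (fst a) (snd a) v [] +
        lin_ext (\<lambda>b. G (fst a) (snd a) (fst b) (snd b)) y \<in> HH"
        using G1[of "fst a" v "snd a" "[]"] G2[of "fst a" "[]" "snd a" v] assms lists_LI(1)
        by (simp add: pm.subspace_add HH_subspace del: in_lists_conv_set)
    qed
  qed
  finally show ?thesis .
qed

lemma delta_HR:
  assumes "r \<in> HR"
  shows "lin_ext delta r \<in> HH"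
  using assms
proof (rule HR_induct[OF _ HH_subspace])
  fix p q l assume "p \<in> lists L" "q \<in> lists L" "l \<in> LR"
  then show "lin_ext (\<lambda>b. delta (p @ b # q)) l \<in> HH"
    unfolding delta_def
    by (rule decon_letter_slot[OF _ _ _ HH_subspace]) (rule phi_HR; use LW_subset_HR in blast)+
qed (rule delta_shuf)

lemma delta_supp:
  assumes "w \<in> lists L"
  shows "(delta w :: _ \<Rightarrow>\<^sub>0 'k) \<in> supp_on (HW \<times> HW)"
  unfolding delta_def
proof (rule supp_on_intros(4))
  fix b assume "b \<in> Poly_Mapping.keys (decon w :: _ \<Rightarrow>\<^sub>0 'k)"
  from decon_keys[OF this] assms show "(case b of (U, V) \<Rightarrow> phi U V) \<in> supp_on (HW \<times> HW)"
    by (cases b) (auto simp: phi_def H_words_def intro!: supp_on_intros)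
qed

end

section \<open>The cobracket by recursion\<close>

lemma sdeg_simps [simp]: "sdeg [] = 0" "sdeg (X # P) = wdeg X + sdeg P" "sdeg (P @ Q) =
    sdeg P + sdeg Q"
  by (simp_all add: sdeg_def)

lemma m_sword_Nil [simp]: "m_sword sc wd [] = 0"
  by (simp add: m_sword_def)

lemma m_sword_Cons [simp]:
  "m_sword sc wd (X # P) = lin_ext (\<lambda>Y. basis (Y # P)) (mu_word sc wd X) +
    signed (wdeg X) (lin_ext (\<lambda>Q. basis (X # Q)) (m_sword sc wd P))"
proof -
  have shift: "(\<Sum>r<Suc j. wdeg ((X # P) ! r)) = wdeg X + (\<Sum>r<j. wdeg (P ! r))" for j
    by (subst sum.lessThan_Suc_shift) simp
  show ?thesis
    unfolding m_sword_def length_Cons sum.lessThan_Suc_shift[where n = "length P"] shift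
    by (simp add: lin_ext_sum pm.scale_sum_right power_int_add)
qed

lemma m_sword_supp: "m_sword sc wd P \<in> supp_on {Q. Q \<noteq> [] \<and> sdeg Q = sdeg P + 1}"
proof (induction P)
  case (Cons X P)
  then show ?case
    by (auto intro!: supp_on_intros dest: supp_onD simp: mu_word_keys wdeg_ldeg)
qed (simp add: supp_on_intros)

lemma m_sword_keys:
  assumes "Q \<in> Poly_Mapping.keys (m_sword sc wd P)"
  shows "sdeg Q = sdeg P + 1" "Q \<noteq> []"
  using supp_onD[OF m_sword_supp assms] by auto

lemma m_sword_append:
  "m_sword sc wd (P @ Q) = lin_ext (\<lambda>P'. basis (P' @ Q)) (m_sword sc wd P) +
    signed (sdeg P) (lin_ext (\<lambda>Q'. basis (P @ Q')) (m_sword sc wd Q))"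
  by (induction P) (simp_all add: pm.scale_right_distrib power_int_add)

text \<open>\<open>ldeg\<close> adds up over the cut, but two words carry the shift by one where
  \<open>X\<close> carried it once.\<close>

lemma delta_keys:
  assumes "b \<in> Poly_Mapping.keys (delta X)"
  shows "wdeg (fst b) + wdeg (snd b) = wdeg X - 1"
proof -
  have "(delta X :: _ \<Rightarrow>\<^sub>0 'b) \<in> supp_on {b. ldeg (fst b) + ldeg (snd b) = ldeg X}"
    unfolding delta_def
  proof (rule supp_on_intros(4))
    fix c assume "c \<in> Poly_Mapping.keys (decon X :: _ \<Rightarrow>\<^sub>0 'b)"
    then show "(case c of (U, V) \<Rightarrow> (phi U V :: _ \<Rightarrow>\<^sub>0 'b)) \<in> supp_on {b. ldeg (fst b) +
        ldeg (snd b) = ldeg X}"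
      by (cases c) (auto dest!: decon_keys simp: phi_def intro!: supp_on_intros)
  qed
  from supp_onD[OF this assms] show ?thesis
    by (simp add: wdeg_ldeg)
qed

definition ins_pair :: "'g word \<Rightarrow> 'g sword \<Rightarrow> 'g sword \<Rightarrow> ('g sword \<times> 'g sword \<Rightarrow>\<^sub>0 'k::field)"
  where "ins_pair X I J = basis (X # I, J) + signed (wdeg X * sdeg I) (basis (I, X # J))"

text \<open>The graded unshuffle coproduct, empty sides included; it distributes the words that are
  not split.\<close>

fun unsh :: "'g sword \<Rightarrow> ('g sword \<times> 'g sword \<Rightarrow>\<^sub>0 'k::field)"
  where
    "unsh [] = basis ([], [])"
  | "unsh (X # P) = lin_ext (\<lambda>(I, J). ins_pair X I J) (unsh P)"

text \<open>\<open>(I, U, V, J)\<close> stands for \<open>X\<^sub>I \<cdot> U \<otimes> V \<cdot> X\<^sub>J\<close>.  Keeping \<open>V\<close> apart from \<open>X\<^sub>J\<close> allows a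
    recursion that
  inserts a new first factor \<open>X\<close> at the head of \<open>X\<^sub>I\<close> or of \<open>X\<^sub>J\<close>.\<close>

type_synonym 'g quad = "'g sword \<times> 'g word \<times> 'g word \<times> 'g sword"

definition ins_quad :: "'g word \<Rightarrow> 'g sword \<Rightarrow> 'g word \<Rightarrow> 'g word \<Rightarrow> 'g sword \<Rightarrow> ('g quad \<Rightarrow>\<^sub>0 'k::field)"
  where "ins_quad X I U V J = basis (X # I, U, V, J) +
    signed (wdeg X * (sdeg I + wdeg U + wdeg V)) (basis (I, U, V, X # J))"

text \<open>The pair cut from \<open>X\<close> has total degree \<open>wdeg X - 1\<close> and passes
  \<open>I\<close>, whose words stood after \<open>X\<close>.\<close>

definition split_quad :: "'g word \<Rightarrow> 'g sword \<Rightarrow> 'g sword \<Rightarrow> ('g quad \<Rightarrow>\<^sub>0 'k::field)"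
  where "split_quad X I J =
    signed ((wdeg X - 1) * sdeg I) (lin_ext (\<lambda>(U, V). basis (I, U, V, J)) (delta X))"

text \<open>Either \<open>X\<close> is the split word and the others are unshuffled around it, or
  the split happens in \<open>P\<close>; then \<open>wdeg X\<close> enters the prefactor, whose
  exponent sums the degrees before the split word.\<close>

fun cobr :: "'g sword \<Rightarrow> ('g quad \<Rightarrow>\<^sub>0 'k::field)"
  where
    "cobr [] = 0"
  | "cobr (X # P) = lin_ext (\<lambda>(I, J). split_quad X I J) (unsh P) +
      signed (wdeg X) (lin_ext (\<lambda>(I, U, V, J). ins_quad X I U V J) (cobr P))"

section \<open>Compatibility of \<open>m\<close> with the recursive cobracket\<close>

context
  fixes sc :: "'k::field \<Rightarrow> 'g::ab_group_add \<Rightarrow> 'g" and wd :: "'g \<Rightarrow> 'g \<Rightarrow> 'g"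
begin

definition m_word_pair :: "'g word \<Rightarrow> 'g word \<Rightarrow> ('g word \<times> 'g word \<Rightarrow>\<^sub>0 'k)"
  where "m_word_pair U V = lin_ext (\<lambda>x. basis (x, V)) (mu_word sc wd U) +
    signed (wdeg U) (lin_ext (\<lambda>x. basis (U, x)) (mu_word sc wd V))"

definition m_pair :: "'g sword \<Rightarrow> 'g sword \<Rightarrow> ('g sword \<times> 'g sword \<Rightarrow>\<^sub>0 'k)"
  where "m_pair I J = lin_ext (\<lambda>I'. basis (I', J)) (m_sword sc wd I) +
    signed (sdeg I) (lin_ext (\<lambda>J'. basis (I, J')) (m_sword sc wd J))"

text \<open>\<open>m\<close> as a derivation along the whole sequence. \<open>U\<close> and
  \<open>V\<close> form one block because \<open>delta_mu\<close> describes the action on them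
  jointly.\<close>

definition m_quad :: "'g sword \<Rightarrow> 'g word \<Rightarrow> 'g word \<Rightarrow> 'g sword \<Rightarrow> ('g quad \<Rightarrow>\<^sub>0 'k)"
  where "m_quad I U V J = lin_ext (\<lambda>I'. basis (I', U, V, J)) (m_sword sc wd I) +
    signed (sdeg I) (lin_ext (\<lambda>(U', V'). basis (I, U', V', J)) (m_word_pair U V)) +
    signed (sdeg I + wdeg U + wdeg V) (lin_ext (\<lambda>J'. basis (I, U, V, J')) (m_sword sc wd J))"

lemma m_word_pair_keys:
  assumes "b \<in> Poly_Mapping.keys (m_word_pair U V)"
  shows "wdeg (fst b) + wdeg (snd b) = wdeg U + wdeg V + 1"
proof -
  have "m_word_pair U V \<in> supp_on {b. wdeg (fst b) + wdeg (snd b) = wdeg U + wdeg V + 1}"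
    unfolding m_word_pair_def by (auto intro!: supp_on_intros simp: wdeg_ldeg mu_word_keys)
  from supp_onD[OF this assms] show ?thesis by simp
qed

lemma delta_mu:
  "lin_ext delta (mu_word sc wd w) = - lin_ext (\<lambda>(U, V). m_word_pair U V) (delta w)"
  unfolding m_word_pair_def by (rule delta_mu_word)

lemma m_pair_ins:
  "lin_ext (\<lambda>(I, J). m_pair I J) (ins_pair X I J) =
    lin_ext (\<lambda>Y. ins_pair Y I J) (mu_word sc wd X) +
    signed (wdeg X) (lin_ext (\<lambda>(I, J). ins_pair X I J) (m_pair I J))"
  by (cases "even (wdeg X)"; cases "even (sdeg I)")
    (simp_all add: ins_pair_def m_pair_def case_prod_unfold signed_if m_sword_keys mu_word_keys
        wdeg_ldeg)

text \<open>\<open>m\<close> changes one word and \<open>unsh\<close> sends each word to one side;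
  these choices are independent, and \<open>lin_ext_swap\<close> exchanges the sums over
  them.\<close>

lemma unsh_m_sword:
  "lin_ext unsh (m_sword sc wd P) = lin_ext (\<lambda>(I, J). m_pair I J) (unsh P)"
proof (induction P)
  case (Cons X P)
  have "lin_ext unsh (m_sword sc wd (X # P)) =
      lin_ext (\<lambda>Y. lin_ext (\<lambda>(I, J). ins_pair Y I J) (unsh P)) (mu_word sc wd X) +
      signed (wdeg X) (lin_ext (\<lambda>(I, J). ins_pair X I J) (lin_ext unsh (m_sword sc wd P)))"
    by simp
  also have "\<dots> = lin_ext (\<lambda>(I, J). lin_ext (\<lambda>Y. ins_pair Y I J) (mu_word sc wd X) +
      signed (wdeg X) (lin_ext (\<lambda>(I, J). ins_pair X I J) (m_pair I J))) (unsh P)"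
    unfolding Cons lin_ext_swap[of _ "unsh P"] by (simp add: case_prod_unfold)
  also have "\<dots> = lin_ext (\<lambda>(I, J). m_pair I J) (unsh (X # P))"
    unfolding m_pair_ins[symmetric] by (simp add: case_prod_unfold)
  finally show ?case .
qed (simp add: m_pair_def)

lemma m_quad_ins:
  "lin_ext (\<lambda>(I, U, V, J). m_quad I U V J) (ins_quad X I U V J) =
    lin_ext (\<lambda>Y. ins_quad Y I U V J) (mu_word sc wd X) +
    signed (wdeg X) (lin_ext (\<lambda>(I, U, V, J). ins_quad X I U V J) (m_quad I U V J))"
proof -
  have deg: "sdeg I + wdeg (fst b) + wdeg (snd b) = sdeg I + wdeg U + wdeg V + 1"
    if "b \<in> Poly_Mapping.keys (m_word_pair U V)" for b
    using m_word_pair_keys[OF that] by simp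
  have mu: "wdeg Y = wdeg X + 1" if "Y \<in> Poly_Mapping.keys (mu_word sc wd X)" for Y
    using that by (simp add: wdeg_ldeg mu_word_keys)
  show ?thesis
    apply (simp add: ins_quad_def m_quad_def case_prod_unfold m_sword_keys mu deg)
    apply (cases "even (wdeg X)"; cases "even (sdeg I)"; cases "even (wdeg U)"; cases "even (wdeg
        V)")
    apply (simp_all add: signed_if)
    done
qed

text \<open>The action on the pair cut from \<open>X\<close> is \<open>delta_mu\<close>, whence the
  first minus. The actions on \<open>I\<close> and \<open>J\<close> meet that pair, of total degree
  \<open>wdeg X - 1\<close>, whence the second.\<close>

lemma m_quad_split:
  "lin_ext (\<lambda>(I, U, V, J). m_quad I U V J) (split_quad X I J) =
    - lin_ext (\<lambda>Y. split_quad Y I J) (mu_word sc wd X) -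
    signed (wdeg X) (lin_ext (\<lambda>(I, J). split_quad X I J) (m_pair I J))"
proof -
  let ?D = "delta X :: _ \<Rightarrow>\<^sub>0 'k"
  have "lin_ext (\<lambda>(I, U, V, J). m_quad I U V J) (split_quad X I J) =
    signed ((wdeg X - 1) * sdeg I) (lin_ext (\<lambda>b. m_quad I (fst b) (snd b) J) ?D)"
    by (simp add: split_quad_def case_prod_unfold)
  \<comment> \<open>By \<open>delta_keys\<close> the total degree of a cut pair is
    \<open>wdeg X - 1\<close> on the whole support, so the sign of the action on \<open>J\<close> is
    constant there.\<close>
  also have "lin_ext (\<lambda>b. m_quad I (fst b) (snd b) J) ?D =
      lin_ext (\<lambda>b. lin_ext (\<lambda>I'. basis (I', fst b, snd b, J)) (m_sword sc wd I)) ?D +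
      signed (sdeg I) (lin_ext (\<lambda>b. basis (I, fst b, snd b, J)) (lin_ext (\<lambda>(U, V). m_word_pair U
          V) ?D)) +
      lin_ext (\<lambda>b. signed (sdeg I +
          wdeg X - 1) (lin_ext (\<lambda>J'. basis (I, fst b, snd b, J')) (m_sword sc wd J))) ?D"
    unfolding m_quad_def
    by (simp add: case_prod_unfold add.assoc delta_keys add_diff_eq del: lin_ext_fun_scale) simp
  also have "lin_ext (\<lambda>(U, V). m_word_pair U V) ?D = - lin_ext delta (mu_word sc wd X)"
    by (simp add: delta_mu)
  also have "lin_ext (\<lambda>b. lin_ext (\<lambda>I'. basis (I', fst b, snd b, J)) (m_sword sc wd I)) ?D =
     lin_ext (\<lambda>I'. lin_ext (\<lambda>b. basis (I', fst b, snd b, J)) ?D) (m_sword sc wd I)"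
    by (rule lin_ext_swap)
  also have "lin_ext (\<lambda>b. signed (sdeg I +
      wdeg X - 1) (lin_ext (\<lambda>J'. basis (I, fst b, snd b, J')) (m_sword sc wd J))) ?D =
     signed (sdeg I + wdeg X - 1) (lin_ext (\<lambda>J'. lin_ext (\<lambda>b. basis (I, fst b, snd b, J')) ?D)
         (m_sword sc wd J))"
    by (simp add: lin_ext_swap[of _ ?D])
  finally show ?thesis
    by (cases "even (wdeg X)"; cases "even (sdeg I)")
      (simp_all add: split_quad_def m_pair_def case_prod_unfold signed_if m_sword_keys
          mu_word_keys wdeg_ldeg)
qed

text \<open>If \<open>X\<close> is the split word, \<open>m_quad_split\<close> and
  \<open>unsh_m_sword\<close> apply; otherwise \<open>m_quad_ins\<close> and the induction
  hypothesis. In the latter case the minus on the terms with \<open>mu X\<close> comes from the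
  prefactor \<open>(-1)^(wdeg X)\<close> of \<open>cobr\<close>, whose exponent grows by
  one.\<close>

lemma m_quad_cobr:
  "lin_ext (\<lambda>(I, U, V, J). m_quad I U V J) (cobr P) = - lin_ext cobr (m_sword sc wd P)"
proof (induction P)
  case (Cons X P)
  let ?q = "\<lambda>b. m_quad (fst b) (fst (snd b)) (fst (snd (snd b))) (snd (snd (snd b)))"
  let ?i = "\<lambda>X b. ins_quad X (fst b) (fst (snd b)) (fst (snd (snd b))) (snd (snd (snd b)))"
  let ?s = "\<lambda>X b. split_quad X (fst b) (snd b)"
  let ?mu = "mu_word sc wd"
  note q = m_quad_ins[unfolded case_prod_unfold] and s = m_quad_split[unfolded case_prod_unfold]
  have 1: "lin_ext ?q (cobr (X # P)) =
      lin_ext (\<lambda>b. lin_ext ?q (?s X b)) (unsh P) +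
          signed (wdeg X) (lin_ext (\<lambda>b. lin_ext ?q (?i X b)) (cobr P))"
    by (simp add: case_prod_unfold)
  have 2: "lin_ext cobr (m_sword sc wd (X # P)) =
      lin_ext (\<lambda>Y. lin_ext (?s Y) (unsh P)) (?mu X) +
      lin_ext (\<lambda>Y. signed (wdeg X + 1) (lin_ext (?i Y) (cobr P))) (?mu X) +
      signed (wdeg X) (lin_ext (?s X) (lin_ext unsh (m_sword sc wd P))) +
      lin_ext (?i X) (lin_ext cobr (m_sword sc wd P))"
    by (simp add: case_prod_unfold wdeg_ldeg mu_word_keys pm.scale_right_distrib add.assoc)
  have 3: "lin_ext (\<lambda>Y. lin_ext (?s Y) (unsh P)) (?mu X) =
      lin_ext (\<lambda>b. lin_ext (\<lambda>Y. ?s Y b) (?mu X)) (unsh P)"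
    "lin_ext (\<lambda>Y. lin_ext (?i Y) (cobr P)) (?mu X) =
        lin_ext (\<lambda>b. lin_ext (\<lambda>Y. ?i Y b) (?mu X)) (cobr P)"
    by (rule lin_ext_swap)+
  have 4: "lin_ext cobr (m_sword sc wd P) = - lin_ext ?q (cobr P)"
    using Cons by (simp add: case_prod_unfold)
  show ?case
    unfolding case_prod_unfold 1 2 q s unsh_m_sword lin_ext_fun_scale 3 4
    by (cases "even (wdeg X)") (simp_all add: signed_if)
qed simp

end

section \<open>Agreement of the recursions with the sums over positions and subsets\<close>

lemma decon_sum: "decon w = (\<Sum>j\<le>length w. basis (take j w, drop j w))"
  by (induction w) (simp_all add: sum.atMost_Suc_shift lin_ext_sum del: sum.atMost_Suc)

text \<open>As \<open>wdeg U + 1 = ldeg U\<close>, the prefactor of \<open>kappa_sword\<close> is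
  that of \<open>phi\<close>; the cuts at both ends contribute nothing.\<close>

lemma delta_sum:
  "delta w = (\<Sum>j\<in>{0<..<length w}. signed (wdeg (take j w) + 1)
    (basis (take j w, drop j w) +
      signed (wdeg (take j w) * wdeg (drop j w)) (basis (drop j w, take j w))))"
proof -
  have "delta w = (\<Sum>j\<le>length w. phi (take j w) (drop j w))"
    by (simp add: delta_def decon_sum lin_ext_sum)
  also have "\<dots> = (\<Sum>j\<in>{0<..<length w}. phi (take j w) (drop j w))"
    by (rule sum.mono_neutral_right) (auto simp: phi_def)
  also have "\<dots> = (\<Sum>j\<in>{0<..<length w}. signed (wdeg (take j w) + 1)
      (basis (take j w, drop j w) +
        signed (wdeg (take j w) * wdeg (drop j w)) (basis (drop j w, take j w))))"
    by (rule sum.cong) (auto simp: phi_def wdeg_ldeg signed_if)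
  finally show ?thesis .
qed

lemma filter_map_Suc: "filter (\<lambda>q. q < Suc a) (map Suc B) = map Suc (filter (\<lambda>q. q < a) B)"
  by (simp add: filter_map comp_def)

lemma koszul_map_Suc: "koszul (d # ds) (map Suc A) = koszul ds A"
  by (induction A) (simp_all add: koszul_Cons filter_map_Suc comp_def)

text \<open>Position \<open>0\<close> is the smallest, so it forms an inversion exactly with the
  entries listed before it. The passing signs in \<open>unsh\<close> and \<open>cobr\<close> come
  from this formula.\<close>

lemma koszul_insert_0:
  "(koszul (d # ds) (map Suc A @ 0 # map Suc B) :: 'k::field) =
    (-1) powi (d * sum_list (map ((!) ds) A)) * koszul ds (A @ B)"
proof (induction A)
  case Nil
  then show ?case
    by (simp add: koszul_Cons koszul_map_Suc)
next
  case (Cons a A)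
  then show ?case
    by (simp add: koszul_Cons filter_map_Suc comp_def power_int_add algebra_simps)
qed

lemma sorted_list_of_set_image_Suc:
  "finite I \<Longrightarrow> sorted_list_of_set (Suc ` I) = map Suc (sorted_list_of_set I)"
  by (rule strict_sorted_equal) (simp_all add: sorted_wrt_map)

lemma sorted_list_of_set_insert_0:
  "finite I \<Longrightarrow> sorted_list_of_set (insert 0 (Suc ` I)) = 0 # map Suc (sorted_list_of_set I)"
  by (rule strict_sorted_equal)
    (simp_all add: sorted_wrt_map strict_sorted_list_of_set
      del: sorted_list_of_set_insert_remove sorted_list_of_set.sorted_key_list_of_set_insert)

lemma sum_Pow_image_Suc:
  "sum F (Pow (Suc ` S)) = (\<Sum>I\<in>Pow S. F (Suc ` I))"
proof -
  have "Pow (Suc ` S) = (`) Suc ` Pow S"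
    by (rule image_Pow_surj[symmetric]) simp
  moreover have "inj_on ((`) Suc) (Pow S)"
    by (simp add: inj_on_def inj_image_eq_iff)
  ultimately show ?thesis
    by (simp add: sum.reindex)
qed

lemma sum_Pow_insert_0:
  assumes "finite S"
  shows "sum F (Pow (insert 0 (Suc ` S))) = (\<Sum>I\<in>Pow S. F (insert 0 (Suc ` I)) + F (Suc ` I))"
proof -
  have "sum F (Pow (insert 0 (Suc ` S))) = sum F (Pow (Suc ` S)) + sum F (insert 0 ` Pow (Suc ` S))"
    unfolding Pow_insert by (rule sum.union_disjoint) (use assms in auto)
  also have "sum F (insert 0 ` Pow (Suc ` S)) = sum (F \<circ> insert 0) (Pow (Suc ` S))"
    by (rule sum.reindex) (auto simp: inj_on_def insert_eq_iff)
  finally show ?thesis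
    by (simp add: sum_Pow_image_Suc sum.distrib add.commute)
qed

abbreviation "sl \<equiv> sorted_list_of_set :: nat set \<Rightarrow> nat list"

lemma sdeg_map: "sdeg (map ((!) P) A) = sum_list (map ((!) (map wdeg P)) A)"
    if "set A \<subseteq> {..<length P}"
  using that by (induction A) simp_all

text \<open>Subsets of positions are sorted by whether they contain \<open>0\<close>, the position
  of the new first word; this is the choice made by \<open>ins_pair\<close>.\<close>

lemma unsh_sum:
  "(unsh P :: _ \<Rightarrow>\<^sub>0 'k::field) = (\<Sum>I\<in>Pow {..<length P}.
    pm_scale (koszul (map wdeg P) (sl I @ sl ({..<length P} - I)))
      (basis (map ((!) P) (sl I), map ((!) P) (sl ({..<length P} - I)))))"
proof (induction P)
  case (Cons X P)
  let ?n = "length P"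
  let ?F = "\<lambda>Q I. pm_scale (koszul (map wdeg Q) (sl I @ sl ({..<length Q} - I)))
      (basis (map ((!) Q) (sl I), map ((!) Q) (sl ({..<length Q} - I)))) :: _ \<Rightarrow>\<^sub>0 'k"
  have *: "?F (X # P) (insert 0 (Suc ` I)) + ?F (X # P) (Suc ` I) =
      lin_ext (\<lambda>(I, J). ins_pair X I J) (?F P I)"
    if "I \<in> Pow {..<?n}" for I
  proof -
    have fin: "finite I" using that finite_subset by auto
    have c: "{..<Suc ?n} - insert 0 (Suc ` I) = Suc ` ({..<?n} - I)"
      "{..<Suc ?n} - Suc ` I = insert 0 (Suc ` ({..<?n} - I))"
      by (auto simp: lessThan_Suc_eq_insert_0)
    have "sdeg (map ((!) P) (sl I)) = sum_list (map ((!) (map wdeg P)) (sl I))"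
      by (rule sdeg_map) (use that fin in auto)
    then show ?thesis
      using koszul_insert_0[where A = "[]" and d = "wdeg X" and ds = "map wdeg P" and B =
          "sl I @ sl ({..<?n} - I)" and ?'k = 'k]
      by (simp add: c fin sorted_list_of_set_image_Suc sorted_list_of_set_insert_0 ins_pair_def
          koszul_insert_0 comp_def pm.scale_right_distrib mult.commute del:
              sorted_list_of_set_insert_remove sorted_list_of_set.sorted_key_list_of_set_insert)
  qed
  have "Pow {..<length (X # P)} = Pow (insert 0 (Suc ` {..<?n}))"
    by (simp add: lessThan_Suc_eq_insert_0)
  then have "sum (?F (X # P)) (Pow {..<length (X # P)}) =
      (\<Sum>I\<in>Pow {..<?n}. lin_ext (\<lambda>(I, J). ins_pair X I J) (?F P I))"
    by (simp only: sum_Pow_insert_0[OF finite_lessThan] * cong: sum.cong)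
  also have "\<dots> = lin_ext (\<lambda>(I, J). ins_pair X I J) (unsh P)"
    unfolding Cons lin_ext_sum ..
  finally show ?case
    by (simp only: unsh.simps)
qed simp

definition quad_sum :: "'g sword \<Rightarrow> nat \<Rightarrow> nat list \<Rightarrow> nat list \<Rightarrow> ('g quad \<Rightarrow>\<^sub>0 'k::field)"
  where "quad_sum Y s A B =
    pm_scale (koszul (map wdeg Y) (A @ [s, Suc s] @ B))
      (basis (map ((!) Y) A, Y ! s, Y ! Suc s, map ((!) Y) B)) +
    pm_scale (koszul (map wdeg Y) (A @ [Suc s, s] @ B))
      (basis (map ((!) Y) A, Y ! Suc s, Y ! s, map ((!) Y) B))"

lemma quad_sum_Suc:
  assumes "set A \<subseteq> {..<length Y}" "Suc s < length Y"
  shows "quad_sum (X # Y) (Suc s) (0 # map Suc A) (map Suc B) +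
      quad_sum (X # Y) (Suc s) (map Suc A) (0 # map Suc B) =
    (lin_ext (\<lambda>(I, U, V, J). ins_quad X I U V J) (quad_sum Y s A B) :: _ \<Rightarrow>\<^sub>0 'k::field)"
proof -
  have 0: "koszul (d # ds) (0 # map Suc A') = (koszul ds A' :: 'k)" for d ds A'
    using koszul_insert_0[where A = "[]"] by simp
  have 1: "koszul (map wdeg (X # Y)) (0 # map Suc A @ [Suc i, Suc j] @ map Suc B) =
      (koszul (map wdeg Y) (A @ [i, j] @ B) :: 'k)" for i j
    using 0[of "wdeg X" "map wdeg Y" "A @ [i, j] @ B"] by simp
  \<comment> \<open>Position \<open>0\<close> is listed after \<open>A\<close> and the split pair
    and passes them all. Leaving \<open>i\<close> and \<open>j\<close> open covers both orders of
    the pair.\<close>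
  have 2: "koszul (map wdeg (X # Y)) (map Suc A @ [Suc i, Suc j] @ 0 # map Suc B) =
      ((-1) powi (wdeg X * (sdeg (map ((!) Y) A) + wdeg (Y ! i) + wdeg (Y ! j))) *
      koszul (map wdeg Y) (A @ [i, j] @ B) :: 'k)" if "i < length Y" "j < length Y" for i j
    using koszul_insert_0[of "wdeg X" "map wdeg Y" "A @ [i, j]" B, where ?'k = 'k] that
    by (simp add: sdeg_map[OF assms(1)] add.assoc)
  have 3: "map ((!) (X # Y)) (0 # map Suc l) =
      X # map ((!) Y) l" "map ((!) (X # Y)) (map Suc l) = map ((!) Y) l" for l
    by (simp_all add: comp_def)
  show ?thesis
    unfolding quad_sum_def append_Cons append_Nil 3 1[unfolded append_Cons append_Nil]
      2[OF Suc_lessD[OF assms(2)] assms(2), unfolded append_Cons append_Nil]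
      2[OF assms(2) Suc_lessD[OF assms(2)], unfolded append_Cons append_Nil]
    by (simp add: ins_quad_def pm.scale_right_distrib algebra_simps)
qed

lemma quad_sum_0:
  assumes "set A \<subseteq> {..<length P}"
  shows "quad_sum (U # V # P) 0 (map Suc (map Suc A)) (map Suc (map Suc B)) =
    (pm_scale (koszul (map wdeg P) (A @ B)) (signed ((wdeg U + wdeg V) * sdeg (map ((!) P) A))
      (basis (map ((!) P) A, U, V, map ((!) P) B) +
       signed (wdeg U * wdeg V) (basis (map ((!) P) A, V, U, map ((!) P) B)))) :: _ \<Rightarrow>\<^sub>0 'k::field)"
proof -
  note k = koszul_insert_0[where ?'k = 'k]
  have "koszul (map wdeg (U # V # P)) (map Suc (map Suc A) @ 0 # map Suc (0 # map Suc B)) =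
      ((-1) powi ((wdeg U + wdeg V) * sdeg (map ((!) P) A)) * koszul (map wdeg P) (A @ B) :: 'k)"
    using k[of "wdeg U" "wdeg V # map wdeg P" "map Suc A" "0 # map Suc B"]
    by (simp add: k sdeg_map[OF assms] comp_def power_int_add algebra_simps)
  \<comment> \<open>In the exchanged order \<open>U\<close>, at position \<open>0\<close>, also
    passes \<open>V\<close>; hence the additional \<open>wdeg U * wdeg V\<close>.\<close>
  moreover have "koszul (map wdeg (U # V # P)) ((map Suc (map Suc A @ [0])) @ 0 # map Suc (map
      Suc B)) =
      ((-1) powi ((wdeg U + wdeg V) * sdeg (map ((!) P) A) +
          wdeg U * wdeg V) * koszul (map wdeg P) (A @ B) :: 'k)"
    using k[of "wdeg U" "wdeg V # map wdeg P" "map Suc A @ [0]" "map Suc B"]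
    by (simp add: k sdeg_map[OF assms] comp_def power_int_add algebra_simps)
  ultimately show ?thesis
    by (simp add: quad_sum_def comp_def pm.scale_right_distrib power_int_add mult.commute)
qed

text \<open>The split list has \<open>length P + 1\<close> entries, hence positions
  \<open>{..length P}\<close>. Quadruples stay unjoined to match \<open>cobr\<close>.\<close>

definition kappa_term :: "'g sword \<Rightarrow> nat \<Rightarrow> nat set \<Rightarrow> nat \<Rightarrow> ('g quad \<Rightarrow>\<^sub>0 'k::field)"
  where "kappa_term P s I j =
    signed ((\<Sum>i<s. wdeg (P ! i)) + (wdeg (take j (P ! s)) + 1))
      (quad_sum (take s P @ [take j (P ! s), drop j (P ! s)] @ drop (Suc s) P) s
        (sl I) (sl ({..length P} - {s, Suc s} - I)))"

text \<open>\<open>U\<close> and \<open>V\<close> occupy positions \<open>0\<close> and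
  \<open>1\<close>, so the remaining words are shifted by two. Both pass the words of
  \<open>I\<close>, which gives the sign of \<open>split_quad\<close>.\<close>

lemma kappa_term_0:
  assumes "I \<subseteq> {..<length P}"
  shows "(\<Sum>j\<in>{0<..<length X}. kappa_term (X # P) 0 (Suc ` Suc ` I) j) =
    pm_scale (koszul (map wdeg P) (sl I @ sl ({..<length P} - I)))
      (split_quad X (map ((!) P) (sl I)) (map ((!) P) (sl ({..<length P} - I))) :: _ \<Rightarrow>\<^sub>0 'k::field)"
proof -
  have fin: "finite I" using assms finite_subset by auto
  have c: "{..length (X # P)} - {0, Suc 0} - Suc ` Suc ` I = Suc ` Suc ` ({..<length P} - I)"
  proof (rule set_eqI)
    fix x show "x \<in> {..length (X # P)} - {0, Suc 0} - Suc ` Suc ` I \<longleftrightarrow> x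
        \<in> Suc ` Suc ` ({..<length P} - I)"
      by (cases x; cases "x - 1") (auto simp: inj_image_mem_iff)
  qed
  have deg: "wdeg (take j X) + wdeg (drop j X) = wdeg X - 1" for j
    using arg_cong[OF append_take_drop_id[of j X], of ldeg]
    by (simp only: wdeg_ldeg ldeg_simps)
  have set_sl: "set (sl I) \<subseteq> {..<length P}"
    using fin assms by simp
  show ?thesis
    unfolding kappa_term_def c
    by (simp add: fin sorted_list_of_set_image_Suc quad_sum_0[OF set_sl, unfolded map_map] deg
        split_quad_def
        delta_sum lin_ext_sum pm.scale_sum_right pm.scale_right_distrib mult_ac)
qed

lemma kappa_term_Suc:
  assumes "I \<subseteq> {..length P} - {s, Suc s}" "s < length P"
  shows "kappa_term (X # P) (Suc s) (insert 0 (Suc ` I)) j +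
      kappa_term (X # P) (Suc s) (Suc ` I) j =
    (signed (wdeg X) (lin_ext (\<lambda>(I, U, V, J). ins_quad X I U V J) (kappa_term P s I j)) :: _ \<Rightarrow>\<^sub>0
        'k::field)"
proof -
  have fin: "finite I" using assms(1) finite_subset by auto
  let ?J = "{..length P} - {s, Suc s} - I"
  have c: "{..length (X # P)} - {Suc s, Suc (Suc s)} - insert 0 (Suc ` I) = Suc ` ?J"
    "{..length (X # P)} - {Suc s, Suc (Suc s)} - Suc ` I = insert 0 (Suc ` ?J)"
    by (auto simp: atMost_Suc_eq_insert_0)
  have shift: "(\<Sum>i<Suc s. wdeg ((X # P) ! i)) = wdeg X + (\<Sum>i<s. wdeg (P ! i))"
    by (subst sum.lessThan_Suc_shift) simp
  have set_sl: "set (sl I) \<subseteq> {..<length (take s P @ [take j (P ! s), drop j (P ! s)] @ drop (Suc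
      s) P)}"
    using fin assms by auto
  have len: "Suc s < length (take s P @ [take j (P ! s), drop j (P ! s)] @ drop (Suc s) P)"
    using assms(2) by simp
  show ?thesis
    unfolding kappa_term_def c shift lin_ext_scale quad_sum_Suc[OF set_sl len, symmetric]
    by (simp add: fin sorted_list_of_set_image_Suc sorted_list_of_set_insert_0 power_int_add
        mult.assoc
       pm.scale_right_distrib pm.scale_right_diff_distrib pm.scale_minus_right
       del: sorted_list_of_set_insert_remove sorted_list_of_set.sorted_key_list_of_set_insert)
qed

text \<open>Peeling off the first word matches \<open>s = 0\<close> with splitting it and
  \<open>Suc s\<close> with inserting it into a summand of the tail, according to whether position
  \<open>0\<close> belongs to \<open>I\<close>.\<close>

lemma cobr_sum:
  "cobr P = (\<Sum>s<length P. \<Sum>I\<in>Pow ({..length P} - {s, Suc s}). \<Sum>j\<in>{0<..<length (P ! s)}.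
    kappa_term P s I j :: _ \<Rightarrow>\<^sub>0 'k::field)"
proof (induction P)
  case (Cons X P)
  let ?S = "\<lambda>P s. {..length P} - {s, Suc s} :: nat set"
  have S: "?S (X # P) 0 = Suc ` Suc ` {..<length P}"
  proof (rule set_eqI)
    fix x show "x \<in> {..length (X # P)} - {0, Suc 0} \<longleftrightarrow> x \<in> Suc ` Suc ` {..<length P}"
      by (cases x; cases "x - 1") auto
  qed
  have S': "?S (X # P) (Suc s) = insert 0 (Suc ` ?S P s)" for s
    by (auto simp: atMost_Suc_eq_insert_0)
  have "(\<Sum>I\<in>Pow (?S (X # P) 0). \<Sum>j\<in>{0<..<length ((X # P) ! 0)}. kappa_term (X # P) 0 I j) =
      (lin_ext (\<lambda>(I, J). split_quad X I J) (unsh P) :: _ \<Rightarrow>\<^sub>0 'k)"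
    unfolding S sum_Pow_image_Suc nth_Cons_0 unsh_sum lin_ext_sum
    by (intro sum.cong refl) (simp add: kappa_term_0)
  moreover have "(\<Sum>I\<in>Pow (?S (X # P) (Suc s)). \<Sum>j\<in>{0<..<length ((X # P) ! Suc s)}. kappa_term (X
      # P) (Suc s) I j) =
      (signed (wdeg X) (lin_ext (\<lambda>(I, U, V, J). ins_quad X I U V J)
        (\<Sum>I\<in>Pow (?S P s). \<Sum>j\<in>{0<..<length (P ! s)}. kappa_term P s I j)) :: _ \<Rightarrow>\<^sub>0 'k)"
    if "s < length P" for s
    unfolding S' sum_Pow_insert_0[OF finite_Diff[OF finite_atMost]] nth_Cons_Suc lin_ext_sum
        pm.scale_sum_right sum.distrib[symmetric]
    by (intro sum.cong refl) (rule kappa_term_Suc, use that in auto)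
  ultimately show ?case
    unfolding length_Cons sum.lessThan_Suc_shift
    by (simp add: Cons lin_ext_sum pm.scale_sum_right)
qed simp

definition join_quad :: "'g quad \<Rightarrow> 'g sword \<times> 'g sword"
  where "join_quad = (\<lambda>(I, U, V, J). (I @ [U], V # J))"

lemma kappa_sword_cobr: "kappa_sword P = lin_ext (\<lambda>b. basis (join_quad b)) (cobr P)"
proof -
  have "(take s P @ [U, V] @ drop (Suc s) P) ! s =
      U" "(take s P @ [U, V] @ drop (Suc s) P) ! Suc s = V"
    if "s < length P" for s U V
    using that by (simp_all add: nth_append)
  then show ?thesis
    unfolding kappa_sword_def cobr_sum lin_ext_sum
    by (intro sum.cong refl)
      (simp add: kappa_term_def quad_sum_def join_quad_def Let_def power_int_add)
qed

section \<open>Descent to the symmetric algebra\<close>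

lemma subspace_lin_ext_vimage:
  assumes "pm.subspace W"
  shows "pm.subspace {r. lin_ext f r \<in> W}"
  using assms by (auto simp: pm.subspace_def)

text \<open>Terms with \<open>X\<close> and \<open>Y\<close> on different sides occur in both orders
  of insertion and cancel. What is left are exchanges at the head of \<open>I\<close> or of
  \<open>J\<close>, hence relations.\<close>

lemma ins_pair_swap:
  "lin_ext (\<lambda>(I, J). ins_pair X I J) (ins_pair Y I J) -
    signed (wdeg X * wdeg Y) (lin_ext (\<lambda>(I, J). ins_pair Y I J) (ins_pair X I J)) =
    basis (X # Y # I, J) - signed (wdeg X * wdeg Y) (basis (Y # X # I, J)) +
    signed ((wdeg X + wdeg Y) * sdeg I)
      (basis (I, X # Y # J) - signed (wdeg X * wdeg Y) (basis (I, Y # X # J)))"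
  by (cases "even (wdeg X)"; cases "even (wdeg Y)"; cases "even (sdeg I)")
    (simp_all add: ins_pair_def signed_if)

lemma ins_quad_swap:
  "lin_ext (\<lambda>(I, U, V, J). ins_quad X I U V J) (ins_quad Y I U V J) -
    signed (wdeg X * wdeg Y) (lin_ext (\<lambda>(I, U, V, J). ins_quad Y I U V J) (ins_quad X I U V J)) =
    basis (X # Y # I, U, V, J) - signed (wdeg X * wdeg Y) (basis (Y # X # I, U, V, J)) +
    signed ((wdeg X + wdeg Y) * (sdeg I + wdeg U + wdeg V))
      (basis (I, U, V, X # Y # J) - signed (wdeg X * wdeg Y) (basis (I, U, V, Y # X # J)))"
  by (cases "even (wdeg X)"; cases "even (wdeg Y)"; cases "even (sdeg I)"; cases "even (wdeg U)";
      cases "even (wdeg V)")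
    (simp_all add: ins_quad_def signed_if)

lemma split_quad_ins_pair:
  "lin_ext (\<lambda>(I, J). split_quad X I J) (ins_pair Y I J) =
    (signed ((wdeg X - 1) * wdeg Y)
      (lin_ext (\<lambda>(I, U, V, J). ins_quad Y I U V J) (split_quad X I J)) :: _ \<Rightarrow>\<^sub>0 'k::field)"
proof -
  have *: "sdeg I + wdeg (fst b) + wdeg (snd b) = sdeg I + wdeg X - 1"
    if "b \<in> Poly_Mapping.keys (delta X :: _ \<Rightarrow>\<^sub>0 'k)" for b
    using delta_keys[OF that] by simp
  have "lin_ext (\<lambda>(I, U, V, J). ins_quad Y I U V J) (split_quad X I J) =
      signed ((wdeg X - 1) * sdeg I) (lin_ext (\<lambda>b. basis (Y # I, fst b, snd b, J)) (delta X) +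
        signed (wdeg Y * (sdeg I + wdeg X -
            1)) (lin_ext (\<lambda>b. basis (I, fst b, snd b, Y # J)) (delta X)) :: _ \<Rightarrow>\<^sub>0 'k)"
    by (simp add: split_quad_def ins_quad_def case_prod_unfold * pm.scale_right_distrib)
  then show ?thesis
    by (cases "even (wdeg X)"; cases "even (wdeg Y)"; cases "even (sdeg I)")
      (simp_all add: split_quad_def ins_pair_def signed_if case_prod_unfold)
qed

text \<open>Terms in which \<open>X\<close> or \<open>Y\<close> is itself split cancel, since by
  \<open>split_quad_ins_pair\<close> splitting one commutes with distributing the other up to sign.
  Only splits inside \<open>Q\<close> remain.\<close>

lemma cobr_swap:
  "cobr (X # Y # Q) - signed (wdeg X * wdeg Y) (cobr (Y # X # Q)) =
    signed (wdeg X + wdeg Y) (lin_ext (\<lambda>(I, U, V, J).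
      lin_ext (\<lambda>(I, U, V, J). ins_quad X I U V J) (ins_quad Y I U V J) -
      signed (wdeg X * wdeg Y) (lin_ext (\<lambda>(I, U, V, J). ins_quad Y I U V J) (ins_quad X I U V
          J))) (cobr Q))"
  by (simp add: case_prod_unfold split_quad_ins_pair[unfolded case_prod_unfold],
      cases "even (wdeg X)"; cases "even (wdeg Y)") (simp_all add: signed_if)

lemma unsh_swap:
  "unsh (X # Y # Q) - signed (wdeg X * wdeg Y) (unsh (Y # X # Q)) =
    lin_ext (\<lambda>(I, J). lin_ext (\<lambda>(I, J). ins_pair X I J) (ins_pair Y I J) -
      signed (wdeg X * wdeg Y) (lin_ext (\<lambda>(I, J). ins_pair Y I J) (ins_pair X I J))) (unsh Q)"
  by (simp add: case_prod_unfold)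

context gerstenhaber_algebra
begin

abbreviation "SR \<equiv> S_rel scale grade"
abbreviation "SSR \<equiv> SS_rel scale grade"
abbreviation "LH \<equiv> lists HW"
abbreviation "M \<equiv> m_sword scale wedge"

lemma SR_subspace: "pm.subspace SR"
  by (simp add: S_rel_def)

lemma SSR_subspace: "pm.subspace SSR"
  by (simp add: SS_rel_def)

lemma SR_word:
  "h \<in> HR \<Longrightarrow> P \<in> LH \<Longrightarrow> Q \<in> LH \<Longrightarrow> lin_ext (\<lambda>X. basis (P @ X # Q)) h \<in> SR"
  unfolding S_rel_def tensor_rel_def by (rule pm.span_base) blast

lemma SR_swap:
  "P \<in> LH \<Longrightarrow> Q \<in> LH \<Longrightarrow> X \<in> HW \<Longrightarrow> Y \<in> HW \<Longrightarrow>
    basis (P @ X # Y # Q) - signed (wdeg X * wdeg Y) (basis (P @ Y # X # Q)) \<in> SR"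
proof -
  assume "P \<in> LH" "Q \<in> LH" "X \<in> HW" "Y \<in> HW"
  then have "basis (P @ [X, Y] @ Q) - signed (wdeg X * wdeg Y) (basis (P @ [Y, X] @ Q)) \<in> SR"
    unfolding S_rel_def by (intro pm.span_base) blast
  then show ?thesis by simp
qed

lemma SR_induct:
  assumes "r \<in> SR" "pm.subspace W"
    and "\<And>P Q h. P \<in> LH \<Longrightarrow> Q \<in> LH \<Longrightarrow> h \<in> HR \<Longrightarrow> lin_ext (\<lambda>X. f (P @ X # Q)) h \<in> W"
    and "\<And>P Q X Y. P \<in> LH \<Longrightarrow> Q \<in> LH \<Longrightarrow> X \<in> HW \<Longrightarrow> Y \<in> HW \<Longrightarrow>
      f (P @ X # Y # Q) - signed (wdeg X * wdeg Y) (f (P @ Y # X # Q)) \<in> W"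
  shows "lin_ext f r \<in> W"
  using assms(1) unfolding S_rel_def
proof (rule lin_ext_span_in_subspace[OF _ assms(2)])
  fix g :: "'g sword \<Rightarrow>\<^sub>0 'k"
  assume "g \<in> tensor_rel HW HR \<union>
     {basis (P @ [X, Y] @ Q) - signed (wdeg X * wdeg Y) (basis (P @ [Y, X] @ Q)) | P Q X Y.
       P \<in> LH \<and> Q \<in> LH \<and> X \<in> HW \<and> Y \<in> HW}"
  then show "lin_ext f g \<in> W"
    unfolding tensor_rel_def
    by (elim UnE CollectE exE conjE) (simp_all add: assms(3,4))
qed

text \<open>Each generator arises from one at the head of a list by prepending words. For maps
  defined by recursion on the first word it thus suffices to treat relations at the head and one
  prepending step.\<close>

lemma SR_induct_Cons:
  assumes "r \<in> SR" "pm.subspace W"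
    and word: "\<And>h Q. h \<in> HR \<Longrightarrow> Q \<in> LH \<Longrightarrow> lin_ext (\<lambda>X. basis (X # Q)) h \<in> W"
    and swap: "\<And>X Y Q. X \<in> HW \<Longrightarrow> Y \<in> HW \<Longrightarrow> Q \<in> LH \<Longrightarrow>
      basis (X # Y # Q) - signed (wdeg X * wdeg Y) (basis (Y # X # Q)) \<in> W"
    and Cons: "\<And>X x. X \<in> HW \<Longrightarrow> x \<in> W \<Longrightarrow> lin_ext (\<lambda>P. basis (X # P)) x \<in> W"
  shows "r \<in> W"
proof -
  have append: "lin_ext (\<lambda>Q. basis (P @ Q)) x \<in> W" if "P \<in> LH" "x \<in> W" for P x
    using that(1)
  proof (induction P)
    case (Cons X P)
    then show ?case
      using assms(5)[of X "lin_ext (\<lambda>Q. basis (P @ Q)) x"] by simp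
  qed (simp add: that)
  have "lin_ext basis r \<in> W"
    using assms(1,2)
  proof (rule SR_induct)
    fix P Q h assume "P \<in> LH" "Q \<in> LH" "h \<in> HR"
    then show "lin_ext (\<lambda>X. basis (P @ X # Q)) h \<in> W"
      using append[OF _ word, of P h Q] by simp
  next
    fix P Q X Y assume "P \<in> LH" "Q \<in> LH" "X \<in> HW" "Y \<in> HW"
    then show "basis (P @ X # Y # Q) - signed (wdeg X * wdeg Y) (basis (P @ Y # X # Q)) \<in> W"
      using append[OF _ swap, of P X Y Q] by simp
  qed
  then show ?thesis by simp
qed

lemma SR_append:
  assumes "r \<in> SR" "A \<in> LH" "B \<in> LH"
  shows "lin_ext (\<lambda>P. basis (A @ P @ B)) r \<in> SR"
  using assms(1)
proof (rule SR_induct[OF _ SR_subspace])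
  fix P Q h assume "P \<in> LH" "Q \<in> LH" "h \<in> HR"
  then show "lin_ext (\<lambda>X. basis (A @ (P @ X # Q) @ B)) h \<in> SR"
    using SR_word[of h "A @ P" "Q @ B"] assms(2,3) by simp
next
  fix P Q X Y assume "P \<in> LH" "Q \<in> LH" "X \<in> HW" "Y \<in> HW"
  then show "basis (A @ (P @ X # Y # Q) @ B) -
      signed (wdeg X * wdeg Y) (basis (A @ (P @ Y # X # Q) @ B)) \<in> SR"
    using SR_swap[of "A @ P" "Q @ B" X Y] assms(2,3) by simp
qed

lemma SR_Cons: "r \<in> SR \<Longrightarrow> X \<in> HW \<Longrightarrow> lin_ext (\<lambda>P. basis (X # P)) r \<in> SR"
  using SR_append[of r "[X]" "[]"] by simp

lemma SR_snoc: "r \<in> SR \<Longrightarrow> X \<in> HW \<Longrightarrow> lin_ext (\<lambda>P. basis (P @ [X])) r \<in> SR"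
  using SR_append[of r "[]" "[X]"] by simp

text \<open>Swap relations are homogeneous, so the sign is a common factor; for a relation inside
  one word it depends on the degree of that word, and \<open>twist_HR\<close> absorbs it.\<close>

lemma twist_SR:
  assumes "r \<in> SR"
  shows "lin_ext (\<lambda>P. signed (s (sdeg P)) (basis P)) r \<in> SR"
  using assms
proof (rule SR_induct[OF _ SR_subspace])
  fix P Q h assume *: "P \<in> LH" "Q \<in> LH" "h \<in> HR"
  show "lin_ext (\<lambda>X. signed (s (sdeg (P @ X # Q))) (basis (P @ X # Q))) h \<in> SR"
    using SR_word[OF twist_HR[OF *(3), of "\<lambda>d. s (sdeg P + (d - 1 + sdeg Q))"] *(1,2)]
    by (simp add: wdeg_ldeg)
next
  fix P Q X Y assume "P \<in> LH" "Q \<in> LH" "X \<in> HW" "Y \<in> HW"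
  from pm.subspace_scale[OF SR_subspace SR_swap[OF this], of "(-1) powi s (sdeg (P @ X # Y # Q))"]
  show "signed (s (sdeg (P @ X # Y # Q))) (basis (P @ X # Y # Q)) -
      signed (wdeg X * wdeg Y) (signed (s (sdeg (P @ Y # X # Q))) (basis (P @ Y # X # Q))) \<in> SR"
    by (simp add: pm.scale_right_diff_distrib add_ac mult.commute)
qed

lemma M_supp: "P \<in> LH \<Longrightarrow> M P \<in> supp_on (S_words grade)"
proof (induction P)
  case (Cons X P)
  have "Y \<in> HW" if "Y \<in> Poly_Mapping.keys (mu X)" for Y
    using mu_keys_HW[OF lists_LI(1) that] Cons by simp
  with Cons show ?case
    by (auto intro!: supp_on_intros dest: supp_onD simp: S_words_def)
qed (simp add: supp_on_intros)

lemma M_keys: 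
  assumes "P \<in> LH" "Q \<in> Poly_Mapping.keys (M P)"
  shows "Q \<in> S_words grade" "Q \<in> LH"
  using supp_onD[OF M_supp assms(2)] assms(1) by (simp_all add: S_words_def)

lemma M_SR:
  assumes "r \<in> SR"
  shows "lin_ext M r \<in> SR"
proof -
  \<comment> \<open>The invariant includes \<open>r \<in> SR\<close>: when a word \<open>X\<close>
    is prepended, the summand in which \<open>mu\<close> hits \<open>X\<close> leaves
    \<open>r\<close> itself.\<close>
  have "r \<in> SR \<inter> {r. lin_ext M r \<in> SR}"
    using assms
  proof (rule SR_induct_Cons)
    show "pm.subspace (SR \<inter> {r. lin_ext M r \<in> SR})"
      by (intro pm.subspace_inter subspace_lin_ext_vimage SR_subspace)
  next
    fix h Q assume h: "h \<in> HR" and Q: "Q \<in> LH"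
    have "lin_ext (\<lambda>Y. basis (Y # Q)) (lin_ext mu h) \<in> SR"
      using SR_word[OF mu_HR[OF h], of "[]" Q] Q by simp
    moreover have "lin_ext (\<lambda>Q'. lin_ext (\<lambda>X. signed (wdeg X) (basis (X # Q'))) h) (M Q) \<in> SR"
    proof (rule lin_ext_in_subspace[OF SR_subspace])
      fix Q' assume "Q' \<in> Poly_Mapping.keys (M Q)"
      then show "lin_ext (\<lambda>X. signed (wdeg X) (basis (X # Q'))) h \<in> SR"
        using SR_word[OF twist_HR[OF h, of "\<lambda>d. d - 1"], of "[]" Q'] M_keys(2)[OF Q]
        by (simp add: wdeg_ldeg)
    qed
    ultimately show "lin_ext (\<lambda>X. basis (X # Q)) h \<in> SR \<inter> {r. lin_ext M r \<in> SR}"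
      using SR_word[OF h, of "[]" Q] Q
      by (simp add: lin_ext_swap[of _ "M Q"] pm.subspace_add SR_subspace flip: lin_ext_fun_scale)
  next
    fix X Y Q assume X: "X \<in> HW" and Y: "Y \<in> HW" and Q: "Q \<in> LH"
    have sw: "basis (A # B # C) - signed (wdeg A * wdeg B) (basis (B # A # C)) \<in> SR"
      if "A \<in> HW" "B \<in> HW" "C \<in> LH" for A B C
      using SR_swap[of "[]" C A B] that by simp
    have keys: "A \<in> Poly_Mapping.keys (mu X) \<Longrightarrow> A \<in> HW" "A \<in> Poly_Mapping.keys (mu Y) \<Longrightarrow> A \<in> HW"
      "C \<in> Poly_Mapping.keys (M Q) \<Longrightarrow> C \<in> LH" for A C
      using mu_keys_HW[OF lists_LI(1)[OF X]] mu_keys_HW[OF lists_LI(1)[OF Y]] M_keys(2)[OF Q]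
          by blast+
    \<comment> \<open>\<open>m\<close> acts on \<open>X\<close>, on \<open>Y\<close> or on
      \<open>Q\<close>. Each time the difference is a combination of swap relations, with the degree
      of the changed word in the exponent.\<close>
    have "M (X # Y # Q) - signed (wdeg X * wdeg Y) (M (Y # X # Q)) =
      lin_ext (\<lambda>X'. basis (X' # Y # Q) - signed (wdeg X' * wdeg Y) (basis (Y # X' # Q))) (mu X) +
      signed (wdeg X) (lin_ext (\<lambda>Y'. basis (X # Y' # Q) -
          signed (wdeg X * wdeg Y') (basis (Y' # X # Q))) (mu Y)) +
      signed (wdeg X + wdeg Y) (lin_ext (\<lambda>Q'. basis (X # Y # Q') -
          signed (wdeg X * wdeg Y) (basis (Y # X # Q'))) (M Q))"
      by (cases "even (wdeg X)"; cases "even (wdeg Y)")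
        (simp_all add: signed_if wdeg_ldeg mu_word_keys)
    also have "\<dots> \<in> SR"
      by (intro pm.subspace_add pm.subspace_scale SR_subspace lin_ext_in_subspace sw)
        (simp_all add: keys X Y Q del: in_lists_conv_set)
    finally show "basis (X # Y # Q) - signed (wdeg X * wdeg Y) (basis (Y # X # Q))
        \<in> SR \<inter> {r. lin_ext M r \<in> SR}"
      using SR_swap[of "[]" Q X Y] X Y Q by (simp del: m_sword_Cons)
  next
    fix X r assume X: "X \<in> HW" and r: "r \<in> SR \<inter> {r. lin_ext M r \<in> SR}"
    have "lin_ext (\<lambda>Y. lin_ext (\<lambda>P. basis (Y # P)) r) (mu X) \<in> SR"
    proof (rule lin_ext_in_subspace[OF SR_subspace], rule SR_Cons)
      fix Y assume "Y \<in> Poly_Mapping.keys (mu X)"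
      then show "Y \<in> HW"
        by (rule mu_keys_HW[OF lists_LI(1)[OF X]])
    qed (use r in simp)
    moreover have "signed (wdeg X) (lin_ext (\<lambda>P. basis (X # P)) (lin_ext M r)) \<in> SR"
      using r X by (intro pm.subspace_scale SR_subspace SR_Cons) auto
    ultimately show "lin_ext (\<lambda>P. basis (X # P)) r \<in> SR \<inter> {r. lin_ext M r \<in> SR}"
      using r X SR_Cons by (simp add: lin_ext_swap[of _ "mu X"] pm.subspace_add SR_subspace)
  qed
  then show ?thesis by simp
qed

section \<open>Relations on pairs and quadruples, and the descent of \<open>unsh\<close> and
  \<open>cobr\<close>\<close>

definition PR :: "('g sword \<times> 'g sword \<Rightarrow>\<^sub>0 'k) set"
  where "PR = pm.span
    ({lin_ext (\<lambda>I. basis (I, J)) r | r J. r \<in> SR \<and> J \<in> LH} \<union>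
     {lin_ext (\<lambda>J. basis (I, J)) r | r I. r \<in> SR \<and> I \<in> LH})"

text \<open>\<open>I\<close> and \<open>J\<close> may be empty, so the outer factors range over
  \<open>LH\<close>. The middle pair is divided by \<open>HH\<close> as a block, since that is where
  \<open>delta\<close> sends relations.\<close>

definition QR :: "('g quad \<Rightarrow>\<^sub>0 'k) set"
  where "QR = pm.span
    ({lin_ext (\<lambda>I. basis (I, U, V, J)) r | r U V J. r \<in> SR \<and> U \<in> HW \<and> V \<in> HW \<and> J \<in> LH} \<union>
     {lin_ext (\<lambda>b. basis (I, fst b, snd b, J)) d | d I J. d \<in> HH \<and> I \<in> LH \<and> J \<in> LH} \<union>
     {lin_ext (\<lambda>J. basis (I, U, V, J)) r | r I U V. r \<in> SR \<and> I \<in> LH \<and> U \<in> HW \<and> V \<in> HW})"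

lemma PR_subspace: "pm.subspace PR"
  by (simp add: PR_def)

lemma QR_subspace: "pm.subspace QR"
  by (simp add: QR_def)

lemma PR_base:
  "r \<in> SR \<Longrightarrow> J \<in> LH \<Longrightarrow> lin_ext (\<lambda>I. basis (I, J)) r \<in> PR"
  "r \<in> SR \<Longrightarrow> I \<in> LH \<Longrightarrow> lin_ext (\<lambda>J. basis (I, J)) r \<in> PR"
  unfolding PR_def by (rule pm.span_base, blast)+

lemma QR_base:
  "r \<in> SR \<Longrightarrow> U \<in> HW \<Longrightarrow> V \<in> HW \<Longrightarrow> J \<in> LH \<Longrightarrow> lin_ext (\<lambda>I. basis (I, U, V, J)) r \<in> QR"
  "d \<in> HH \<Longrightarrow> I \<in> LH \<Longrightarrow> J \<in> LH \<Longrightarrow> lin_ext (\<lambda>b. basis (I, fst b, snd b, J)) d \<in> QR"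
  "r \<in> SR \<Longrightarrow> I \<in> LH \<Longrightarrow> U \<in> HW \<Longrightarrow> V \<in> HW \<Longrightarrow> lin_ext (\<lambda>J. basis (I, U, V, J)) r \<in> QR"
  unfolding QR_def by (rule pm.span_base, blast)+

lemma PR_induct:
  assumes "x \<in> PR" "pm.subspace W"
    and "\<And>r J. r \<in> SR \<Longrightarrow> J \<in> LH \<Longrightarrow> lin_ext (\<lambda>I. f (I, J)) r \<in> W"
    and "\<And>r I. r \<in> SR \<Longrightarrow> I \<in> LH \<Longrightarrow> lin_ext (\<lambda>J. f (I, J)) r \<in> W"
  shows "lin_ext f x \<in> W"
  using assms(1) unfolding PR_def
  by (rule lin_ext_span_in_subspace[OF _ assms(2)], elim UnE CollectE exE conjE)
    (simp_all add: assms(3,4))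

lemma QR_induct:
  assumes "x \<in> QR" "pm.subspace W"
    and "\<And>r U V J. r \<in> SR \<Longrightarrow> U \<in> HW \<Longrightarrow> V \<in> HW \<Longrightarrow> J \<in> LH \<Longrightarrow> lin_ext (\<lambda>I. f (I, U, V, J)) r \<in> W"
    and "\<And>d I J. d \<in> HH \<Longrightarrow> I \<in> LH \<Longrightarrow> J \<in> LH \<Longrightarrow> lin_ext (\<lambda>b. f (I, fst b, snd b, J)) d \<in> W"
    and "\<And>r I U V. r \<in> SR \<Longrightarrow> I \<in> LH \<Longrightarrow> U \<in> HW \<Longrightarrow> V \<in> HW \<Longrightarrow> lin_ext (\<lambda>J. f (I, U, V, J)) r \<in> W"
  shows "lin_ext f x \<in> W"
  using assms(1) unfolding QR_def
  by (rule lin_ext_span_in_subspace[OF _ assms(2)], elim UnE CollectE exE conjE)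
    (simp_all add: assms(3-5))

lemma HH_induct:
  assumes "x \<in> HH" "pm.subspace W"
    and "\<And>h V. h \<in> HR \<Longrightarrow> V \<in> HW \<Longrightarrow> lin_ext (\<lambda>U. f (U, V)) h \<in> W"
    and "\<And>h U. h \<in> HR \<Longrightarrow> U \<in> HW \<Longrightarrow> lin_ext (\<lambda>V. f (U, V)) h \<in> W"
  shows "lin_ext f x \<in> W"
  using assms(1) unfolding HH_def
  by (rule lin_ext_span_in_subspace[OF _ assms(2)], elim UnE CollectE exE conjE)
    (simp_all add: assms(3,4))

text \<open>Needed where a word passes \<open>U\<close> and \<open>V\<close> together: the sign
  depends on their total degree.\<close>

lemma twist_HH:
  assumes "d \<in> HH"
  shows "lin_ext (\<lambda>b. signed (s (wdeg (fst b) + wdeg (snd b))) (basis b)) d \<in> HH"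
  using assms
proof (rule HH_induct[OF _ HH_subspace])
  fix h V assume "h \<in> HR" "V \<in> HW"
  then show "lin_ext (\<lambda>U. signed (s (wdeg (fst (U, V)) + wdeg (snd (U, V)))) (basis (U, V))) h \<in> HH"
    using HH_base(1)[OF twist_HR[of h "\<lambda>e. s (e - 1 + wdeg V)"], of V]
    by (simp add: wdeg_ldeg)
next
  fix h U assume "h \<in> HR" "U \<in> HW"
  then show "lin_ext (\<lambda>V. signed (s (wdeg (fst (U, V)) + wdeg (snd (U, V)))) (basis (U, V))) h \<in> HH"
    using HH_base(2)[OF twist_HR[of h "\<lambda>e. s (wdeg U + (e - 1))"], of U]
    by (simp add: wdeg_ldeg)
qed

lemma ins_pair_PR:
  assumes "x \<in> PR" "X \<in> HW"
  shows "lin_ext (\<lambda>(I, J). ins_pair X I J) x \<in> PR"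
  using assms(1)
proof (rule PR_induct[OF _ PR_subspace])
  fix r J assume r: "r \<in> SR" and J: "J \<in> LH"
  have "lin_ext (\<lambda>I. basis (X # I, J)) r \<in> PR"
    using PR_base(1)[OF SR_Cons[OF r assms(2)] J] by simp
  moreover have "lin_ext (\<lambda>I. signed (wdeg X * sdeg I) (basis (I, X # J))) r \<in> PR"
    using PR_base(1)[OF twist_SR[OF r, of "\<lambda>e. wdeg X * e"], of "X # J"] J assms(2) by simp
  ultimately show "lin_ext (\<lambda>I. case (I, J) of (I, J) \<Rightarrow> ins_pair X I J) r \<in> PR"
    by (simp add: ins_pair_def pm.subspace_add PR_subspace)
next
  fix r I assume r: "r \<in> SR" and I: "I \<in> LH"
  then show "lin_ext (\<lambda>J. case (I, J) of (I, J) \<Rightarrow> ins_pair X I J) r \<in> PR"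
    using PR_base(2)[OF r, of "X # I"] PR_base(2)[OF SR_Cons[OF r assms(2)] I] assms(2)
    by (simp add: ins_pair_def pm.subspace_add pm.subspace_scale PR_subspace)
qed

lemma ins_quad_QR:
  assumes "x \<in> QR" "X \<in> HW"
  shows "lin_ext (\<lambda>(I, U, V, J). ins_quad X I U V J) x \<in> QR"
  using assms(1)
proof (rule QR_induct[OF _ QR_subspace])
  fix r U V J assume r: "r \<in> SR" and *: "U \<in> HW" "V \<in> HW" "J \<in> LH"
  have "lin_ext (\<lambda>I. basis (X # I, U, V, J)) r \<in> QR"
    using QR_base(1)[OF SR_Cons[OF r assms(2)] *] by simp
  moreover have "lin_ext (\<lambda>I. signed (wdeg X * (sdeg I + wdeg U +
      wdeg V)) (basis (I, U, V, X # J))) r \<in> QR"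
    using QR_base(1)[OF twist_SR[OF r, of "\<lambda>e. wdeg X * (e + wdeg U +
        wdeg V)"] *(1,2), of "X # J"] *(3) assms(2)
    by simp
  ultimately show "lin_ext (\<lambda>I. case (I, U, V, J) of (I, U, V, J) \<Rightarrow> ins_quad X I U V J) r \<in> QR"
    by (simp add: ins_quad_def pm.subspace_add QR_subspace)
next
  fix d I J assume d: "d \<in> HH" and *: "I \<in> LH" "J \<in> LH"
  have "lin_ext (\<lambda>b. basis (X # I, fst b, snd b, J)) d \<in> QR"
    using QR_base(2)[OF d, of "X # I" J] * assms(2) by simp
  moreover have "lin_ext (\<lambda>b. signed (wdeg X * (sdeg I + wdeg (fst b) +
      wdeg (snd b))) (basis (I, fst b, snd b, X # J))) d \<in> QR"
    using QR_base(2)[OF twist_HH[OF d, of "\<lambda>e. wdeg X * (sdeg I +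
        e)"] *(1), of "X # J"] *(2) assms(2)
    by (simp add: add.assoc)
  ultimately show "lin_ext (\<lambda>b. case (I, fst b, snd b, J) of (I, U, V, J) \<Rightarrow> ins_quad X I U V J) d
      \<in> QR"
    by (simp add: ins_quad_def pm.subspace_add QR_subspace)
next
  fix r I U V assume r: "r \<in> SR" and *: "I \<in> LH" "U \<in> HW" "V \<in> HW"
  then show "lin_ext (\<lambda>J. case (I, U, V, J) of (I, U, V, J) \<Rightarrow> ins_quad X I U V J) r \<in> QR"
    using QR_base(3)[OF r, of "X # I" U V] QR_base(3)[OF SR_Cons[OF r assms(2)] *] assms(2)
    by (simp add: ins_quad_def pm.subspace_add pm.subspace_scale QR_subspace)
qed

lemma delta_keys_HW: "X \<in> HW \<Longrightarrow> b \<in> Poly_Mapping.keys (delta X :: _ \<Rightarrow>\<^sub>0 'k) \<Longrightarrow> fst b \<in> HW \<and> snd b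
    \<in> HW"
  using supp_onD[OF delta_supp[OF lists_LI(1)], of X b] by (simp add: mem_Times_iff)

lemma split_quad_PR:
  assumes "x \<in> PR" "X \<in> HW"
  shows "lin_ext (\<lambda>(I, J). split_quad X I J) x \<in> QR"
  using assms(1)
proof (rule PR_induct[OF _ QR_subspace])
  fix r J assume r: "r \<in> SR" and J: "J \<in> LH"
  have "lin_ext (\<lambda>b. lin_ext (\<lambda>I. signed ((wdeg X -
      1) * sdeg I) (basis (I, fst b, snd b, J))) r) (delta X) \<in> QR"
  proof (rule lin_ext_in_subspace[OF QR_subspace])
    fix b assume "b \<in> Poly_Mapping.keys (delta X :: _ \<Rightarrow>\<^sub>0 'k)"
    then show "lin_ext (\<lambda>I. signed ((wdeg X - 1) * sdeg I) (basis (I, fst b, snd b, J))) r \<in> QR"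
      using QR_base(1)[OF twist_SR[OF r, of "\<lambda>e. (wdeg X - 1) * e"], of "fst b" "snd b" J] J
        delta_keys_HW[OF assms(2)] by simp
  qed
  then show "lin_ext (\<lambda>I. case (I, J) of (I, J) \<Rightarrow> split_quad X I J) r \<in> QR"
    by (simp add: split_quad_def case_prod_unfold lin_ext_swap[of _ "delta X"] flip:
        lin_ext_fun_scale)
next
  fix r I assume r: "r \<in> SR" and I: "I \<in> LH"
  have "lin_ext (\<lambda>b. lin_ext (\<lambda>J. basis (I, fst b, snd b, J)) r) (delta X) \<in> QR"
  proof (rule lin_ext_in_subspace[OF QR_subspace])
    fix b assume "b \<in> Poly_Mapping.keys (delta X :: _ \<Rightarrow>\<^sub>0 'k)"
    then show "lin_ext (\<lambda>J. basis (I, fst b, snd b, J)) r \<in> QR"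
      using QR_base(3)[OF r I] delta_keys_HW[OF assms(2)] by simp
  qed
  then show "lin_ext (\<lambda>J. case (I, J) of (I, J) \<Rightarrow> split_quad X I J) r \<in> QR"
    by (simp add: split_quad_def case_prod_unfold lin_ext_swap[of _ "delta X"] pm.subspace_scale
        QR_subspace)
qed

lemma unsh_supp: "P \<in> LH \<Longrightarrow> (unsh P :: _ \<Rightarrow>\<^sub>0 'k) \<in> supp_on (LH \<times> LH)"
proof (induction P)
  case (Cons X P)
  then show ?case
    by (auto intro!: supp_on_intros dest!: supp_onD simp: ins_pair_def)
qed simp

lemma unsh_keys: "P \<in> LH \<Longrightarrow> b \<in> Poly_Mapping.keys (unsh P :: _ \<Rightarrow>\<^sub>0 'k) \<Longrightarrow> fst b \<in> LH \<and> snd b \<in> LH"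
  using supp_onD[OF unsh_supp, of P b] by (simp add: mem_Times_iff)

lemma cobr_supp: "P \<in> LH \<Longrightarrow> (cobr P :: _ \<Rightarrow>\<^sub>0 'k) \<in> supp_on (LH \<times> HW \<times> HW \<times> LH)"
proof (induction P)
  case (Cons X P)
  let ?A = "LH \<times> HW \<times> HW \<times> LH"
  have X: "X \<in> HW" and P: "P \<in> LH"
    using Cons.prems by auto
  have "lin_ext (\<lambda>(I, J). split_quad X I J) (unsh P :: _ \<Rightarrow>\<^sub>0 'k) \<in> supp_on ?A"
    unfolding split_quad_def case_prod_unfold
  proof (intro supp_on_intros(3,4))
    fix b c assume "b \<in> Poly_Mapping.keys (unsh P :: _ \<Rightarrow>\<^sub>0 'k)" "c
        \<in> Poly_Mapping.keys (delta X :: _ \<Rightarrow>\<^sub>0 'k)"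
    then show "basis (fst b, fst c, snd c, snd b) \<in> supp_on ?A"
      using unsh_keys[OF P] delta_keys_HW[OF X] by simp
  qed
  moreover have "lin_ext (\<lambda>(I, U, V, J). ins_quad X I U V J) (cobr P :: _ \<Rightarrow>\<^sub>0 'k) \<in> supp_on ?A"
  proof (rule supp_on_intros(4))
    fix b assume "b \<in> Poly_Mapping.keys (cobr P :: _ \<Rightarrow>\<^sub>0 'k)"
    then have "b \<in> ?A"
      by (rule supp_onD[OF Cons.IH[OF P]])
    then show "(case b of (I, U, V, J) \<Rightarrow> ins_quad X I U V J) \<in> supp_on ?A"
      using X by (cases b) (simp add: ins_quad_def supp_on_intros)
  qed
  ultimately show ?case
    by (simp add: supp_on_intros)
qed (simp add: supp_on_intros)

lemma cobr_SR:
  assumes "r \<in> SR"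
  shows "lin_ext cobr r \<in> QR"
proof -
  \<comment> \<open>\<open>cobr\<close> of a list calls \<open>unsh\<close> of its tail, so both
    claims are proved together.\<close>
  have "r \<in> {r. lin_ext unsh r \<in> PR} \<inter> {r. lin_ext cobr r \<in> QR}"
    using assms
  proof (rule SR_induct_Cons)
    show "pm.subspace ({r. lin_ext unsh r \<in> PR} \<inter> {r. lin_ext cobr r \<in> QR})"
      by (intro pm.subspace_inter subspace_lin_ext_vimage PR_subspace QR_subspace)
  next
    fix h Q assume h: "h \<in> HR" and Q: "Q \<in> LH"
    have hSR: "lin_ext (\<lambda>X. signed (s (wdeg X)) (basis (X # I))) h \<in> SR" if "I \<in> LH" for I s
      using SR_word[OF twist_HR[OF h, of "\<lambda>e. s (e - 1)"], of "[]" I] that by (simp add: wdeg_ldeg)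
    have hSR0: "lin_ext (\<lambda>X. basis (X # I)) h \<in> SR" if "I \<in> LH" for I
      using SR_word[OF h, of "[]" I] that by simp
    have "lin_ext (\<lambda>b. lin_ext (\<lambda>X. ins_pair X (fst b) (snd b)) h) (unsh Q) \<in> PR"
    proof (rule lin_ext_in_subspace[OF PR_subspace])
      fix b assume "b \<in> Poly_Mapping.keys (unsh Q :: _ \<Rightarrow>\<^sub>0 'k)"
      then have b: "fst b \<in> LH" "snd b \<in> LH"
        using unsh_keys[OF Q] by blast+
      show "lin_ext (\<lambda>X. ins_pair X (fst b) (snd b)) h \<in> PR"
        using PR_base(1)[OF hSR0[OF b(1)] b(2)]
          PR_base(2)[OF hSR[OF b(2), of "\<lambda>e. e * sdeg (fst b)"] b(1)]
        by (simp add: ins_pair_def pm.subspace_add PR_subspace)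
    qed
    moreover have "lin_ext (\<lambda>b. lin_ext (\<lambda>X. split_quad X (fst b) (snd b)) h) (unsh Q) \<in> QR"
    proof (rule lin_ext_in_subspace[OF QR_subspace])
      fix b assume "b \<in> Poly_Mapping.keys (unsh Q :: _ \<Rightarrow>\<^sub>0 'k)"
      then have b: "fst b \<in> LH" "snd b \<in> LH"
        using unsh_keys[OF Q] by blast+
      show "lin_ext (\<lambda>X. split_quad X (fst b) (snd b)) h \<in> QR"
        \<comment> \<open>The exponent is \<open>wdeg X - 1\<close> in terms of
          \<open>ldeg X\<close>: one shift from \<open>wdeg\<close>, one from splitting.\<close>
        using QR_base(2)[OF delta_HR[OF twist_HR[OF h, of "\<lambda>e. (e - 1 - 1) * sdeg (fst b)"]] b]
        by (simp add: split_quad_def case_prod_unfold wdeg_ldeg)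
    qed
    moreover have "lin_ext (\<lambda>b. lin_ext (\<lambda>X. signed (wdeg X) (ins_quad X (fst b) (fst (snd b))
        (fst (snd (snd b))) (snd (snd (snd b))))) h) (cobr Q) \<in> QR"
    proof (rule lin_ext_in_subspace[OF QR_subspace])
      fix b assume b: "b \<in> Poly_Mapping.keys (cobr Q :: _ \<Rightarrow>\<^sub>0 'k)"
      obtain I U V J where b_eq: "b = (I, U, V, J)" by (cases b)
      have *: "I \<in> LH" "U \<in> HW" "V \<in> HW" "J \<in> LH"
        using supp_onD[OF cobr_supp[OF Q] b] by (simp_all add: b_eq)
      show "lin_ext (\<lambda>X. signed (wdeg X) (ins_quad X (fst b) (fst (snd b)) (fst (snd (snd b)))
          (snd (snd (snd b))))) h \<in> QR"
        \<comment> \<open>For \<open>X\<close> put in front of \<open>J\<close>, the prefactor of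
          \<open>cobr\<close> and the sign of passing \<open>I\<close>, \<open>U\<close>,
          \<open>V\<close> are merged into one exponent, so that a single twist suffices.\<close>
        using QR_base(1)[OF hSR[OF *(1), of "\<lambda>e. e"] *(2-4)]
          QR_base(3)[OF hSR[OF *(4), of "\<lambda>e. e + e * (sdeg I + wdeg U + wdeg V)"] *(1-3)]
        by (simp add: b_eq ins_quad_def pm.scale_right_distrib pm.subspace_add QR_subspace
            power_int_add)
    qed
    ultimately show "lin_ext (\<lambda>X. basis (X # Q)) h \<in> {r. lin_ext unsh r \<in> PR} \<inter> {r. lin_ext cobr r
        \<in> QR}"
      by (simp add: case_prod_unfold lin_ext_swap[of _ "unsh Q"] lin_ext_swap[of _ "cobr Q"]
          pm.subspace_add QR_subspace flip: lin_ext_fun_scale)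
  next
    fix X Y Q assume X: "X \<in> HW" and Y: "Y \<in> HW" and Q: "Q \<in> LH"
    have sw: "basis (X # Y # P) - signed (wdeg X * wdeg Y) (basis (Y # X # P)) \<in> SR"
        if "P \<in> LH" for P
      using SR_swap[of "[]" P X Y] that X Y by simp
    have "unsh (X # Y # Q) - signed (wdeg X * wdeg Y) (unsh (Y # X # Q)) \<in> PR"
      unfolding unsh_swap case_prod_unfold
    proof (rule lin_ext_in_subspace[OF PR_subspace])
      fix b assume "b \<in> Poly_Mapping.keys (unsh Q :: _ \<Rightarrow>\<^sub>0 'k)"
      then have b: "fst b \<in> LH" "snd b \<in> LH"
        using unsh_keys[OF Q] by blast+
      show "lin_ext (\<lambda>p. ins_pair X (fst p) (snd p)) (ins_pair Y (fst b) (snd b)) -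
          signed (wdeg X * wdeg Y) (lin_ext (\<lambda>p. ins_pair Y (fst p) (snd p)) (ins_pair X (fst b)
              (snd b))) \<in> PR"
        unfolding ins_pair_swap[unfolded case_prod_unfold]
        using PR_base(1)[OF sw[OF b(1)] b(2)] PR_base(2)[OF sw[OF b(2)] b(1)]
        by (intro pm.subspace_add pm.subspace_scale PR_subspace) simp_all
    qed
    moreover have "cobr (X # Y # Q) - signed (wdeg X * wdeg Y) (cobr (Y # X # Q)) \<in> QR"
      unfolding cobr_swap
    proof (intro pm.subspace_scale[OF QR_subspace] lin_ext_in_subspace[OF QR_subspace])
      fix b assume b: "b \<in> Poly_Mapping.keys (cobr Q :: _ \<Rightarrow>\<^sub>0 'k)"
      obtain I U V J where b_eq: "b = (I, U, V, J)" by (cases b)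
      have *: "I \<in> LH" "U \<in> HW" "V \<in> HW" "J \<in> LH"
        using supp_onD[OF cobr_supp[OF Q] b] by (simp_all add: b_eq)
      show "(case b of (I, U, V, J) \<Rightarrow>
          lin_ext (\<lambda>(I, U, V, J). ins_quad X I U V J) (ins_quad Y I U V J) -
          signed (wdeg X * wdeg Y) (lin_ext (\<lambda>(I, U, V, J). ins_quad Y I U V J) (ins_quad X I U V
              J))) \<in> QR"
        unfolding b_eq prod.case ins_quad_swap
        using QR_base(1)[OF sw[OF *(1)] *(2-4)] QR_base(3)[OF sw[OF *(4)] *(1-3)]
        by (intro pm.subspace_add pm.subspace_scale QR_subspace) simp_all
    qed
    ultimately show "basis (X # Y # Q) - signed (wdeg X * wdeg Y) (basis (Y # X # Q)) \<in>
        {r. lin_ext unsh r \<in> PR} \<inter> {r. lin_ext cobr r \<in> QR}"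
      by (simp del: unsh.simps cobr.simps)
  next
    fix X r assume X: "X \<in> HW" and r: "r \<in> {r. lin_ext unsh r \<in> PR} \<inter> {r. lin_ext cobr r \<in> QR}"
    have "lin_ext (\<lambda>(I, J). split_quad X I J) (lin_ext unsh r) +
        signed (wdeg X) (lin_ext (\<lambda>(I, U, V, J). ins_quad X I U V J) (lin_ext cobr r)) \<in> QR"
      using r X by (intro pm.subspace_add pm.subspace_scale QR_subspace split_quad_PR
          ins_quad_QR) auto
    moreover have "lin_ext (\<lambda>(I, J). ins_pair X I J) (lin_ext unsh r) \<in> PR"
      using r X by (intro ins_pair_PR) auto
    ultimately show "lin_ext (\<lambda>P. basis (X # P)) r \<in> {r. lin_ext unsh r \<in> PR} \<inter> {r. lin_ext cobr r
        \<in> QR}"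
      by simp
  qed
  then show ?thesis by simp
qed

section \<open>Descent to the tensor square of the symmetric algebra\<close>

lemma SSR_base:
  "r \<in> SR \<Longrightarrow> Q \<in> S_words grade \<Longrightarrow> lin_ext (\<lambda>P. basis (P, Q)) r \<in> SSR"
  "r \<in> SR \<Longrightarrow> P \<in> S_words grade \<Longrightarrow> lin_ext (\<lambda>Q. basis (P, Q)) r \<in> SSR"
  unfolding SS_rel_def by (rule pm.span_base, blast)+

lemma SSR_induct:
  assumes "x \<in> SSR" "pm.subspace W"
    and "\<And>r Q. r \<in> SR \<Longrightarrow> Q \<in> S_words grade \<Longrightarrow> lin_ext (\<lambda>P. f (P, Q)) r \<in> W"
    and "\<And>r P. r \<in> SR \<Longrightarrow> P \<in> S_words grade \<Longrightarrow> lin_ext (\<lambda>Q. f (P, Q)) r \<in> W"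
  shows "lin_ext f x \<in> W"
  using assms(1) unfolding SS_rel_def
  by (rule lin_ext_span_in_subspace[OF _ assms(2)], elim UnE CollectE exE conjE)
    (simp_all add: assms(3,4))

lemma S_wordsI: "P \<in> LH \<Longrightarrow> U \<in> HW \<Longrightarrow> P @ [U] \<in> S_words grade" "P \<in> LH \<Longrightarrow> U \<in> HW \<Longrightarrow> U # P
    \<in> S_words grade"
  by (simp_all add: S_words_def)

text \<open>\<open>I @ [U]\<close> and \<open>V # J\<close> are nonempty even for empty
  \<open>I\<close> or \<open>J\<close>, so joining lands in the symmetric algebra without
  unit.\<close>

lemma join_quad_QR:
  assumes "x \<in> QR"
  shows "lin_ext (\<lambda>b. basis (join_quad b)) x \<in> SSR"
  using assms
proof (rule QR_induct[OF _ SSR_subspace])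
  fix r U V J assume "r \<in> SR" "U \<in> HW" "V \<in> HW" "J \<in> LH"
  then show "lin_ext (\<lambda>I. basis (join_quad (I, U, V, J))) r \<in> SSR"
    using SSR_base(1)[OF SR_snoc[of r U] S_wordsI(2)] by (simp add: join_quad_def)
next
  fix r I U V assume "r \<in> SR" "I \<in> LH" "U \<in> HW" "V \<in> HW"
  then show "lin_ext (\<lambda>J. basis (join_quad (I, U, V, J))) r \<in> SSR"
    using SSR_base(2)[OF SR_Cons[of r V] S_wordsI(1)] by (simp add: join_quad_def)
next
  fix d I J assume d: "d \<in> HH" and I: "I \<in> LH" and J: "J \<in> LH"
  show "lin_ext (\<lambda>b. basis (join_quad (I, fst b, snd b, J))) d \<in> SSR"
    using d
  proof (rule HH_induct[OF _ SSR_subspace])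
    fix h V assume "h \<in> HR" "V \<in> HW"
    then show "lin_ext (\<lambda>U. basis (join_quad (I, fst (U, V), snd (U, V), J))) h \<in> SSR"
      using SSR_base(1)[OF SR_word[of h I "[]"] S_wordsI(2)[OF J]] I by (simp add: join_quad_def)
  next
    fix h U assume "h \<in> HR" "U \<in> HW"
    then show "lin_ext (\<lambda>V. basis (join_quad (I, fst (U, V), snd (U, V), J))) h \<in> SSR"
      using SSR_base(2)[OF SR_word[of h "[]" J] S_wordsI(1)[OF I]] J by (simp add: join_quad_def)
  qed
qed

lemma kappa_SR: "r \<in> SR \<Longrightarrow> lin_ext kappa_sword r \<in> SSR"
  using join_quad_QR[OF cobr_SR] by (simp add: kappa_sword_cobr)

lemma id_tensor_SSR:
  assumes "x \<in> SSR"
  shows "lin_ext (tensor_map 1 basis M) x \<in> SSR"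
  using assms
proof (rule SSR_induct[OF _ SSR_subspace])
  fix r Q assume r: "r \<in> SR" and Q: "Q \<in> S_words grade"
  have "lin_ext (\<lambda>Q'. lin_ext (\<lambda>P. signed (sdeg P) (basis (P, Q'))) r) (M Q) \<in> SSR"
  proof (rule lin_ext_in_subspace[OF SSR_subspace])
    fix Q' assume "Q' \<in> Poly_Mapping.keys (M Q)"
    then have "Q' \<in> S_words grade"
      using M_keys(1) Q by (auto simp: S_words_def)
    then show "lin_ext (\<lambda>P. signed (sdeg P) (basis (P, Q'))) r \<in> SSR"
      using SSR_base(1)[OF twist_SR[OF r, of "\<lambda>e. e"]] by simp
  qed
  then show "lin_ext (\<lambda>P. tensor_map 1 basis M (P, Q)) r \<in> SSR"
    by (simp add: tensor_map_def lin_ext_swap[of _ "M Q"] flip: lin_ext_fun_scale)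
next
  fix r P assume "r \<in> SR" "P \<in> S_words grade"
  then show "lin_ext (\<lambda>Q. tensor_map 1 basis M (P, Q)) r \<in> SSR"
    using SSR_base(2)[OF M_SR[of r]]
    by (simp add: tensor_map_def pm.subspace_scale SSR_subspace)
qed

lemma tensor_id_SSR:
  assumes "x \<in> SSR"
  shows "lin_ext (tensor_map 0 M basis) x \<in> SSR"
  using assms
proof (rule SSR_induct[OF _ SSR_subspace])
  fix r Q assume "r \<in> SR" "Q \<in> S_words grade"
  then show "lin_ext (\<lambda>P. tensor_map 0 M basis (P, Q)) r \<in> SSR"
    using SSR_base(1)[OF M_SR[of r]] by (simp add: tensor_map_def)
next
  fix r P assume r: "r \<in> SR" and P: "P \<in> S_words grade"
  have "lin_ext (\<lambda>P'. lin_ext (\<lambda>Q. basis (P', Q)) r) (M P) \<in> SSR"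
    using M_keys(1) P r by (intro lin_ext_in_subspace[OF SSR_subspace] SSR_base) (auto simp:
        S_words_def)
  then show "lin_ext (\<lambda>Q. tensor_map 0 M basis (P, Q)) r \<in> SSR"
    by (simp add: tensor_map_def lin_ext_swap[of _ "M P"])
qed

text \<open>\<open>m_sword_append\<close> expands \<open>m\<close> on \<open>I @ [U]\<close> and on
  \<open>V # J\<close>. The exponent of \<open>id \<otimes> m\<close> is
  \<open>sdeg I + wdeg U\<close>, exactly what \<open>m\<close> collects in passing \<open>I\<close>
  and \<open>U\<close>.\<close>

lemma tensor_join_quad:
  "tensor_map 1 basis M (join_quad b) + tensor_map 0 M basis (join_quad b) =
    lin_ext (\<lambda>b. basis (join_quad b)) (case b of (I, U, V, J) \<Rightarrow> m_quad scale wedge I U V J)"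
  by (cases b) (simp add: tensor_map_def join_quad_def m_quad_def m_word_pair_def m_sword_append
      case_prod_unfold power_int_add pm.scale_right_distrib algebra_simps)

lemma tensor_kappa:
  "lin_ext (tensor_map 1 basis M) (lin_ext kappa_sword x) +
    lin_ext (tensor_map 0 M basis) (lin_ext kappa_sword x) =
    - lin_ext kappa_sword (lin_ext M x)"
proof -
  have "lin_ext (tensor_map 1 basis M) (kappa_sword P) +
      lin_ext (tensor_map 0 M basis) (kappa_sword P) =
      - lin_ext kappa_sword (M P)" for P
  proof -
    have "lin_ext (tensor_map 1 basis M) (kappa_sword P) +
        lin_ext (tensor_map 0 M basis) (kappa_sword P) =
        lin_ext (\<lambda>b. tensor_map 1 basis M (join_quad b) +
            tensor_map 0 M basis (join_quad b)) (cobr P)"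
      by (simp add: kappa_sword_cobr)
    also have "\<dots> = lin_ext (\<lambda>b. basis (join_quad b)) (lin_ext (\<lambda>(I, U, V, J). m_quad scale wedge
        I U V J) (cobr P))"
      unfolding tensor_join_quad by (simp add: case_prod_unfold)
    also have "\<dots> = - lin_ext kappa_sword (M P)"
      unfolding m_quad_cobr by (simp add: kappa_sword_cobr[abs_def])
    finally show ?thesis .
  qed
  then show ?thesis
    by (simp flip: lin_ext_fun_add)
qed

end

section \<open>Passage to cosets\<close>

lemma induced_coset:
  assumes "pm.subspace R" "pm.subspace R'" "\<And>r. r \<in> R \<Longrightarrow> lin_ext f r \<in> R'"
  shows "induced R' (lin_ext f) (x +o R) = lin_ext f x +o R'"
proof (intro set_eqI iffI)
  fix y assume "y \<in> induced R' (lin_ext f) (x +o R)"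
  then obtain r r' where "r \<in> R" "r' \<in> R'" "y = lin_ext f (x + r) + r'"
    by (auto simp: induced_def elt_set_plus_def set_plus_def)
  then show "y \<in> lin_ext f x +o R'"
    using assms(2,3) by (auto simp: elt_set_plus_def add.assoc intro!: bexI pm.subspace_add)
next
  \<comment> \<open>Since \<open>0 \<in> R\<close>, the representative \<open>x\<close> alone
    already produces the whole coset.\<close>
  fix y assume "y \<in> lin_ext f x +o R'"
  then show "y \<in> induced R' (lin_ext f) (x +o R)"
    using pm.subspace_0[OF assms(1)]
    by (force simp: induced_def elt_set_plus_def set_plus_def image_iff)
qed

theorem proposition6p2:
  fixes scale :: "'k::field_char_0 \<Rightarrow> 'g::ab_group_add \<Rightarrow> 'g"
    and grade :: "int \<Rightarrow> 'g set"
    and wedge bracket :: "'g \<Rightarrow> 'g \<Rightarrow> 'g"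
    and C :: "('g sword \<Rightarrow>\<^sub>0 'k) set"
  assumes "gerstenhaber_algebra scale grade wedge bracket"
    and "C \<in> S_plus scale grade"
  shows "id_tensor_m scale grade wedge (kappa scale grade C) +
         m_tensor_id scale grade wedge (kappa scale grade C) =
         uminus ` kappa scale grade (m_map scale grade wedge C)"
proof -
  interpret gerstenhaber_algebra scale grade wedge bracket
    by (rule assms(1))
  obtain x where C: "C = x +o SR"
    using assms(2) by (auto simp: S_plus_def quotient_space_def)
  \<comment> \<open>The operations in the claim are set operations; \<open>sum\<close> and
    \<open>neg\<close> turn them into operations on representatives, where
    \<open>tensor_kappa\<close> decides.\<close>
  have sum: "(a +o SSR) + (b +o SSR) = (a + b) +o SSR" for a b
  proof (intro set_eqI iffI)
    fix y assume "y \<in> (a +o SSR) + (b +o SSR)"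
    then obtain r s where "r \<in> SSR" "s \<in> SSR" "y = (a + b) + (r + s)"
      by (auto simp: elt_set_plus_def set_plus_def algebra_simps)
    then show "y \<in> (a + b) +o SSR"
      using SSR_subspace by (auto simp: elt_set_plus_def intro!: bexI pm.subspace_add)
  next
    fix y assume "y \<in> (a + b) +o SSR"
    then obtain r where "r \<in> SSR" "y = (a + r) + (b + 0)"
      by (auto simp: elt_set_plus_def algebra_simps)
    then show "y \<in> (a +o SSR) + (b +o SSR)"
      using pm.subspace_0[OF SSR_subspace] by (auto simp: elt_set_plus_def set_plus_def)
  qed
  have neg: "uminus ` (a +o SSR) = (- a) +o SSR" for a
  proof (intro set_eqI iffI)
    fix y assume "y \<in> uminus ` (a +o SSR)"
    then obtain r where "r \<in> SSR" "y = - a + - r"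
      by (auto simp: elt_set_plus_def)
    then show "y \<in> (- a) +o SSR"
      using pm.subspace_neg[OF SSR_subspace] by (auto simp: elt_set_plus_def)
  next
    fix y assume "y \<in> (- a) +o SSR"
    then obtain r where "r \<in> SSR" "y = - (a + - r)"
      by (auto simp: elt_set_plus_def)
    moreover from this have "- r \<in> SSR"
      by (intro pm.subspace_neg SSR_subspace)
    ultimately show "y \<in> uminus ` (a +o SSR)"
      unfolding elt_set_plus_def by blast
  qed
  show ?thesis
    unfolding C kappa_def m_map_def id_tensor_m_def m_tensor_id_def
    by (simp only: induced_coset SR_subspace SSR_subspace kappa_SR M_SR id_tensor_SSR tensor_id_SSR
        sum neg tensor_kappa)
qed

end
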